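(* Let $\tau$ be a composition type, $f\in\mathcal{D}yn_\tau$, $A$ an attracting axis of the parabolic fixed point $0$ of $Rf$, and $(V_n)_{n\in\mathbf Z}$ the associated virtual basins. Then for all $N\in\mathbf Z$, the restriction $f:V_N\to V_{N+1}$ is proper.
   Context: **Parabolic points.** $\mathcal F$ is the set of holomorphic maps $f:\mathrm{Dom}(f)\to\mathbf C$ defined on an open neighbourhood $\mathrm{Dom}(f)\subset\mathbf C$ of $0$ with $f(0)=0$, $f'(0)=1$; $\mathcal E=\{f\in\mathcal F: f''(0)=0\}$. If $f\in\mathcal F$ is not the identity near $0$, $f(z)=z(1+cz^q+\cdots)$, $c\ne0$, the half-lines $cz^q\in\mathbf R_{<0}$ are its attracting axes. The parabolic basin $B_f$ is the set of $z\in\mathrm{Dom}(f)$ such that $f^n(z)$ is defined and nonzero for all $n$ and $f^n(z)\to0$. The immediate basin $B^*_f(A)$ of an attracting axis $A$ is the connected component of $B_f$ containing an attracting petal for $A$; it is denoted $B^*_f$ if $f''(0)\ne0$ (single attracting axis). **Parabolic renormalization.** Let $E(z)=e^{2\pi iz}$, $T_\sigma(z)=z+\sigma$. Let $f\in\mathcal F\setminus\mathcal E$. The extended attracting Fatou coordinate is the holomorphic map $\phi_{\mathrm{att}}:B_f\to\mathbf C$, injective on an attracting petal, with $\phi_{\mathrm{att}}\circ f=\phi_{\mathrm{att}}+1$. A repelling Fatou coordinate $\phi_{\mathrm{rep}}$ is an injective holomorphic map on a repelling petal conjugating $f$ to $z\mapsto z+1$, whose image contains a left half-plane $\mathbf H_{<r}=\{\operatorname{Re}z<r\}$;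 $\psi_{\mathrm{rep}}=\phi_{\mathrm{rep}}^{-1}$ is extended to $\{z+n: z\in\mathbf H_{<r},\,n\in\mathbf N,\ f^n(\psi_{\mathrm{rep}}(z))\text{ defined}\}$ by $\psi_{\mathrm{rep}}(z+n)=f^n(\psi_{\mathrm{rep}}(z))$. Put $h_f=\phi_{\mathrm{att}}\circ\psi_{\mathrm{rep}}$ on $\mathrm{Dom}(h_f)=\psi_{\mathrm{rep}}^{-1}(B_f)$; it commutes with $T_1$ and its domain contains an upper half-plane. $E\circ T_\sigma\circ h_f\circ E^{-1}$ is well defined on $E(\mathrm{Dom}(h_f))$ and extends to a map $\ell_\sigma$ holomorphic at $0$ with $\ell_\sigma(0)=0$, $\ell_\sigma'(0)\neq0$. Choose $\sigma_0$ with $\ell_{\sigma_0}'(0)=1$; $Rf\in\mathcal F$ is the restriction of $\ell_{\sigma_0}$ to the connected component of its domain containing $0$. **Types.** A composition type $\tau=d_m\circ\cdots\circ d_1$ is a tuple $(d_1,\dots,d_m)$ of integers with $m\ge1$, $d_k\ge2$. $\mathcal B_\tau$ is the set of maps $G=G_m\circ\cdots\circ G_1:\mathbf D\to\mathbf D$, with $G_k$ a finite Blaschke product of degree $d_k$, such that the rational extension of $G$ has on the unit circle a parabolic fixed point with two attracting axes. $\mathcal{D}yn_\tau$ is the set of $f\in\mathcal F\setminus\mathcal E$ such that $f:B^*_f\to B^*_f$ is conformally conjugate to an element of $\mathcal B_\tau$. **Virtual basins.** Let $f\in\mathcal{D}yn_\tau$ and let $A$ be an attracting axis of $Rf$, $B^*_{Rf}=B^*_{Rf}(A)$,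 which is simply connected and does not contain $0$. Let $U_0\subset\mathbf C$ be a connected component of $E^{-1}(B^*_{Rf})$ (a simply connected lift of $B^*_{Rf}$ by $E$), $U_n=U_0+n$ for $n\in\mathbf Z$, and $V_n=\psi_{\mathrm{rep}}(U_n)$. These are open subsets of $B^*_f$ with $f(V_n)=V_{n+1}$, called virtual basins. *)

theory Defs
  imports "HOL-Complex_Analysis.Complex_Analysis"
begin

text \<open>
  A partially defined holomorphic map is given by its domain \<open>D\<close> together with a total function
  \<open>f\<close> whose values outside \<open>D\<close> are meaningless; the iterate \<open>(f ^^ n) z\<close> is defined if
  the first \<open>n\<close> points \<open>z, f z, \<dots>, (f ^^ (n - 1)) z\<close> of the orbit lie in \<open>D\<close>.
\<close>

section \<open>Parabolic points\<close>

definition parabolic_maps :: "(complex set \<times> (complex \<Rightarrow> complex)) set" where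
  "parabolic_maps =
     {(D, f). open D \<and> 0 \<in> D \<and> f holomorphic_on D \<and> f 0 = 0 \<and> deriv f 0 = 1}"

definition degenerate_parabolic_maps :: "(complex set \<times> (complex \<Rightarrow> complex)) set" where
  "degenerate_parabolic_maps = {(D, f) \<in> parabolic_maps. deriv (deriv f) 0 = 0}"

definition iterate_defined :: "complex set \<Rightarrow> (complex \<Rightarrow> complex) \<Rightarrow> nat \<Rightarrow> complex \<Rightarrow> bool" where
  "iterate_defined D f n z \<longleftrightarrow> (\<forall>k<n. (f ^^ k) z \<in> D)"

text \<open>\<open>f z = z (1 + c z^q + \<dots>)\<close> with \<open>c \<noteq> 0\<close>, for \<open>f\<close> with \<open>f 0 = 0\<close> and \<open>deriv f 0 = 1\<close>.\<close>

definition leading_term :: "(complex \<Rightarrow> complex) \<Rightarrow> nat \<Rightarrow> complex \<Rightarrow> bool" where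
  "leading_term f q c \<longleftrightarrow>
     q \<ge> 1 \<and> c \<noteq> 0 \<and> fps_nth (fps_expansion f 0) (q + 1) = c \<and>
     (\<forall>k. 2 \<le> k \<and> k \<le> q \<longrightarrow> fps_nth (fps_expansion f 0) k = 0)"

definition attracting_axes :: "(complex \<Rightarrow> complex) \<Rightarrow> complex set set" where
  "attracting_axes f =
     {A. \<exists>q c u. leading_term f q c \<and> u \<noteq> 0 \<and> c * u ^ q \<in> complex_of_real ` {..<0} \<and>
                 A = {of_real t * u | t. t > 0}}"

definition parabolic_basin :: "complex set \<Rightarrow> (complex \<Rightarrow> complex) \<Rightarrow> complex set" where
  "parabolic_basin D f =
     {z \<in> D. (\<forall>n. iterate_defined D f n z \<and> (f ^^ n) z \<noteq> 0) \<and> (\<lambda>n. (f ^^ n) z) \<longlonglongrightarrow> 0}"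

definition converges_along ::
    "complex set \<Rightarrow> (complex \<Rightarrow> complex) \<Rightarrow> complex set \<Rightarrow> complex \<Rightarrow> bool" where
  "converges_along D f A z \<longleftrightarrow>
     z \<in> parabolic_basin D f \<and> (\<exists>u\<in>A. (\<lambda>n. sgn ((f ^^ n) z)) \<longlonglongrightarrow> sgn u)"

text \<open>
  Petals in the sense of Milnor, with the extra requirement of connectedness: a forward invariant
  open set on which \<open>f\<close> is injective and which eventually absorbs exactly those orbits that
  converge to 0 in the direction of the axis.  (The last condition applied to the orbit of 0
  shows that 0 is not in \<open>P\<close>.)
\<close>

definition attracting_petal ::
    "complex set \<Rightarrow> (complex \<Rightarrow> complex) \<Rightarrow> complex set \<Rightarrow> complex set \<Rightarrow> bool" where
  "attracting_petal D f A P \<longleftrightarrow>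
     A \<in> attracting_axes f \<and> open P \<and> connected P \<and> P \<noteq> {} \<and> P \<subseteq> D \<and>
     inj_on f P \<and> f ` P \<subseteq> P \<and>
     (\<forall>z. converges_along D f A z \<longleftrightarrow>
          (\<forall>n. iterate_defined D f n z) \<and> (\<forall>\<^sub>F n in sequentially. (f ^^ n) z \<in> P))"

text \<open>A repelling petal is an attracting petal of a local inverse \<open>g\<close> of \<open>f\<close> fixing 0.\<close>

definition repelling_petal :: "complex set \<Rightarrow> (complex \<Rightarrow> complex) \<Rightarrow> complex set \<Rightarrow> bool" where
  "repelling_petal D f P \<longleftrightarrow>
     P \<subseteq> D \<and> inj_on f P \<and>
     (\<exists>W g A. (W, g) \<in> parabolic_maps \<and> (\<forall>w\<in>W. g w \<in> D \<and> f (g w) = w) \<and>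
              attracting_petal W g A P)"

text \<open>
  \<open>B\<close> is the immediate basin of \<open>A\<close>.  There is only one such component: two petals for the same
  axis always meet.
\<close>

definition is_immediate_basin ::
    "complex set \<Rightarrow> (complex \<Rightarrow> complex) \<Rightarrow> complex set \<Rightarrow> complex set \<Rightarrow> bool" where
  "is_immediate_basin D f A B \<longleftrightarrow>
     B \<in> components (parabolic_basin D f) \<and> (\<exists>P. attracting_petal D f A P \<and> P \<subseteq> B)"

section \<open>Fatou coordinates and parabolic renormalization\<close>

definition attracting_Fatou_coordinate ::
    "complex set \<Rightarrow> (complex \<Rightarrow> complex) \<Rightarrow> (complex \<Rightarrow> complex) \<Rightarrow> bool" where
  "attracting_Fatou_coordinate D f \<phi>att \<longleftrightarrow>
     \<phi>att holomorphic_on parabolic_basin D f \<and>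
     (\<exists>A P. attracting_petal D f A P \<and> inj_on \<phi>att P) \<and>
     (\<forall>z\<in>parabolic_basin D f. \<phi>att (f z) = \<phi>att z + 1)"

definition repelling_Fatou_coordinate ::
    "complex set \<Rightarrow> (complex \<Rightarrow> complex) \<Rightarrow> complex set \<Rightarrow> (complex \<Rightarrow> complex) \<Rightarrow> real \<Rightarrow> bool" where
  "repelling_Fatou_coordinate D f P \<phi>rep r \<longleftrightarrow>
     repelling_petal D f P \<and> \<phi>rep holomorphic_on P \<and> inj_on \<phi>rep P \<and>
     (\<forall>z\<in>P. f z \<in> P \<longrightarrow> \<phi>rep (f z) = \<phi>rep z + 1) \<and>
     {z. Re z < r} \<subseteq> \<phi>rep ` P"

definition psi_domain ::
    "complex set \<Rightarrow> (complex \<Rightarrow> complex) \<Rightarrow> real \<Rightarrow> (complex \<Rightarrow> complex) \<Rightarrow> complex set" where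
  "psi_domain D f r \<psi>rep =
     {z + of_nat n | z n. Re z < r \<and> iterate_defined D f n (\<psi>rep z)}"

text \<open>\<open>\<psi>rep\<close> is the extension of the inverse of \<open>\<phi>rep\<close>; its values are only prescribed on
  \<^const>\<open>psi_domain\<close>.\<close>

definition extended_inverse_coordinate ::
    "complex set \<Rightarrow> (complex \<Rightarrow> complex) \<Rightarrow> complex set \<Rightarrow> (complex \<Rightarrow> complex) \<Rightarrow> real \<Rightarrow>
     (complex \<Rightarrow> complex) \<Rightarrow> bool" where
  "extended_inverse_coordinate D f P \<phi>rep r \<psi>rep \<longleftrightarrow>
     (\<forall>z. Re z < r \<longrightarrow> \<psi>rep z \<in> P \<and> \<phi>rep (\<psi>rep z) = z) \<and>
     (\<forall>z n. Re z < r \<and> iterate_defined D f n (\<psi>rep z) \<longrightarrow>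
            \<psi>rep (z + of_nat n) = (f ^^ n) (\<psi>rep z))"

definition horn_domain ::
    "complex set \<Rightarrow> (complex \<Rightarrow> complex) \<Rightarrow> real \<Rightarrow> (complex \<Rightarrow> complex) \<Rightarrow> complex set" where
  "horn_domain D f r \<psi>rep = {z \<in> psi_domain D f r \<psi>rep. \<psi>rep z \<in> parabolic_basin D f}"

definition exp_2pi_i :: "complex \<Rightarrow> complex" where
  "exp_2pi_i z = exp (2 * of_real pi * \<i> * z)"

text \<open>\<open>l\<close> is the holomorphic extension to 0 of \<open>E \<circ> T\<^sub>\<sigma> \<circ> h \<circ> E\<^sup>-\<^sup>1\<close>, where \<open>h = \<phi>att \<circ> \<psi>rep\<close> is the horn
  map, \<open>E\<close> is \<open>exp_2pi_i\<close> and \<open>T\<^sub>\<sigma>\<close> is the translation by \<open>\<sigma>\<close>.\<close>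

definition extended_horn_map ::
    "complex set \<Rightarrow> (complex \<Rightarrow> complex) \<Rightarrow> (complex \<Rightarrow> complex) \<Rightarrow> real \<Rightarrow> (complex \<Rightarrow> complex) \<Rightarrow>
     complex \<Rightarrow> (complex \<Rightarrow> complex) \<Rightarrow> bool" where
  "extended_horn_map D f \<phi>att r \<psi>rep \<sigma> l \<longleftrightarrow>
     l holomorphic_on insert 0 (exp_2pi_i ` horn_domain D f r \<psi>rep) \<and> l 0 = 0 \<and>
     (\<forall>z\<in>horn_domain D f r \<psi>rep. l (exp_2pi_i z) = exp_2pi_i (\<phi>att (\<psi>rep z) + \<sigma>))"

text \<open>\<open>(D', g)\<close> is the parabolic renormalization of \<open>(D, f)\<close> obtained from the given coordinates.\<close>

definition is_parabolic_renormalization ::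
    "complex set \<Rightarrow> (complex \<Rightarrow> complex) \<Rightarrow> (complex \<Rightarrow> complex) \<Rightarrow> real \<Rightarrow> (complex \<Rightarrow> complex) \<Rightarrow>
     complex set \<Rightarrow> (complex \<Rightarrow> complex) \<Rightarrow> bool" where
  "is_parabolic_renormalization D f \<phi>att r \<psi>rep D' g \<longleftrightarrow>
     D' = connected_component_set (insert 0 (exp_2pi_i ` horn_domain D f r \<psi>rep)) 0 \<and>
     (\<exists>\<sigma> l. extended_horn_map D f \<phi>att r \<psi>rep \<sigma> l \<and> deriv l 0 = 1 \<and> (\<forall>z\<in>D'. g z = l z))"

section \<open>Composition types\<close>

text \<open>The type \<open>d\<^sub>m \<circ> \<dots> \<circ> d\<^sub>1\<close> is the list \<open>[d\<^sub>1, \<dots>, d\<^sub>m]\<close>.\<close>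

definition composition_type :: "nat list \<Rightarrow> bool" where
  "composition_type \<tau> \<longleftrightarrow> \<tau> \<noteq> [] \<and> (\<forall>d\<in>set \<tau>. d \<ge> 2)"

text \<open>The formula describes the rational extension of the Blaschke product, off its poles; these
  lie outside the closed unit disc.\<close>

definition finite_Blaschke_product :: "nat \<Rightarrow> (complex \<Rightarrow> complex) \<Rightarrow> bool" where
  "finite_Blaschke_product d G \<longleftrightarrow>
     (\<exists>u a. norm u = 1 \<and> (\<forall>i<d. norm (a i) < 1) \<and>
            G = (\<lambda>z. u * (\<Prod>i<d. (z - a i) / (1 - cnj (a i) * z))))"

definition parabolic_fixed_point :: "(complex \<Rightarrow> complex) \<Rightarrow> complex \<Rightarrow> bool" where
  "parabolic_fixed_point G p \<longleftrightarrow> G p = p \<and> (\<exists>n>0. deriv G p ^ n = 1)"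

text \<open>
  The multiplier of a Blaschke product at a fixed point on the unit circle is a positive real
  number, so at a parabolic fixed point it is 1 and the translate of \<open>G\<close> to the origin is of the
  form for which \<^const>\<open>attracting_axes\<close> is meaningful.  In \<open>fold\<close>, the head of the list (of degree
  \<open>d\<^sub>1\<close>) is applied first.
\<close>

definition Blaschke_class :: "nat list \<Rightarrow> (complex \<Rightarrow> complex) set" where
  "Blaschke_class \<tau> =
     {G. \<exists>Gs. list_all2 finite_Blaschke_product \<tau> Gs \<and> G = (\<lambda>z. fold (\<lambda>h w. h w) Gs z) \<and>
              (\<exists>p. norm p = 1 \<and> parabolic_fixed_point G p \<and>
                   card (attracting_axes (\<lambda>z. G (p + z) - p)) = 2)}"

definition Dyn :: "nat list \<Rightarrow> (complex set \<times> (complex \<Rightarrow> complex)) set" where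
  "Dyn \<tau> =
     {(D, f) \<in> parabolic_maps - degenerate_parabolic_maps.
        \<exists>A B. is_immediate_basin D f A B \<and>
          (\<exists>G\<in>Blaschke_class \<tau>. \<exists>\<kappa>. \<kappa> holomorphic_on B \<and> bij_betw \<kappa> B (ball 0 1) \<and>
             (\<forall>z\<in>B. \<kappa> (f z) = G (\<kappa> z)))}"

section \<open>Virtual basins\<close>

definition virtual_basin :: "(complex \<Rightarrow> complex) \<Rightarrow> complex set \<Rightarrow> int \<Rightarrow> complex set" where
  "virtual_basin \<psi>rep U n = \<psi>rep ` ((\<lambda>z. z + of_int n) ` U)"

text \<open>The restriction of \<open>(D, f)\<close> is a well-defined proper map from \<open>V\<close> to \<open>W\<close>; the inclusion of
  \<open>f ` V\<close> in \<open>W\<close> is part of \<^const>\<open>proper_map\<close>.\<close>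

definition proper_restriction ::
    "complex set \<Rightarrow> (complex \<Rightarrow> complex) \<Rightarrow> complex set \<Rightarrow> complex set \<Rightarrow> bool" where
  "proper_restriction D f V W \<longleftrightarrow>
     V \<subseteq> D \<and> proper_map (top_of_set V) (top_of_set W) f"

end

theory Submission
  imports Defs
begin

text \<open>
  Let \<open>B\<close> be the immediate basin of \<open>f\<close>.  The conjugacy to a composition of finite Blaschke
  products shows that \<open>f : B \<rightarrow> B\<close> is proper with finitely many critical points
  (\<open>conjugate_proper\<close>).  As \<open>f\<close> sends \<open>V_N\<close> onto \<open>V_(N+1)\<close>, properness of the restriction
  follows if \<open>V_N\<close> is contained in \<open>B\<close> and relatively closed in the set of points of \<open>B\<close> that
  \<open>f\<close> sends into \<open>V_(N+1)\<close>.

  The inclusion in \<open>B\<close> is a statement about the component of 0 in the domain of the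
  renormalization.  By \<open>horn_ends_in_basin\<close>, \<open>\<psi>rep\<close> maps the points far from the real axis
  to points of \<open>B\<close>; thus a punctured neighbourhood of 0 consists of images of points that
  \<open>\<psi>rep\<close>, along with their translates to the left, sends into \<open>B\<close>.  A connectedness argument
  extends this to the whole component (\<open>renormalization_domain\<close>).

  The relative closedness holds in a larger set.  If \<open>f z\<close> lies in \<open>V_(N+1)\<close>, then
  \<open>exp_2pi_i (\<phi>att z + \<sigma>)\<close> lies in the basin \<open>BR\<close> of the renormalization, because \<open>BR\<close> is forward
  invariant and \<open>\<phi>att (f z) = \<phi>att z + 1\<close>; and \<open>V_N\<close> is closed in the set of all points
  \<open>z\<close> of \<open>B\<close> with this property (\<open>virtual_basin_relatively_closed\<close>).  To see this, let \<open>z\<close> be a limit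
  point of \<open>V_N\<close> in this set.  Points of \<open>V_N\<close> are the initial points of backward orbits that converge to
  0, and it suffices that those of the points close to \<open>z\<close> can be continued to \<open>z\<close>.  Critical
  orbits converge to 0, so only finitely many steps back from a small disc around \<open>z\<close> are affected by
  critical points.  After these steps, which properness of \<open>f\<close> on \<open>B\<close> allows one to
  take, all further inverse branches exist on a fixed disc (\<open>inverse_branches\<close>).  They omit 0 and
  another value and converge to 0 at one point, hence everywhere by the theorems of Montel and
  Hurwitz (\<open>omitting_sequence_tendsto_0\<close>).  Eventually they take values in the repelling petal, and
  the repelling Fatou coordinate turns them into a lift of the disc through \<open>\<psi>rep\<close>
  (\<open>lift_to_repelling_coordinate\<close>).  The lift stays in a component of \<open>exp_2pi_i -` BR\<close>, up to a
  translation, by the choice of the disc.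
\<close>

section \<open>Local dynamics at a parabolic fixed point\<close>

lemma parabolic_mapsD:
  assumes "(D, k) \<in> parabolic_maps"
  shows "open D" "0 \<in> D" "k holomorphic_on D" "k 0 = 0" "deriv k 0 = 1"
  using assms by (auto simp: parabolic_maps_def)

lemma parabolic_quotient_limit:
  assumes k: "(D, k) \<in> parabolic_maps" and "q \<ge> 1"
    and van: "\<And>j. 2 \<le> j \<Longrightarrow> j \<le> q \<Longrightarrow> fps_nth (fps_expansion k 0) j = 0"
  shows "((\<lambda>z. (k z - z) / z ^ (q + 1)) \<longlongrightarrow> fps_nth (fps_expansion k 0) (q + 1)) (at 0)"
proof -
  note k' = parabolic_mapsD[OF k]
  define K where "K = fps_expansion k 0"
  have kK: "k has_fps_expansion K"
    unfolding K_def using k' by blast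
  define F where "F = K - fps_X"
  have F: "(\<lambda>z. k z - z) has_fps_expansion F"
    unfolding F_def by (intro fps_expansion_intros kK)
  define G where "G = fps_shift (q + 1) F"
  have K01: "fps_nth K 0 = 0" "fps_nth K (Suc 0) = 1"
    using fps_nth_fps_expansion[OF kK, of 0] fps_nth_fps_expansion[OF kK, of 1] k' by auto
  have Fn: "fps_nth F j = 0" if "j \<le> q" for j
  proof (cases "j \<ge> 2")
    case True
    then show ?thesis using van that by (auto simp: F_def K_def)
  next
    case False
    then have "j = 0 \<or> j = 1" by auto
    then show ?thesis using K01 by (auto simp: F_def)
  qed
  have FG: "F = G * fps_X ^ (q + 1)"
    by (rule fps_ext) (auto simp: G_def fps_X_power_mult_right_nth Fn not_less simp del: power_Suc)
  have cr: "fps_conv_radius G > 0"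
    using F by (auto simp: G_def has_fps_expansion_def)
  have G: "eval_fps G has_fps_expansion G"
    using cr by (rule eval_fps_has_fps_expansion)
  have "(\<lambda>z. eval_fps G z * z ^ (q + 1)) has_fps_expansion F"
    unfolding FG by (intro fps_expansion_intros G)
  then have "\<forall>\<^sub>F z in nhds 0. eval_fps G z * z ^ (q + 1) = k z - z"
    using F unfolding has_fps_expansion_def by (auto elim: eventually_elim2)
  then have ev: "\<forall>\<^sub>F z in at 0. eval_fps G z = (k z - z) / z ^ (q + 1)"
    unfolding eventually_at_filter by eventually_elim (auto simp: field_simps)
  have "(eval_fps G \<longlongrightarrow> fps_nth G 0) (at 0)"
    using has_fps_expansion_imp_tendsto_0[OF G] by (simp add: tendsto_nhds_iff)
  then have "(eval_fps G \<longlongrightarrow> fps_nth K (q + 1)) (at 0)"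
    using \<open>q \<ge> 1\<close> by (simp add: G_def F_def)
  with ev show ?thesis
    unfolding K_def by (rule Lim_transform_eventually[rotated])
qed

text \<open>The coordinate at infinity in which a germ \<open>z (1 + c z^q + \<dots>)\<close> is close to the translation
  by 1.  The case \<open>q = 1\<close> concerns the map \<open>f\<close>; a general \<open>q\<close> is needed for its
  renormalization, whose second derivative at 0 may vanish.\<close>

definition leau :: "nat \<Rightarrow> complex \<Rightarrow> complex \<Rightarrow> complex" where
  "leau q c z = - 1 / (of_nat q * c * z ^ q)"

lemma leau_increment:
  assumes k: "(D, k) \<in> parabolic_maps" and lt: "leading_term k q c"
  shows "((\<lambda>z. leau q c (k z) - leau q c z) \<longlongrightarrow> 1) (at 0)"
proof -
  have q: "q \<ge> 1" and c: "c \<noteq> 0" using lt by (auto simp: leading_term_def)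
  define \<rho> where "\<rho> z = (k z - z) / z ^ (q + 1)" for z
  have \<rho>: "(\<rho> \<longlongrightarrow> c) (at 0)"
    using parabolic_quotient_limit[OF k q] lt unfolding \<rho>_def leading_term_def by auto
  have zq: "((\<lambda>z::complex. z ^ q) \<longlongrightarrow> 0) (at 0)"
    using q by (auto intro!: tendsto_eq_intros)
  define w where "w z = z ^ q * \<rho> z" for z
  have "(w \<longlongrightarrow> 0) (at 0)"
    unfolding w_def using tendsto_mult[OF zq \<rho>] by simp
  moreover have \<rho>nz: "\<forall>\<^sub>F z in at 0. \<rho> z \<noteq> 0"
    using \<rho> c tendsto_imp_eventually_ne by blast
  have znz: "\<forall>\<^sub>F z in at 0. (z::complex) \<noteq> 0"
    by (simp add: eventually_at_filter)
  have wnz: "\<forall>\<^sub>F z in at 0. w z \<noteq> 0"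
    using \<rho>nz znz by eventually_elim (simp add: w_def)
  ultimately have w0: "filterlim w (at 0) (at 0)"
    by (simp add: filterlim_at)
  have "((\<lambda>w::complex. inverse ((1 + w) ^ q)) has_field_derivative - of_nat q) (at 0)"
    by (auto intro!: derivative_eq_intros)
  then have "((\<lambda>w::complex. (inverse ((1 + w) ^ q) - 1) / w) \<longlongrightarrow> - of_nat q) (at 0)"
    by (simp add: has_field_derivative_iff)
  from filterlim_compose[OF this w0]
  have "((\<lambda>z. (inverse ((1 + w z) ^ q) - 1) / w z * \<rho> z * (- 1 / (of_nat q * c))) \<longlongrightarrow>
        - of_nat q * c * (- 1 / (of_nat q * c))) (at 0)"
    by (intro tendsto_mult \<rho> tendsto_const)
  moreover have "- of_nat q * c * (- 1 / (of_nat q * c)) = 1"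
    using q c by simp
  moreover have "\<forall>\<^sub>F z in at 0. (inverse ((1 + w z) ^ q) - 1) / w z * \<rho> z * (- 1 / (of_nat q * c))
      = leau q c (k z) - leau q c z"
    using \<rho>nz znz wnz
  proof eventually_elim
    case (elim z)
    have kz: "k z = z * (1 + w z)"
      using elim by (simp add: w_def \<rho>_def field_simps)
    have "(inverse ((1 + w z) ^ q) - 1) / w z * \<rho> z = inverse ((1 + w z) ^ q) / z ^ q - 1 / z ^ q"
      using elim unfolding w_def by (simp add: field_simps)
    also have "\<dots> * (- 1 / (of_nat q * c)) = leau q c (k z) - leau q c z"
      unfolding leau_def kz power_mult_distrib using q c elim
      by (cases "1 + w z = 0") (simp_all add: field_simps power_0_left)
    finally show ?case .
  qed
  ultimately show ?thesis
    by (auto elim!: Lim_transform_eventually)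
qed

text \<open>Close to 0, that is, for large values of the coordinate, the translation by 1 is approximated
  within \<open>1/4\<close>, and any property that holds near 0 may be imposed in addition.\<close>

lemma leau_region:
  assumes k: "(D, k) \<in> parabolic_maps" and lt: "leading_term k q c" and ev: "\<forall>\<^sub>F z in at 0. Q z"
  obtains R where "R > 0"
    "\<And>z. z \<noteq> 0 \<Longrightarrow> R \<le> norm (leau q c z) \<Longrightarrow>
       z \<in> D \<and> k z \<noteq> 0 \<and> norm (leau q c (k z) - leau q c z - 1) < 1/4 \<and> Q z"
proof -
  note k' = parabolic_mapsD[OF k]
  have q: "q \<ge> 1" and c: "c \<noteq> 0" using lt by (auto simp: leading_term_def)
  have 1: "\<forall>\<^sub>F z in at 0. z \<in> D"
    using k' by (simp add: eventually_at_in_open')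
  have "((\<lambda>z. (k z - z) / z ^ (1 + 1)) \<longlongrightarrow> fps_nth (fps_expansion k 0) (1 + 1)) (at 0)"
    by (rule parabolic_quotient_limit[OF k]) auto
  then have "((\<lambda>z. 1 + (k z - z) / z ^ 2 * z) \<longlongrightarrow> 1 + fps_nth (fps_expansion k 0) (1 + 1) * 0) (at 0)"
    by (intro tendsto_add tendsto_mult tendsto_const) (auto simp: numeral_2_eq_2)
  then have "\<forall>\<^sub>F z in at 0. 1 + (k z - z) / z ^ 2 * z \<noteq> 0"
    by (intro tendsto_imp_eventually_ne) auto
  moreover have nz: "\<forall>\<^sub>F z in at 0. (z::complex) \<noteq> 0"
    by (simp add: eventually_at_filter)
  ultimately have 2: "\<forall>\<^sub>F z in at 0. k z \<noteq> 0"
    by eventually_elim (auto simp: power2_eq_square field_simps)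
  have 3: "\<forall>\<^sub>F z in at 0. norm (leau q c (k z) - leau q c z - 1) < 1/4"
    using tendstoD[OF leau_increment[OF k lt], of "1/4"] by (simp add: dist_norm)
  have "\<forall>\<^sub>F z in at 0. z \<in> D \<and> k z \<noteq> 0 \<and> norm (leau q c (k z) - leau q c z - 1) < 1/4 \<and> Q z"
    using 1 2 3 ev by eventually_elim auto
  then obtain d where d: "d > 0" "\<And>z. z \<noteq> 0 \<Longrightarrow> norm z < d \<Longrightarrow>
      z \<in> D \<and> k z \<noteq> 0 \<and> norm (leau q c (k z) - leau q c z - 1) < 1/4 \<and> Q z"
    unfolding eventually_at by auto
  \<comment> \<open>With this choice, \<open>norm (leau q c z) \<ge> R\<close> means that \<open>norm z ^ q \<le> d ^ q / 2\<close>.\<close>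
  define R where "R = 2 / (of_nat q * norm c * d ^ q)"
  have "R > 0" using q c d by (simp add: R_def)
  moreover have "norm z < d" if "z \<noteq> 0" "R \<le> norm (leau q c z)" for z
  proof -
    have "2 / (of_nat q * norm c * d ^ q) \<le> 1 / (of_nat q * norm c * norm z ^ q)"
      using that by (simp add: R_def leau_def norm_divide norm_mult norm_power)
    then have "2 * norm z ^ q \<le> d ^ q"
      using q c d that by (simp add: field_simps)
    moreover have "norm z ^ q > 0" using that by simp
    ultimately have "norm z ^ q < d ^ q" by linarith
    then show ?thesis
      using d(1) power_less_imp_less_base[of "norm z" q d] by linarith
  qed
  ultimately show ?thesis
    using d(2) by (intro that[of R]) simp_all
qed

lemma tendsto_0_of_leau:
  assumes "q \<ge> 1" "c \<noteq> 0" "filterlim (\<lambda>n. leau q c (x n)) at_infinity sequentially"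
  shows "x \<longlonglongrightarrow> 0"
proof -
  have "(\<lambda>n. inverse (leau q c (x n))) \<longlonglongrightarrow> 0"
    using assms(3) filterlim_compose tendsto_inverse_0 by blast
  then have "(\<lambda>n. inverse (leau q c (x n)) * (- 1 / (of_nat q * c))) \<longlonglongrightarrow> 0 * (- 1 / (of_nat q * c))"
    by (intro tendsto_mult tendsto_const)
  moreover have "inverse (leau q c (x n)) * (- 1 / (of_nat q * c)) = x n ^ q" for n
    using assms by (simp add: leau_def field_simps)
  ultimately have "(\<lambda>n. x n ^ q) \<longlonglongrightarrow> 0" by simp
  then have "(\<lambda>n. norm (x n) ^ q) \<longlonglongrightarrow> 0"
    using tendsto_norm_zero_iff[of "\<lambda>n. x n ^ q"] by (simp add: norm_power)
  then have "(\<lambda>n. root q (norm (x n) ^ q)) \<longlonglongrightarrow> root q 0"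
    by (intro tendsto_real_root)
  then have "(\<lambda>n. norm (x n)) \<longlonglongrightarrow> 0"
    using assms by (simp add: real_root_power_cancel)
  then show ?thesis by (simp add: tendsto_norm_zero_iff)
qed

lemma filterlim_at_top_of_increment:
  fixes a :: "nat \<Rightarrow> real"
  assumes "d > 0" "\<forall>\<^sub>F n in sequentially. a n + d \<le> a (Suc n)"
  shows "filterlim a at_top sequentially"
proof -
  obtain N where N: "\<And>n. n \<ge> N \<Longrightarrow> a n + d \<le> a (Suc n)"
    using assms by (auto simp: eventually_sequentially)
  have le: "a N + d * of_nat m \<le> a (m + N)" for m
  proof (induction m)
    case (Suc m)
    then show ?case using N[of "m + N"] by (simp add: algebra_simps)
  qed simp
  have "filterlim (\<lambda>m. a N + d * of_nat m) at_top sequentially"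
    by (intro filterlim_tendsto_add_at_top[OF tendsto_const]
        filterlim_tendsto_pos_mult_at_top[OF tendsto_const \<open>d > 0\<close>] filterlim_real_sequentially)
  then have "filterlim (\<lambda>m. a (m + N)) at_top sequentially"
    by (rule filterlim_at_top_mono) (use le in auto)
  then show ?thesis
    unfolding filterlim_at_top by (subst (asm) eventually_sequentially_seg)
qed

lemma at_infinity_of_Re_at_top:
  assumes "filterlim (\<lambda>n. Re (x n)) at_top sequentially"
  shows "filterlim x at_infinity sequentially"
  unfolding filterlim_at_infinity_conv_norm_at_top
  by (rule filterlim_at_top_mono[OF assms]) (auto intro: always_eventually complex_Re_le_cmod)

lemma iterate_defined_Suc:
  "iterate_defined D f (Suc n) z \<longleftrightarrow> z \<in> D \<and> iterate_defined D f n (f z)"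
  unfolding iterate_defined_def by (auto simp: less_Suc_eq_0_disj funpow_swap1)

lemma iterate_defined_add:
  "iterate_defined D f (m + n) z \<longleftrightarrow> iterate_defined D f m z \<and> iterate_defined D f n ((f ^^ m) z)"
proof (induction m arbitrary: z)
  case 0
  then show ?case by (simp add: iterate_defined_def)
next
  case (Suc m)
  then show ?case by (simp add: iterate_defined_Suc funpow_swap1)
qed

lemma iterates_in_invariant_set:
  assumes "f ` B \<subseteq> B" "z \<in> B"
  shows "(f ^^ n) z \<in> B"
  by (induction n) (use assms in auto)

lemma parabolic_basinD:
  assumes "z \<in> parabolic_basin D f"
  shows "(f ^^ n) z \<in> D" "(f ^^ n) z \<noteq> 0" "(\<lambda>n. (f ^^ n) z) \<longlonglongrightarrow> 0" "z \<in> D" "iterate_defined D f n z"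
    "f z \<in> parabolic_basin D f"
proof -
  have *: "iterate_defined D f n z" "(f ^^ n) z \<noteq> 0" for n
    using assms by (auto simp: parabolic_basin_def)
  then show 1: "(f ^^ n) z \<in> D" "(f ^^ n) z \<noteq> 0" "iterate_defined D f n z" for n
    using *(1)[of "Suc n"] by (auto simp: iterate_defined_def)
  show 2: "(\<lambda>n. (f ^^ n) z) \<longlonglongrightarrow> 0" "z \<in> D"
    using assms by (auto simp: parabolic_basin_def)
  have "iterate_defined D f n (f z)" "(f ^^ n) (f z) \<noteq> 0" for n
    using *[of "Suc n"] by (simp_all add: iterate_defined_Suc funpow_swap1)
  moreover have "(\<lambda>n. (f ^^ n) (f z)) \<longlonglongrightarrow> 0"
    using LIMSEQ_Suc[OF 2(1)] by (simp add: funpow_swap1)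
  moreover have "f z \<in> D" using 1(1)[of 1] by simp
  ultimately show "f z \<in> parabolic_basin D f"
    by (simp add: parabolic_basin_def)
qed

lemma parabolic_basin_pullback:
  assumes "f 0 = 0" "iterate_defined D f n z" "(f ^^ n) z \<in> parabolic_basin D f"
  shows "z \<in> parabolic_basin D f"
proof -
  have "iterate_defined D f m z" for m
  proof -
    have "iterate_defined D f (n + m) z"
      using assms parabolic_basinD[OF assms(3)] by (simp add: iterate_defined_add)
    then show ?thesis by (simp add: iterate_defined_def)
  qed
  moreover from this[of 1] have "z \<in> D" by (auto simp: iterate_defined_def)
  moreover have f0: "(f ^^ m) 0 = 0" for m by (induction m) (use assms in auto)
  have "(f ^^ m) z \<noteq> 0" for m
  proof
    assume "(f ^^ m) z = 0"
    then have "(f ^^ (n + m)) z = 0" by (simp add: funpow_add f0)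
    moreover have "(f ^^ (m + n)) z \<noteq> 0"
      using parabolic_basinD(2)[OF assms(3), of m] by (simp add: funpow_add)
    ultimately show False by (simp add: add.commute)
  qed
  moreover have "(\<lambda>m. (f ^^ m) z) \<longlonglongrightarrow> 0"
  proof (rule LIMSEQ_offset)
    have "(f ^^ (m + n)) z = (f ^^ m) ((f ^^ n) z)" for m by (simp add: funpow_add)
    with parabolic_basinD(3)[OF assms(3)] show "(\<lambda>m. (f ^^ (m + n)) z) \<longlonglongrightarrow> 0" by simp
  qed
  ultimately show ?thesis by (simp add: parabolic_basin_def)
qed

lemma open_iterate_preimage:
  assumes "open D" "continuous_on D f" "open V"
  shows "open {z. iterate_defined D f n z \<and> (f ^^ n) z \<in> V}"
proof (induction n)
  case 0
  then show ?case using assms by (simp add: iterate_defined_def)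
next
  case (Suc n)
  have "{z. iterate_defined D f (Suc n) z \<and> (f ^^ Suc n) z \<in> V}
      = D \<inter> f -` {z. iterate_defined D f n z \<and> (f ^^ n) z \<in> V}"
    by (auto simp: iterate_defined_Suc funpow_swap1)
  then show ?case
    using continuous_open_preimage[OF assms(2,1) Suc] by simp
qed

text \<open>A sector, in the Leau coordinate, of opening angle \<open>3 \<pi> / 2\<close> around the positive real axis.
  It is invariant under maps that differ from the translation by 1 by less than \<open>1/4\<close>, and it
  contains the points of large imaginary part of every vertical line; a right half-plane would
  not do.\<close>

definition attracting_sector :: "real \<Rightarrow> complex set" where
  "attracting_sector R = {z. R < Re z + \<bar>Im z\<bar>}"

lemma attracting_sector_norm: "z \<in> attracting_sector R \<Longrightarrow> R < 2 * norm z"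
  unfolding attracting_sector_def using abs_Re_le_cmod[of z] abs_Im_le_cmod[of z] by auto

lemma attracting_sector_step:
  assumes "z \<in> attracting_sector R" "norm (w - z - 1) < 1/4"
  shows "w \<in> attracting_sector R"
  using assms abs_Re_le_cmod[of "w - z - 1"] abs_Im_le_cmod[of "w - z - 1"]
  unfolding attracting_sector_def by auto

lemma connected_attracting_sector: "connected (attracting_sector R)"
proof -
  have eq: "attracting_sector R = {z. R < (1 - \<i>) \<bullet> z} \<union> {z. R < (1 + \<i>) \<bullet> z}"
    by (auto simp: attracting_sector_def inner_complex_def)
  have "of_real (R + 1) \<in> {z. R < (1 - \<i>) \<bullet> z} \<inter> {z. R < (1 + \<i>) \<bullet> z}"
    by (auto simp: inner_complex_def)
  then show ?thesis unfolding eq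
    by (intro connected_Un convex_connected convex_halfspace_gt) auto
qed

lemma attracting_sector_in_basin:
  assumes k: "(D, k) \<in> parabolic_maps" and lt: "leading_term k q c"
  obtains R where "R > 0"
    "\<And>z. z \<noteq> 0 \<Longrightarrow> leau q c z \<in> attracting_sector R \<Longrightarrow> z \<in> parabolic_basin D k"
proof -
  have q: "q \<ge> 1" and c: "c \<noteq> 0" using lt by (auto simp: leading_term_def)
  obtain R where R: "R > 0" "\<And>z. z \<noteq> 0 \<Longrightarrow> R \<le> norm (leau q c z) \<Longrightarrow>
       z \<in> D \<and> k z \<noteq> 0 \<and> norm (leau q c (k z) - leau q c z - 1) < 1/4 \<and> True"
    using leau_region[OF k lt, of "\<lambda>_. True"] by (metis eventually_True)
  define S where "S = {z. z \<noteq> 0 \<and> leau q c z \<in> attracting_sector (2 * R)}"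
  have S: "z \<in> D" "k z \<in> S" "Re (leau q c z) + 3/4 \<le> Re (leau q c (k z))" if "z \<in> S" for z
  proof -
    have *: "z \<noteq> 0" "leau q c z \<in> attracting_sector (2 * R)" using that by (auto simp: S_def)
    with attracting_sector_norm[of "leau q c z" "2 * R"]
    have **: "z \<in> D" "k z \<noteq> 0" "norm (leau q c (k z) - leau q c z - 1) < 1/4"
      using R(2)[of z] by auto
    then show "z \<in> D" "k z \<in> S"
      using * attracting_sector_step by (auto simp: S_def)
    show "Re (leau q c z) + 3/4 \<le> Re (leau q c (k z))"
      using ** abs_Re_le_cmod[of "leau q c (k z) - leau q c z - 1"] by auto
  qed
  have "z \<in> parabolic_basin D k" if "z \<in> S" for z
  proof -
    have it: "(k ^^ n) z \<in> S" for n
      using that S(2) by (intro iterates_in_invariant_set) auto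
    have "filterlim (\<lambda>n. Re (leau q c ((k ^^ n) z))) at_top sequentially"
      using S(3)[OF it] by (intro filterlim_at_top_of_increment[of "3/4"]) auto
    then have "(\<lambda>n. (k ^^ n) z) \<longlonglongrightarrow> 0"
      by (intro tendsto_0_of_leau[OF q c] at_infinity_of_Re_at_top)
    then show ?thesis
      using it S(1) that by (auto simp: parabolic_basin_def iterate_defined_def S_def)
  qed
  then show ?thesis
    using that[of "2 * R"] R(1) by (auto simp: S_def)
qed

lemma basin_orbit_leau:
  assumes k: "(D, k) \<in> parabolic_maps" and lt: "leading_term k q c" and z: "z \<in> parabolic_basin D k"
  shows "filterlim (\<lambda>n. Re (leau q c ((k ^^ n) z))) at_top sequentially"
proof -
  have q: "q \<ge> 1" and c: "c \<noteq> 0" using lt by (auto simp: leading_term_def)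
  have "filterlim (\<lambda>n. (k ^^ n) z) (at 0) sequentially"
    using parabolic_basinD[OF z] by (simp add: filterlim_at)
  then have "((\<lambda>n. leau q c (k ((k ^^ n) z)) - leau q c ((k ^^ n) z)) \<longlongrightarrow> 1) sequentially"
    using filterlim_compose leau_increment[OF k lt] by blast
  then have "((\<lambda>n. Re (leau q c (k ((k ^^ n) z)) - leau q c ((k ^^ n) z))) \<longlongrightarrow> Re 1) sequentially"
    by (rule tendsto_Re)
  then have "\<forall>\<^sub>F n in sequentially. Re (leau q c (k ((k ^^ n) z)) - leau q c ((k ^^ n) z)) > 1/2"
    by (intro order_tendstoD) auto
  then show ?thesis
    by (intro filterlim_at_top_of_increment[of "1/2"]) (auto elim: eventually_mono)
qed

lemma basin_orbit_in_sector:
  assumes k: "(D, k) \<in> parabolic_maps" and lt: "leading_term k q c" and z: "z \<in> parabolic_basin D k"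
  shows "\<forall>\<^sub>F n in sequentially. leau q c ((k ^^ n) z) \<in> attracting_sector R"
proof -
  have "\<forall>\<^sub>F n in sequentially. Re (leau q c ((k ^^ n) z)) > R"
    using basin_orbit_leau[OF assms] by (simp add: filterlim_at_top_dense)
  then show ?thesis
    by eventually_elim (auto simp: attracting_sector_def)
qed

lemma open_attracting_sector: "open (attracting_sector R)"
  unfolding attracting_sector_def by (intro open_Collect_less continuous_intros)

lemma open_leau_preimage:
  assumes "q \<ge> 1" "c \<noteq> 0" "open V"
  shows "open {z. z \<noteq> 0 \<and> leau q c z \<in> V}"
proof -
  have "continuous_on (- {0}) (leau q c)"
    unfolding leau_def using assms by (intro continuous_intros) auto
  from continuous_open_preimage[OF this _ \<open>open V\<close>]
  have "open (- {0} \<inter> leau q c -` V)" by auto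
  moreover have "- {0} \<inter> leau q c -` V = {z. z \<noteq> 0 \<and> leau q c z \<in> V}" by auto
  ultimately show ?thesis by simp
qed

text \<open>Every orbit in the basin enters the attracting sector, which is open and contained in the basin.\<close>

lemma open_parabolic_basin:
  assumes k: "(D, k) \<in> parabolic_maps" and lt: "leading_term k q c"
  shows "open (parabolic_basin D k)"
proof -
  note k' = parabolic_mapsD[OF k]
  have q: "q \<ge> 1" and c: "c \<noteq> 0" using lt by (auto simp: leading_term_def)
  obtain R where R: "R > 0"
    "\<And>z. z \<noteq> 0 \<Longrightarrow> leau q c z \<in> attracting_sector R \<Longrightarrow> z \<in> parabolic_basin D k"
    using attracting_sector_in_basin[OF k lt] by blast
  define S where "S = {z. z \<noteq> 0 \<and> leau q c z \<in> attracting_sector R}"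
  have "open S" unfolding S_def
    by (rule open_leau_preimage[OF q c open_attracting_sector])
  have SB: "S \<subseteq> parabolic_basin D k" using R by (auto simp: S_def)
  have "parabolic_basin D k = (\<Union>n. {z. iterate_defined D k n z \<and> (k ^^ n) z \<in> S})"
  proof (intro subset_antisym subsetI)
    fix z assume z: "z \<in> parabolic_basin D k"
    obtain n where "leau q c ((k ^^ n) z) \<in> attracting_sector R"
      using basin_orbit_in_sector[OF k lt z] by (meson eventually_sequentially le_refl)
    then show "z \<in> (\<Union>n. {z. iterate_defined D k n z \<and> (k ^^ n) z \<in> S})"
      using parabolic_basinD[OF z] by (auto simp: S_def)
  next
    fix z assume "z \<in> (\<Union>n. {z. iterate_defined D k n z \<and> (k ^^ n) z \<in> S})"
    then show "z \<in> parabolic_basin D k"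
      using SB parabolic_basin_pullback[of k D _ z] k'(4) by blast
  qed
  then show ?thesis
    using open_iterate_preimage[OF k'(1) holomorphic_on_imp_continuous_on[OF k'(3)] \<open>open S\<close>] by auto
qed

lemma component_absorbs:
  assumes "B \<in> components X" "connected C" "C \<subseteq> X" "C \<inter> B \<noteq> {}"
  shows "C \<subseteq> B"
  using components_maximal assms by blast

text \<open>A petal in \<open>B\<close> is sent into itself, so the connected set \<open>k ` B\<close> meets \<open>B\<close>.\<close>

lemma immediate_basin_invariant:
  assumes k: "(D, k) \<in> parabolic_maps" and B: "is_immediate_basin D k A B"
  shows "k ` B \<subseteq> B" "B \<subseteq> parabolic_basin D k" "B \<noteq> {}"
proof -
  obtain P where P: "attracting_petal D k A P" "P \<subseteq> B" and Bc: "B \<in> components (parabolic_basin D k)"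
    using B by (auto simp: is_immediate_basin_def)
  show sub: "B \<subseteq> parabolic_basin D k"
    using Bc by (rule in_components_subset)
  obtain z where z: "z \<in> P" "k z \<in> P" "B \<noteq> {}"
    using P unfolding attracting_petal_def by blast
  show "B \<noteq> {}" by fact
  have "continuous_on B k"
    using parabolic_mapsD(3)[OF k] sub parabolic_basinD(4)
    by (meson continuous_on_subset holomorphic_on_imp_continuous_on subset_eq)
  then have "connected (k ` B)"
    using Bc in_components_connected connected_continuous_image by blast
  then show "k ` B \<subseteq> B"
  proof (rule component_absorbs[OF Bc])
    show "k ` B \<subseteq> parabolic_basin D k" using sub parabolic_basinD(6) by blast
    show "k ` B \<inter> B \<noteq> {}" using z P(2) by blast
  qed
qed

text \<open>For \<open>q = 1\<close> the Leau coordinate is injective, so the attracting sector corresponds to a connected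
  subset of the basin, which is entered by the orbits of the immediate basin.\<close>

lemma attracting_sector_in_immediate_basin:
  assumes k: "(D, k) \<in> parabolic_maps" and lt: "leading_term k 1 c" and B: "is_immediate_basin D k A B"
  obtains R where "R > 0" "\<And>z. z \<noteq> 0 \<Longrightarrow> leau 1 c z \<in> attracting_sector R \<Longrightarrow> z \<in> B"
proof -
  have c: "c \<noteq> 0" using lt by (auto simp: leading_term_def)
  obtain R where R: "R > 0"
    "\<And>z. z \<noteq> 0 \<Longrightarrow> leau 1 c z \<in> attracting_sector R \<Longrightarrow> z \<in> parabolic_basin D k"
    using attracting_sector_in_basin[OF k lt] by blast
  define S where "S = {z. z \<noteq> 0 \<and> leau 1 c z \<in> attracting_sector R}"
  have nz: "w \<noteq> 0" if "w \<in> attracting_sector R" for w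
    using that R(1) by (auto simp: attracting_sector_def)
  have "S = (\<lambda>w. - 1 / (c * w)) ` attracting_sector R"
  proof (intro subset_antisym subsetI)
    fix z assume "z \<in> S"
    then show "z \<in> (\<lambda>w. - 1 / (c * w)) ` attracting_sector R"
      using c by (intro image_eqI[of _ _ "leau 1 c z"]) (auto simp: S_def leau_def)
  next
    fix z assume "z \<in> (\<lambda>w. - 1 / (c * w)) ` attracting_sector R"
    then show "z \<in> S"
      using c nz by (auto simp: S_def leau_def)
  qed
  moreover have "continuous_on (attracting_sector R) (\<lambda>w. - 1 / (c * w))"
    using c nz by (intro continuous_intros) auto
  ultimately have "connected S"
    using connected_continuous_image connected_attracting_sector by metis
  note B' = immediate_basin_invariant[OF k B]
  obtain z where z: "z \<in> B" using B'(3) by blast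
  obtain n where "leau 1 c ((k ^^ n) z) \<in> attracting_sector R"
    using basin_orbit_in_sector[OF k lt] z B'(2) by (meson eventually_sequentially le_refl subsetD)
  moreover have "(k ^^ n) z \<in> B" "(k ^^ n) z \<noteq> 0"
    using iterates_in_invariant_set[OF B'(1) z] parabolic_basinD(2)[of z D k n] z B'(2) by blast+
  ultimately have "(k ^^ n) z \<in> S \<inter> B" by (simp add: S_def)
  then have "S \<inter> B \<noteq> {}" by blast
  moreover have "B \<in> components (parabolic_basin D k)"
    using B by (simp add: is_immediate_basin_def)
  moreover have "S \<subseteq> parabolic_basin D k" using R(2) by (auto simp: S_def)
  ultimately have "S \<subseteq> B"
    using component_absorbs \<open>connected S\<close> by blast
  then show ?thesis
    using R(1) by (intro that[of R]) (auto simp: S_def)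
qed

section \<open>The repelling direction\<close>

lemma tendsto_quotient_of_increments:
  fixes x :: "nat \<Rightarrow> complex"
  assumes "(\<lambda>n. x (Suc n) - x n) \<longlonglongrightarrow> l"
  shows "(\<lambda>n. x n / of_nat n) \<longlonglongrightarrow> l"
proof (rule LIMSEQ_I)
  fix e :: real assume "e > 0"
  define d where "d n = x n - of_nat n * l" for n
  have inc: "d (Suc n) - d n = x (Suc n) - x n - l" for n
    by (simp add: d_def algebra_simps)
  obtain N where N: "\<And>n. n \<ge> N \<Longrightarrow> norm (d (Suc n) - d n) < e / 2"
    using LIMSEQ_D[OF assms, of "e / 2"] \<open>e > 0\<close> by (auto simp: inc)
  have bd: "norm (d (N + m)) \<le> norm (d N) + of_nat m * (e / 2)" for m
  proof (induction m)
    case (Suc m)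
    have "norm (d (N + Suc m)) \<le> norm (d (N + m)) + norm (d (Suc (N + m)) - d (N + m))"
      by (metis add.commute add_Suc_right diff_add_cancel norm_triangle_ineq)
    with Suc N[of "N + m"] show ?case by (simp add: algebra_simps add_divide_distrib)
  qed simp
  obtain K :: nat where K: "2 * norm (d N) / e < of_nat K"
    using reals_Archimedean2 by blast
  have "norm (x n / of_nat n - l) < e" if n: "n \<ge> max (Suc K) (Suc N)" for n
  proof -
    have n0: "n > 0" "K \<le> n" "N \<le> n" using n by auto
    have "2 * norm (d N) < e * of_nat K" using K \<open>e > 0\<close> by (simp add: field_simps)
    also have "\<dots> \<le> e * of_nat n" using n0 \<open>e > 0\<close> by simp
    finally have 1: "2 * norm (d N) < e * of_nat n" .
    have "norm (d n) \<le> norm (d N) + of_nat (n - N) * (e / 2)"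
      using bd[of "n - N"] n0 by simp
    also have "of_nat (n - N) * (e / 2) \<le> of_nat n * (e / 2)"
      using \<open>e > 0\<close> by (intro mult_right_mono) auto
    finally have "norm (d n) < e * of_nat n" using 1 by (simp add: mult.commute)
    moreover have "x n / of_nat n - l = d n / of_nat n"
      using n0 by (simp add: d_def field_simps)
    ultimately show ?thesis
      using n0 by (simp add: norm_divide field_simps)
  qed
  then show "\<exists>no. \<forall>n\<ge>no. norm (x n / of_nat n - l) < e" by blast
qed

lemma parabolic_map_quotient:
  assumes "(W, g) \<in> parabolic_maps"
  shows "((\<lambda>w. g w / w) \<longlongrightarrow> 1) (at 0)" "(g \<longlongrightarrow> 0) (at 0)"
proof -
  note g = parabolic_mapsD[OF assms]
  have "(g has_field_derivative 1) (at 0)"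
    using g holomorphic_derivI by metis
  then show "((\<lambda>w. g w / w) \<longlongrightarrow> 1) (at 0)" "(g \<longlongrightarrow> 0) (at 0)"
    using g DERIV_isCont[of g 1 0] by (auto simp: has_field_derivative_iff isCont_def)
qed

lemma local_inverse_at_0:
  assumes f: "(D, f) \<in> parabolic_maps"
    and g: "(W, g) \<in> parabolic_maps" "\<forall>w\<in>W. f (g w) = w"
  shows "filterlim g (at 0) (at 0)" "\<forall>\<^sub>F w in at 0. f (g w) = w"
proof -
  have W: "\<forall>\<^sub>F w in at 0. w \<in> W"
    using parabolic_mapsD[OF g(1)] by (simp add: eventually_at_in_open')
  then show inv: "\<forall>\<^sub>F w in at 0. f (g w) = w"
    by eventually_elim (use g(2) in auto)
  have "\<forall>\<^sub>F w in at 0. (w::complex) \<noteq> 0" by (simp add: eventually_at_filter)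
  with inv have "\<forall>\<^sub>F w in at 0. g w \<noteq> 0"
    by eventually_elim (use parabolic_mapsD(4)[OF f] in auto)
  then show "filterlim g (at 0) (at 0)"
    using parabolic_map_quotient[OF g(1)] by (simp add: filterlim_at)
qed

text \<open>The local inverse of \<open>z + c z^2 + \<dots>\<close> is \<open>z - c z^2 + \<dots>\<close>; in particular it has a
  single attracting axis.\<close>

lemma local_inverse_leading_term:
  assumes f: "(D, f) \<in> parabolic_maps" "leading_term f 1 c"
    and g: "(W, g) \<in> parabolic_maps" "\<forall>w\<in>W. f (g w) = w"
    and lt: "leading_term g q b"
  shows "q = 1" "b = - c"
proof -
  have c: "c \<noteq> 0" "fps_nth (fps_expansion f 0) (1 + 1) = c" using f(2) by (auto simp: leading_term_def)
  note g0 = local_inverse_at_0[OF f(1) g]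
  have "((\<lambda>z. (f z - z) / z ^ (1 + 1)) \<longlongrightarrow> c) (at 0)"
    unfolding c(2)[symmetric] by (rule parabolic_quotient_limit[OF f(1)]) auto
  from filterlim_compose[OF this g0(1)]
  have 1: "((\<lambda>w. (f (g w) - g w) / (g w) ^ (1 + 1)) \<longlongrightarrow> c) (at 0)" .
  have "((\<lambda>w. - ((f (g w) - g w) / (g w) ^ (1 + 1) * (g w / w) ^ 2)) \<longlongrightarrow> - (c * 1 ^ 2)) (at 0)"
    by (intro tendsto_minus tendsto_mult 1 tendsto_power parabolic_map_quotient[OF g(1)])
  moreover have "\<forall>\<^sub>F w in at 0. g w \<noteq> 0" "\<forall>\<^sub>F w in at 0. (w::complex) \<noteq> 0"
    using g0(1) by (simp_all add: filterlim_at eventually_at_filter)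
  then have "\<forall>\<^sub>F w in at 0. - ((f (g w) - g w) / (g w) ^ (1 + 1) * (g w / w) ^ 2) = (g w - w) / w ^ (1 + 1)"
    using g0(2) by eventually_elim (simp add: field_simps power2_eq_square)
  ultimately have "((\<lambda>w. (g w - w) / w ^ (1 + 1)) \<longlongrightarrow> - c) (at 0)"
    by (auto elim: Lim_transform_eventually)
  moreover have "((\<lambda>w. (g w - w) / w ^ (1 + 1)) \<longlongrightarrow> fps_nth (fps_expansion g 0) (1 + 1)) (at 0)"
    by (rule parabolic_quotient_limit[OF g(1)]) auto
  ultimately have 2: "fps_nth (fps_expansion g 0) 2 = - c"
    using tendsto_unique[OF trivial_limit_at] by (auto simp: numeral_2_eq_2)
  have "q \<ge> 1" "\<And>k. 2 \<le> k \<Longrightarrow> k \<le> q \<Longrightarrow> fps_nth (fps_expansion g 0) k = 0"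
    using lt by (auto simp: leading_term_def)
  from this(2)[of 2] this(1) 2 c show "q = 1" by fastforce
  with lt 2 show "b = - c" by (simp add: leading_term_def numeral_2_eq_2)
qed

lemma local_inverse_increment:
  assumes f: "(D, f) \<in> parabolic_maps" "leading_term f 1 c"
    and g: "(W, g) \<in> parabolic_maps" "\<forall>w\<in>W. f (g w) = w"
  shows "((\<lambda>w. leau 1 c (g w) - leau 1 c w) \<longlongrightarrow> - 1) (at 0)"
proof -
  note g0 = local_inverse_at_0[OF f(1) g]
  from filterlim_compose[OF leau_increment[OF f] g0(1)]
  have "((\<lambda>w. - (leau 1 c (f (g w)) - leau 1 c (g w))) \<longlongrightarrow> - 1) (at 0)"
    by (rule tendsto_minus)
  moreover have "\<forall>\<^sub>F w in at 0. - (leau 1 c (f (g w)) - leau 1 c (g w)) = leau 1 c (g w) - leau 1 c w"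
    using g0(2) by eventually_elim simp
  ultimately show ?thesis by (rule Lim_transform_eventually)
qed

text \<open>All backward orbits that converge to 0 do so along the only repelling axis: in the Leau
  coordinate their increments tend to \<open>- 1\<close>, so the \<open>n\<close>-th point is equivalent to \<open>- n\<close>.
  Hence a repelling petal, which absorbs the backward orbits that converge in the direction of the
  axis, absorbs all backward orbits that converge to 0.\<close>

lemma backward_orbit_direction:
  assumes f: "(D, f) \<in> parabolic_maps" "leading_term f 1 c"
    and g: "(W, g) \<in> parabolic_maps" "\<forall>w\<in>W. f (g w) = w"
    and A: "A \<in> attracting_axes g" and y: "y \<in> parabolic_basin W g"
  shows "converges_along W g A y"
proof -
  have c: "c \<noteq> 0" using f(2) by (auto simp: leading_term_def)
  obtain q b u where lt: "leading_term g q b" and u: "u \<noteq> 0" "b * u ^ q \<in> complex_of_real ` {..<0}"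
    and Aeq: "A = {of_real t * u | t. t > 0}"
    using A by (auto simp: attracting_axes_def)
  note qb = local_inverse_leading_term[OF f g lt]
  from u(2) qb obtain s where s: "s < 0" "- c * u = of_real s" by auto
  then have "u = of_real (- s) * (1 / c)" using c by (simp add: nonzero_eq_divide_eq minus_equation_iff mult.commute)
  then have sgnu: "sgn u = sgn (1 / c)"
    using s(1) by (simp add: sgn_mult sgn_of_real)
  have uA: "u \<in> A" unfolding Aeq by (rule CollectI, rule exI[of _ 1]) simp
  define x where "x n = (g ^^ n) y" for n
  define Z where "Z n = leau 1 c (x n)" for n
  have x0: "x n \<noteq> 0" for n using parabolic_basinD[OF y] by (simp add: x_def)
  have "filterlim x (at 0) sequentially"
    using parabolic_basinD[OF y] by (simp add: filterlim_at x_def[abs_def])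
  from filterlim_compose[OF local_inverse_increment[OF f g] this]
  have "(\<lambda>n. Z (Suc n) - Z n) \<longlonglongrightarrow> - 1" by (simp add: Z_def x_def)
  then have "(\<lambda>n. Z n / of_nat n) \<longlonglongrightarrow> - 1" by (rule tendsto_quotient_of_increments)
  then have "(\<lambda>n. sgn (1 / c * inverse (- (Z n / of_nat n)))) \<longlonglongrightarrow> sgn (1 / c * inverse (- (- 1)))"
    using c by (intro tendsto_sgn tendsto_mult tendsto_const tendsto_inverse tendsto_minus) auto
  moreover have "\<forall>\<^sub>F n in sequentially. sgn (1 / c * inverse (- (Z n / of_nat n))) = sgn (x n)"
    using eventually_gt_at_top[of 0]
  proof eventually_elim
    case (elim n)
    have "1 / c * inverse (- (Z n / of_nat n)) = of_real (of_nat n) * x n"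
      using elim c x0[of n] by (simp add: Z_def leau_def field_simps)
    moreover have "sgn (of_real (of_nat n) * x n) = sgn (x n)"
      using elim by (subst sgn_mult, subst sgn_of_real) simp
    ultimately show ?case by simp
  qed
  ultimately have "(\<lambda>n. sgn (x n)) \<longlonglongrightarrow> sgn u"
    unfolding sgnu by (auto elim: Lim_transform_eventually)
  then show ?thesis
    unfolding converges_along_def using y uA by (auto simp: x_def)
qed

lemma repelling_petalE:
  assumes f: "(D, f) \<in> parabolic_maps" "leading_term f 1 c" and P: "repelling_petal D f P"
  obtains W g where "(W, g) \<in> parabolic_maps" "\<forall>w\<in>W. g w \<in> D \<and> f (g w) = w"
    "P \<subseteq> D" "open P" "inj_on g P" "g ` P \<subseteq> P" "P \<subseteq> parabolic_basin W g"
    "\<And>y. y \<in> parabolic_basin W g \<Longrightarrow> \<forall>\<^sub>F n in sequentially. (g ^^ n) y \<in> P"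
proof -
  obtain W g A where W: "P \<subseteq> D" "inj_on f P" "(W, g) \<in> parabolic_maps"
      "\<forall>w\<in>W. g w \<in> D \<and> f (g w) = w" and at: "attracting_petal W g A P"
    using P by (auto simp: repelling_petal_def)
  have A: "A \<in> attracting_axes g" and P': "open P" "inj_on g P" "g ` P \<subseteq> P" "P \<subseteq> W"
    and conv: "\<And>z. converges_along W g A z \<longleftrightarrow>
          (\<forall>n. iterate_defined W g n z) \<and> (\<forall>\<^sub>F n in sequentially. (g ^^ n) z \<in> P)"
    using at by (auto simp: attracting_petal_def)
  have "y \<in> parabolic_basin W g" if "y \<in> P" for y
  proof -
    have "(g ^^ n) y \<in> P" for n by (rule iterates_in_invariant_set[OF P'(3) that])
    then have "converges_along W g A y"
      unfolding conv using P'(4) by (auto simp: iterate_defined_def)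
    then show ?thesis by (simp add: converges_along_def)
  qed
  moreover have "\<forall>\<^sub>F n in sequentially. (g ^^ n) y \<in> P" if "y \<in> parabolic_basin W g" for y
    using backward_orbit_direction[OF f W(3) _ A that] W(4) conv by auto
  ultimately show ?thesis
    using that W P' by blast
qed

text \<open>As \<open>f\<close> is injective near 0, its right inverse \<open>g\<close> is also a left inverse there.\<close>

lemma local_inverse_left:
  assumes f: "(D, f) \<in> parabolic_maps"
    and g: "(W, g) \<in> parabolic_maps" "\<forall>w\<in>W. g w \<in> D \<and> f (g w) = w"
  shows "\<forall>\<^sub>F z in at 0. g (f z) = z"
proof -
  note f' = parabolic_mapsD[OF f] and g' = parabolic_mapsD[OF g(1)]
  obtain d where d: "d > 0" "ball 0 d \<subseteq> D" "inj_on f (ball 0 d)"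
    using has_complex_derivative_locally_injective[OF f'(3,2,1)] f'(5) by auto
  have fc: "filterlim f (nhds 0) (nhds 0)" and gc: "filterlim g (nhds 0) (nhds 0)"
    using parabolic_map_quotient(2)[OF f] parabolic_map_quotient(2)[OF g(1)] f' g'
    by (simp_all add: tendsto_nhds_iff)
  have "\<forall>\<^sub>F w in nhds 0. w \<in> W \<and> g w \<in> ball 0 d"
    using g' d by (intro eventually_conj eventually_nhds_in_open topological_tendstoD[OF gc]) auto
  then have "\<forall>\<^sub>F z in nhds 0. f z \<in> W \<and> g (f z) \<in> ball 0 d"
    using fc by (rule eventually_compose_filterlim)
  moreover have "\<forall>\<^sub>F z in nhds 0. z \<in> ball 0 d"
    using d by (intro eventually_nhds_in_open) auto
  ultimately have "\<forall>\<^sub>F z in nhds 0. g (f z) = z"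
    by eventually_elim (use d(3) g(2) in \<open>auto dest: inj_onD\<close>)
  then show ?thesis by (auto simp: eventually_at_filter elim: eventually_mono)
qed

lemma parabolic_pair_region:
  assumes f: "(D, f) \<in> parabolic_maps" "leading_term f 1 c"
    and g: "(W, g) \<in> parabolic_maps" "\<forall>w\<in>W. g w \<in> D \<and> f (g w) = w"
  obtains R where "R > 0"
    "\<And>z. z \<noteq> 0 \<Longrightarrow> R \<le> norm (leau 1 c z) \<Longrightarrow> z \<in> D \<and> z \<in> W \<and> f z \<noteq> 0 \<and> g z \<noteq> 0 \<and> g (f z) = z \<and>
       norm (leau 1 c (f z) - leau 1 c z - 1) < 1/4 \<and> norm (leau 1 c (g z) - leau 1 c z + 1) < 1/4"
proof -
  have g': "\<forall>w\<in>W. f (g w) = w" using g by auto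
  have W: "\<forall>\<^sub>F w in at 0. w \<in> W"
    using parabolic_mapsD[OF g(1)] by (simp add: eventually_at_in_open')
  have "\<forall>\<^sub>F w in at 0. g w \<noteq> 0"
    using local_inverse_at_0(1)[OF f(1) g(1) g'] by (simp add: filterlim_at)
  moreover have "\<forall>\<^sub>F w in at 0. norm (leau 1 c (g w) - leau 1 c w + 1) < 1/4"
    using tendstoD[OF local_inverse_increment[OF f g(1) g'], of "1/4"] by (simp add: dist_norm)
  moreover note local_inverse_left[OF f(1) g]
  ultimately have "\<forall>\<^sub>F z in at 0. z \<in> W \<and> g z \<noteq> 0 \<and> g (f z) = z \<and>
      norm (leau 1 c (g z) - leau 1 c z + 1) < 1/4"
    using W by eventually_elim simp
  from leau_region[OF f this] that show ?thesis
    by (smt (verit, ccfv_threshold))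
qed

text \<open>Along the backward orbits that start far to the left in the Leau coordinate, each step is
  close to the translation by \<open>- 1\<close>.\<close>

lemma backward_iterates:
  assumes step: "\<forall>z. z \<noteq> 0 \<and> R \<le> norm (leau 1 c z) \<longrightarrow>
      z \<in> W \<and> g z \<noteq> 0 \<and> norm (leau 1 c (g z) - leau 1 c z + 1) < 1/4"
    and z: "z \<noteq> 0" "Re (leau 1 c z) \<le> - R"
  shows "(g ^^ n) z \<noteq> 0" "(g ^^ n) z \<in> W"
    "Re (leau 1 c ((g ^^ n) z)) \<le> Re (leau 1 c z) - 3/4 * n"
    "Re (leau 1 c z) - 5/4 * n \<le> Re (leau 1 c ((g ^^ n) z))"
    "\<bar>Im (leau 1 c ((g ^^ n) z)) - Im (leau 1 c z)\<bar> \<le> n / 4"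
proof -
  have *: "(g ^^ n) z \<noteq> 0 \<and> Re (leau 1 c ((g ^^ n) z)) \<le> Re (leau 1 c z) - 3/4 * n \<and>
      Re (leau 1 c z) - 5/4 * n \<le> Re (leau 1 c ((g ^^ n) z)) \<and>
      \<bar>Im (leau 1 c ((g ^^ n) z)) - Im (leau 1 c z)\<bar> \<le> n / 4" for n
  proof (induction n)
    case (Suc n)
    let ?y = "(g ^^ n) z"
    have "R \<le> norm (leau 1 c ?y)"
      using abs_Re_le_cmod[of "leau 1 c ?y"] Suc z by linarith
    with Suc step have y: "g ?y \<noteq> 0" "norm (leau 1 c (g ?y) - leau 1 c ?y + 1) < 1/4" by auto
    from y(2) have "\<bar>Re (leau 1 c (g ?y)) - Re (leau 1 c ?y) + 1\<bar> < 1/4"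
        "\<bar>Im (leau 1 c (g ?y)) - Im (leau 1 c ?y)\<bar> < 1/4"
      using abs_Re_le_cmod[of "leau 1 c (g ?y) - leau 1 c ?y + 1"]
        abs_Im_le_cmod[of "leau 1 c (g ?y) - leau 1 c ?y + 1"] by auto
    moreover have "real (Suc n) = real n + 1" by simp
    ultimately have "Re (leau 1 c (g ?y)) \<le> Re (leau 1 c z) - 3/4 * real (Suc n)"
        "Re (leau 1 c z) - 5/4 * real (Suc n) \<le> Re (leau 1 c (g ?y))"
        "\<bar>Im (leau 1 c (g ?y)) - Im (leau 1 c z)\<bar> \<le> real (Suc n) / 4"
      using Suc by argo+
    with y(1) show ?case by simp
  qed (use z in auto)
  from *[of n] show "(g ^^ n) z \<noteq> 0" 
    "Re (leau 1 c ((g ^^ n) z)) \<le> Re (leau 1 c z) - 3/4 * n"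
    "Re (leau 1 c z) - 5/4 * n \<le> Re (leau 1 c ((g ^^ n) z))"
    "\<bar>Im (leau 1 c ((g ^^ n) z)) - Im (leau 1 c z)\<bar> \<le> n / 4" by auto
  have "R \<le> norm (leau 1 c ((g ^^ n) z))"
    using abs_Re_le_cmod[of "leau 1 c ((g ^^ n) z)"] *[of n] z by linarith
  with step *[of n] show "(g ^^ n) z \<in> W" by auto
qed

lemma left_region_in_backward_basin:
  assumes step: "\<forall>z. z \<noteq> 0 \<and> R \<le> norm (leau 1 c z) \<longrightarrow>
      z \<in> W \<and> g z \<noteq> 0 \<and> norm (leau 1 c (g z) - leau 1 c z + 1) < 1/4"
    and z: "z \<noteq> 0" "Re (leau 1 c z) \<le> - R" and c: "c \<noteq> 0"
  shows "z \<in> parabolic_basin W g"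
proof -
  note it = backward_iterates[OF step z]
  have "filterlim (\<lambda>n. - Re (leau 1 c z) + 3/4 * real n) at_top sequentially"
    by (intro filterlim_tendsto_add_at_top[OF tendsto_const]
        filterlim_tendsto_pos_mult_at_top[OF tendsto_const] filterlim_real_sequentially) auto
  then have "filterlim (\<lambda>n. norm (leau 1 c ((g ^^ n) z))) at_top sequentially"
  proof (rule filterlim_at_top_mono, intro always_eventually allI)
    fix n show "- Re (leau 1 c z) + 3/4 * real n \<le> norm (leau 1 c ((g ^^ n) z))"
      using it(3)[of n] abs_Re_le_cmod[of "leau 1 c ((g ^^ n) z)"] by linarith
  qed
  then have "(\<lambda>n. (g ^^ n) z) \<longlonglongrightarrow> 0"
    using c by (intro tendsto_0_of_leau[of 1 c]) (auto simp: filterlim_at_infinity_conv_norm_at_top)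
  then show ?thesis
    using it(1,2) it(2)[of 0] by (auto simp: parabolic_basin_def iterate_defined_def)
qed

text \<open>A forward orbit that starts to the left of the line \<open>Re = - X\<close> moves to the right by about 1 in
  each step and enters the strip to the right of this line, of width \<open>5/4\<close>; up to this point the
  local inverse \<open>g\<close> retraces it.\<close>

lemma first_entry_from_left:
  assumes step: "\<forall>z. z \<noteq> 0 \<and> R \<le> norm (leau 1 c z) \<longrightarrow>
      f z \<noteq> 0 \<and> g (f z) = z \<and> norm (leau 1 c (f z) - leau 1 c z - 1) < 1/4"
    and z: "z \<noteq> 0" "Re (leau 1 c z) < - X" and "R \<le> X"
  obtains j s where "s \<noteq> 0" "(g ^^ j) s = z" "- X \<le> Re (leau 1 c s)" "Re (leau 1 c s) \<le> - X + 5/4"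
proof -
  have nz: "(f ^^ i) z \<noteq> 0 \<and> Re (leau 1 c z) + 3/4 * i \<le> Re (leau 1 c ((f ^^ i) z)) \<and> (g ^^ i) ((f ^^ i) z) = z"
    if "\<forall>k<i. Re (leau 1 c ((f ^^ k) z)) < - X" for i
    using that
  proof (induction i)
    case (Suc i)
    let ?y = "(f ^^ i) z"
    have IH: "?y \<noteq> 0" "Re (leau 1 c z) + 3/4 * i \<le> Re (leau 1 c ?y)" "(g ^^ i) ?y = z" using Suc by auto
    have "Re (leau 1 c ?y) < - X" using Suc by auto
    then have "R \<le> norm (leau 1 c ?y)"
      using abs_Re_le_cmod[of "leau 1 c ?y"] \<open>R \<le> X\<close> by linarith
    from step[rule_format, OF conjI[OF IH(1) this]]
    have y: "f ?y \<noteq> 0" "g (f ?y) = ?y" "norm (leau 1 c (f ?y) - leau 1 c ?y - 1) < 1/4" by auto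
    have "\<bar>Re (leau 1 c (f ?y)) - Re (leau 1 c ?y) - 1\<bar> < 1/4"
      using y(3) abs_Re_le_cmod[of "leau 1 c (f ?y) - leau 1 c ?y - 1"] by auto
    moreover have "(g ^^ Suc i) ((f ^^ Suc i) z) = z"
      using y(2) IH(3) by (simp add: funpow_swap1)
    moreover have "real (Suc i) = real i + 1" by simp
    ultimately show ?case using y(1) IH unfolding funpow.simps o_apply by (intro conjI; argo)
  qed (use z in auto)
  have "\<exists>j. - X \<le> Re (leau 1 c ((f ^^ j) z))"
  proof (rule ccontr)
    assume "\<not> ?thesis"
    then have "\<forall>k. Re (leau 1 c ((f ^^ k) z)) < - X" by (auto simp: not_le)
    with nz have *: "Re (leau 1 c z) + 3/4 * real i \<le> - X" for i by (meson less_imp_le order_trans)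
    have "\<exists>i::nat. - X - Re (leau 1 c z) < of_nat i * (3/4)"
      by (rule ex_less_of_nat_mult) simp
    then obtain i :: nat where "- X - Re (leau 1 c z) < of_nat i * (3/4)" by blast
    with *[of i] show False by (simp add: mult.commute)
  qed
  then obtain j where j: "- X \<le> Re (leau 1 c ((f ^^ j) z))" "\<forall>k<j. Re (leau 1 c ((f ^^ k) z)) < - X"
    using exists_least_iff[of "\<lambda>j. - X \<le> Re (leau 1 c ((f ^^ j) z))"] by (auto simp: not_le)
  then obtain i where i: "j = Suc i" using z by (cases j) auto
  let ?y = "(f ^^ i) z"
  have y: "?y \<noteq> 0" "Re (leau 1 c ?y) < - X" using nz[of i] j i by auto
  then have "R \<le> norm (leau 1 c ?y)"
    using abs_Re_le_cmod[of "leau 1 c ?y"] \<open>R \<le> X\<close> by linarith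
  from step[rule_format, OF conjI[OF y(1) this]] have "norm (leau 1 c (f ?y) - leau 1 c ?y - 1) < 1/4" by auto
  then have "\<bar>Re (leau 1 c (f ?y)) - Re (leau 1 c ?y) - 1\<bar> < 1/4"
    using abs_Re_le_cmod[of "leau 1 c (f ?y) - leau 1 c ?y - 1"] by auto
  then have "Re (leau 1 c (f ?y)) \<le> - X + 5/4" using y(2) by argo
  then have "Re (leau 1 c ((f ^^ j) z)) \<le> - X + 5/4" using i by simp
  with nz[OF j(2)] j(1) that show ?thesis by blast
qed

text \<open>The functional equation extends the imaginary part of the repelling Fatou coordinate from \<open>P\<close> to
  a continuous function, invariant under \<open>g\<close>, on the set of points whose orbit under \<open>g\<close> enters
  \<open>P\<close>.  It is bounded on compact subsets of this set.\<close>

lemma repelling_coordinate_bounded: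
  assumes W: "open W" "continuous_on W g" and P: "open P" "g ` P \<subseteq> P" "P \<subseteq> W"
    and \<phi>: "continuous_on P \<phi>" "\<And>y. y \<in> P \<Longrightarrow> \<phi> (g y) = \<phi> y - 1"
    and K: "compact K" "\<And>y. y \<in> K \<Longrightarrow> \<exists>n. iterate_defined W g n y \<and> (g ^^ n) y \<in> P"
  obtains M :: real where "\<And>y n. y \<in> K \<Longrightarrow> (g ^^ n) y \<in> P \<Longrightarrow> \<bar>Im (\<phi> ((g ^^ n) y))\<bar> \<le> M"
proof -
  have inP: "(g ^^ n) y \<in> P \<and> Im (\<phi> ((g ^^ n) y)) = Im (\<phi> y)" if "y \<in> P" for n y
    by (induction n) (use that P(2) \<phi>(2) in auto)
  have indep: "Im (\<phi> ((g ^^ n) y)) = Im (\<phi> ((g ^^ m) y))" if "(g ^^ n) y \<in> P" "(g ^^ m) y \<in> P" for m n y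
  proof -
    have "Im (\<phi> ((g ^^ (m + n)) y)) = Im (\<phi> ((g ^^ n) y))"
      using inP[OF that(1), of m] by (simp add: funpow_add)
    moreover have "Im (\<phi> ((g ^^ (n + m)) y)) = Im (\<phi> ((g ^^ m) y))"
      using inP[OF that(2), of n] by (simp add: funpow_add)
    ultimately show ?thesis by (simp add: add.commute)
  qed
  define V where "V n m = {y. iterate_defined W g n y \<and> (g ^^ n) y \<in> {x\<in>P. \<bar>Im (\<phi> x)\<bar> < real m}}" for n m :: nat
  have "open (V n m)" for n m
  proof -
    have "open (P \<inter> \<phi> -` {w. \<bar>Im w\<bar> < real m})"
      by (intro continuous_open_preimage[OF \<phi>(1) P(1)] open_Collect_less continuous_intros)
    moreover have "P \<inter> \<phi> -` {w. \<bar>Im w\<bar> < real m} = {x\<in>P. \<bar>Im (\<phi> x)\<bar> < real m}" by auto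
    ultimately show ?thesis
      unfolding V_def by (intro open_iterate_preimage[OF W]) simp
  qed
  then have op: "\<And>T. T \<in> (\<lambda>(n, m). V n m) ` UNIV \<Longrightarrow> open T" by auto
  have "K \<subseteq> \<Union> ((\<lambda>(n, m). V n m) ` UNIV)"
  proof
    fix y assume "y \<in> K"
    then obtain n where "iterate_defined W g n y \<and> (g ^^ n) y \<in> P" using K by blast
    moreover obtain m :: nat where "\<bar>Im (\<phi> ((g ^^ n) y))\<bar> < real m" using reals_Archimedean2 by blast
    ultimately have "y \<in> V n m" by (simp add: V_def)
    then show "y \<in> \<Union> ((\<lambda>(n, m). V n m) ` UNIV)" by auto
  qed
  then obtain F where F: "F \<subseteq> UNIV" "finite F" "K \<subseteq> (\<Union>(n, m)\<in>F. V n m)"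
    using compactE_image[OF K(1), of UNIV "\<lambda>(n, m). V n m"] op by (metis UNIV_I imageI)
  define M where "M = (\<Sum>(n, m)\<in>F. real m)"
  have "\<bar>Im (\<phi> ((g ^^ n) y))\<bar> \<le> M" if "y \<in> K" "(g ^^ n) y \<in> P" for y n
  proof -
    have "y \<in> (\<Union>(n, m)\<in>F. V n m)" using F(3) that(1) by (rule subsetD)
    then obtain n' m where nm: "(n', m) \<in> F" "y \<in> V n' m" by auto
    then have "\<bar>Im (\<phi> ((g ^^ n) y))\<bar> \<le> real m"
      using indep[OF that(2), of n'] by (auto simp: V_def)
    also have "real m \<le> M"
      unfolding M_def using member_le_sum[OF nm(1), of "\<lambda>(n, m). real m"] F(2) by auto
    finally show ?thesis .
  qed
  then show ?thesis using that by blast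
qed


text \<open>Points of the repelling petal whose Fatou coordinate has a large imaginary part, in absolute
  value, belong to the immediate basin.  The backward orbit of such a point contains a point \<open>x\<close>
  whose forward orbit, in the Leau coordinate, enters a fixed vertical strip at a point \<open>s\<close>.  The
  coordinate is bounded on the compact parts of the strip, so \<open>s\<close> is far from the real axis and
  lies in the attracting sector, together with one of the two vertical half-lines starting at
  \<open>s\<close>.  The pull-back of this half-line along the orbit from \<open>x\<close> to \<open>s\<close> is a connected
  subset of the basin that contains \<open>x\<close>, and its far end lies in the attracting sector.\<close>

lemma horn_ends_in_basin:
  assumes f: "(D, f) \<in> parabolic_maps" "leading_term f 1 c"
    and B: "is_immediate_basin D f A B"
    and rep: "repelling_Fatou_coordinate D f P \<phi> r"
    and ext: "extended_inverse_coordinate D f P \<phi> r \<psi>"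
  obtains M where "\<And>u. Re u < r \<Longrightarrow> M < \<bar>Im u\<bar> \<Longrightarrow> \<psi> u \<in> B"
proof -
  have c: "c \<noteq> 0" using f(2) by (auto simp: leading_term_def)
  note f' = parabolic_mapsD[OF f(1)]
  have rp: "repelling_petal D f P" and \<phi>: "\<phi> holomorphic_on P" "\<And>z. z \<in> P \<Longrightarrow> f z \<in> P \<Longrightarrow> \<phi> (f z) = \<phi> z + 1"
    using rep by (auto simp: repelling_Fatou_coordinate_def)
  obtain W g where g: "(W, g) \<in> parabolic_maps" "\<forall>w\<in>W. g w \<in> D \<and> f (g w) = w"
    and P: "open P" "g ` P \<subseteq> P" "P \<subseteq> parabolic_basin W g"
    and absorb: "\<And>y. y \<in> parabolic_basin W g \<Longrightarrow> \<forall>\<^sub>F n in sequentially. (g ^^ n) y \<in> P"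
    using repelling_petalE[OF f rp] by metis
  note g' = parabolic_mapsD[OF g(1)]
  have PW: "P \<subseteq> W" using P(3) parabolic_basinD(4) by blast
  have \<phi>g: "\<phi> (g y) = \<phi> y - 1" if "y \<in> P" for y
  proof -
    have "g y \<in> P" "f (g y) = y" using that P(2) PW g(2) by auto
    then show ?thesis using \<phi>(2)[of "g y"] that by simp
  qed
  have \<phi>gn: "(g ^^ n) y \<in> P \<and> \<phi> ((g ^^ n) y) = \<phi> y - of_nat n" if "y \<in> P" for n y
    by (induction n) (use that P(2) \<phi>g in auto)
  note B' = immediate_basin_invariant[OF f(1) B]
  have Bc: "B \<in> components (parabolic_basin D f)" using B by (simp add: is_immediate_basin_def)
  obtain R1 where R1: "R1 > 0"
    "\<And>z. z \<noteq> 0 \<Longrightarrow> R1 \<le> norm (leau 1 c z) \<Longrightarrow> z \<in> D \<and> z \<in> W \<and> f z \<noteq> 0 \<and> g z \<noteq> 0 \<and> g (f z) = z \<and>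
       norm (leau 1 c (f z) - leau 1 c z - 1) < 1/4 \<and> norm (leau 1 c (g z) - leau 1 c z + 1) < 1/4"
    using parabolic_pair_region[OF f g] by blast
  have gstep: "\<forall>z. z \<noteq> 0 \<and> R1 \<le> norm (leau 1 c z) \<longrightarrow>
      z \<in> W \<and> g z \<noteq> 0 \<and> norm (leau 1 c (g z) - leau 1 c z + 1) < 1/4"
    and fstep: "\<forall>z. z \<noteq> 0 \<and> R1 \<le> norm (leau 1 c z) \<longrightarrow>
      f z \<noteq> 0 \<and> g (f z) = z \<and> norm (leau 1 c (f z) - leau 1 c z - 1) < 1/4"
    using R1(2) by blast+
  obtain R2 where R2: "R2 > 0" "\<And>z. z \<noteq> 0 \<Longrightarrow> leau 1 c z \<in> attracting_sector R2 \<Longrightarrow> z \<in> B"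
    using attracting_sector_in_immediate_basin[OF f B] by blast
  define X where "X = R1 + 2"
  \<comment> \<open>Points of the strip \<open>- X \<le> Re \<le> - X + 5/4\<close> whose distance to the real axis is greater than
    \<open>L\<close> lie in the attracting sector \<open>R2\<close>.\<close>
  define L where "L = R2 + X + 1"
  have inv: "leau 1 c (- 1 / (c * w)) = w" "- 1 / (c * w) \<noteq> 0" if "w \<noteq> 0" for w
    using c that by (auto simp: leau_def)
  define box where "box = cbox (Complex (- X) (- L)) (Complex (- X + 5/4) L)"
  have box: "w \<in> box \<longleftrightarrow> - X \<le> Re w \<and> Re w \<le> - X + 5/4 \<and> \<bar>Im w\<bar> \<le> L" for w
    by (auto simp: box_def in_cbox_complex_iff abs_le_iff)
  have box0: "w \<noteq> 0" if "w \<in> box" for w using that R1(1) by (auto simp: box X_def)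
  define K where "K = (\<lambda>w. - 1 / (c * w)) ` box"
  have "compact K"
    unfolding K_def using c box0
    by (intro compact_continuous_image continuous_intros) (auto simp: box_def)
  moreover have "\<exists>n. iterate_defined W g n y \<and> (g ^^ n) y \<in> P" if "y \<in> K" for y
  proof -
    obtain w where w: "w \<in> box" "y = - 1 / (c * w)" using \<open>y \<in> K\<close> unfolding K_def by blast
    have "y \<noteq> 0" "leau 1 c y = w" using inv box0[OF w(1)] w(2) by auto
    moreover from this have "Re (leau 1 c y) \<le> - R1" using w(1) by (auto simp: box X_def)
    ultimately have y: "y \<in> parabolic_basin W g"
      using left_region_in_backward_basin[OF gstep] c by blast
    then show ?thesis
      using absorb[OF y] parabolic_basinD(5)[OF y] by (meson eventually_sequentially le_refl)
  qed
  ultimately obtain M where M: "\<And>y n. y \<in> K \<Longrightarrow> (g ^^ n) y \<in> P \<Longrightarrow> \<bar>Im (\<phi> ((g ^^ n) y))\<bar> \<le> M"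
    using repelling_coordinate_bounded[of W g P \<phi> K] g' P(1,2) PW \<phi>(1) \<phi>g
      holomorphic_on_imp_continuous_on by metis
  have "\<psi> u \<in> B" if u: "Re u < r" "M < \<bar>Im u\<bar>" for u
  proof -
    have \<psi>u: "\<psi> u \<in> P" "\<phi> (\<psi> u) = u"
      using ext u(1) by (auto simp: extended_inverse_coordinate_def)
    then have bas: "\<psi> u \<in> parabolic_basin W g" using P(3) by blast
    note orb = parabolic_basinD[OF bas]
    define Z where "Z n = leau 1 c ((g ^^ n) (\<psi> u))" for n
    have "filterlim (\<lambda>n. (g ^^ n) (\<psi> u)) (at 0) sequentially"
      using orb by (simp add: filterlim_at)
    moreover have "\<forall>w\<in>W. f (g w) = w" using g(2) by blast
    ultimately have "(\<lambda>n. Z (Suc n) - Z n) \<longlonglongrightarrow> - 1"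
      using filterlim_compose[OF local_inverse_increment[OF f g(1)]] by (auto simp: Z_def)
    then have "(\<lambda>n. Re (Z (Suc n) - Z n)) \<longlonglongrightarrow> Re (- 1)" by (rule tendsto_Re)
    then have "\<forall>\<^sub>F n in sequentially. Re (Z (Suc n) - Z n) < - (1/2)"
      by (rule order_tendstoD) simp
    then have "filterlim (\<lambda>n. - Re (Z n)) at_top sequentially"
      by (intro filterlim_at_top_of_increment[of "1/2"]) (auto elim: eventually_mono)
    then have "\<forall>\<^sub>F n in sequentially. X < - Re (Z n)" by (simp add: filterlim_at_top_dense)
    then obtain n where n: "X < - Re (Z n)" by (meson eventually_sequentially le_refl)
    define x where "x = (g ^^ n) (\<psi> u)"
    have x: "x \<noteq> 0" "Re (leau 1 c x) < - X" "x \<in> P" "\<phi> x = u - of_nat n"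
      using orb(2) n \<phi>gn[OF \<psi>u(1), of n] \<psi>u(2) by (auto simp: x_def Z_def)
    obtain j s where s: "s \<noteq> 0" "(g ^^ j) s = x" "- X \<le> Re (leau 1 c s)" "Re (leau 1 c s) \<le> - X + 5/4"
    proof (rule first_entry_from_left[OF fstep x(1,2)])
      show "R1 \<le> X" by (simp add: X_def)
    qed
    have "s \<notin> K"
      using M[of s j] s(2) x(3,4) u(2) by auto
    have "L < \<bar>Im (leau 1 c s)\<bar>"
    proof (rule ccontr)
      assume "\<not> ?thesis"
      then have "leau 1 c s \<in> box" using s by (auto simp: box)
      moreover have "s = - 1 / (c * leau 1 c s)" using s(1) c by (simp add: leau_def)
      ultimately show False using \<open>s \<notin> K\<close> unfolding K_def by blast
    qed
    define e where "e = sgn (Im (leau 1 c s))"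
    have e: "\<bar>e\<bar> = 1" "\<bar>Im (leau 1 c s) + e * t\<bar> = \<bar>Im (leau 1 c s)\<bar> + t" if "t \<ge> 0" for t
      using \<open>L < \<bar>Im (leau 1 c s)\<bar>\<close> R1(1) R2(1) that
      by (auto simp: e_def L_def X_def sgn_if)
    define w where "w t = leau 1 c s + \<i> * of_real (e * t)" for t
    define \<sigma> where "\<sigma> t = - 1 / (c * w t)" for t
    have Rew: "Re (w t) = Re (leau 1 c s)" for t by (simp add: w_def)
    have w0: "w t \<noteq> 0" for t using Rew[of t] s(4) R1(1) by (auto simp: X_def)
    have \<sigma>: "\<sigma> t \<noteq> 0" "leau 1 c (\<sigma> t) = w t" for t
      unfolding \<sigma>_def using inv[OF w0] by auto
    have \<sigma>0: "\<sigma> 0 = s" using s(1) c by (simp add: \<sigma>_def w_def leau_def)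
    have left: "Re (leau 1 c (\<sigma> t)) \<le> - R1" for t
      unfolding \<sigma> Rew using s(4) by (simp add: X_def)
    note it = backward_iterates[OF gstep \<sigma>(1) left]
    have \<sigma>B: "\<sigma> t \<in> B" if "t \<ge> 0" for t
    proof (rule R2(2))
      show "leau 1 c (\<sigma> t) \<in> attracting_sector R2"
        using e(2)[OF that] \<open>L < \<bar>Im (leau 1 c s)\<bar>\<close> s(3) that Rew[of t]
        unfolding \<sigma> attracting_sector_def by (simp add: w_def L_def)
    qed (rule \<sigma>)
    have fg: "iterate_defined D f i ((g ^^ i) (\<sigma> t)) \<and> (f ^^ i) ((g ^^ i) (\<sigma> t)) = \<sigma> t" for i t
    proof (induction i)
      case (Suc i)
      have "(g ^^ i) (\<sigma> t) \<in> W" by (rule it)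
      then have "g ((g ^^ i) (\<sigma> t)) \<in> D" "f (g ((g ^^ i) (\<sigma> t))) = (g ^^ i) (\<sigma> t)" using g(2) by auto
      with Suc show ?case by (simp add: iterate_defined_Suc funpow_swap1)
    qed (simp add: iterate_defined_def)
    define \<gamma> where "\<gamma> t = (g ^^ j) (\<sigma> t)" for t
    have "continuous_on {0..} (\<lambda>t. (g ^^ i) (\<sigma> t))" for i
    proof (induction i)
      case 0
      show ?case using w0 c unfolding \<sigma>_def w_def funpow_0 by (intro continuous_intros) auto
    next
      case (Suc i)
      have "continuous_on W g" using g'(3) by (rule holomorphic_on_imp_continuous_on)
      then show ?case
        using continuous_on_compose2[OF _ Suc, of W g] it(2) by auto
    qed
    then have "continuous_on {0..} \<gamma>" unfolding \<gamma>_def .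
    then have "connected (\<gamma> ` {0..})"
      by (intro connected_continuous_image convex_connected) auto
    moreover have "\<gamma> ` {0..} \<subseteq> parabolic_basin D f"
    proof clarify
      fix t :: real assume "t \<ge> 0"
      then have "(f ^^ j) (\<gamma> t) \<in> parabolic_basin D f" using \<sigma>B B'(2) fg[of j t] by (auto simp: \<gamma>_def)
      then show "\<gamma> t \<in> parabolic_basin D f"
        using parabolic_basin_pullback[of f D j "\<gamma> t"] f'(4) fg[of j t] by (simp add: \<gamma>_def)
    qed
    \<comment> \<open>The \<open>j\<close> backward steps decrease the real part by at most \<open>5 j / 4\<close> and change the
      imaginary part by at most \<open>j / 4\<close>, which a height of \<open>2 j\<close> compensates.\<close>
    moreover have "\<gamma> (2 * real j) \<in> B"
    proof (rule R2(2))
      show "\<gamma> (2 * real j) \<noteq> 0" unfolding \<gamma>_def by (rule it)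
      have "Re (leau 1 c s) - 5/4 * j \<le> Re (leau 1 c (\<gamma> (2 * real j)))"
        using it(4)[of "2 * real j" j] unfolding \<gamma>_def \<sigma> Rew .
      moreover have "\<bar>Im (leau 1 c (\<gamma> (2 * real j))) - (Im (leau 1 c s) + e * (2 * real j))\<bar> \<le> j / 4"
        using it(5)[of j "2 * real j"] unfolding \<gamma>_def \<sigma> by (simp add: w_def)
      moreover have "\<bar>Im (leau 1 c s) + e * (2 * real j)\<bar> = \<bar>Im (leau 1 c s)\<bar> + 2 * real j"
        by (rule e(2)) simp
      ultimately have "R2 < Re (leau 1 c (\<gamma> (2 * real j))) + \<bar>Im (leau 1 c (\<gamma> (2 * real j)))\<bar>"
        using \<open>L < \<bar>Im (leau 1 c s)\<bar>\<close> s(3) unfolding L_def by linarith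
      then show "leau 1 c (\<gamma> (2 * real j)) \<in> attracting_sector R2"
        by (simp add: attracting_sector_def)
    qed
    moreover have "\<gamma> (2 * real j) \<in> \<gamma> ` {0..}" by (rule imageI) simp
    ultimately have "\<gamma> ` {0..} \<subseteq> B"
      using component_absorbs[OF Bc] by blast
    then have "x \<in> B" using s(2) \<sigma>0 by (auto simp: \<gamma>_def)
    have "(f ^^ i) ((g ^^ i) (\<psi> u)) = \<psi> u" for i
    proof (induction i)
      case (Suc i)
      have "(g ^^ i) (\<psi> u) \<in> W" using orb(1) .
      with Suc g(2) show ?case
        unfolding funpow_Suc_right[of i f] funpow.simps(2)[of i g] o_apply by simp
    qed simp
    then have "\<psi> u = (f ^^ n) x" by (simp add: x_def)
    with \<open>x \<in> B\<close> show ?thesis using iterates_in_invariant_set[OF B'(1)] by simp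
  qed
  then show ?thesis using that by blast
qed

section \<open>Finite Blaschke products\<close>

lemma Blaschke_factor_norm:
  fixes a z :: complex
  assumes "norm a < 1"
  shows "norm z < 1 \<Longrightarrow> norm ((z - a) / (1 - cnj a * z)) < 1"
    and "norm z = 1 \<Longrightarrow> norm ((z - a) / (1 - cnj a * z)) = 1"
    and "norm z \<le> 1 \<Longrightarrow> 1 - cnj a * z \<noteq> 0"
proof -
  have nz: "1 - cnj a * z \<noteq> 0" if "norm z \<le> 1"
  proof
    assume "1 - cnj a * z = 0"
    then have "norm (cnj a * z) = 1" by simp
    then have "1 = norm a * norm z" by (simp add: norm_mult)
    also have "\<dots> \<le> norm a" using that by (simp add: mult_left_le)
    finally show False using assms by simp
  qed
  then show "norm z \<le> 1 \<Longrightarrow> 1 - cnj a * z \<noteq> 0" .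
  have norm_id: "(norm (1 - cnj a * z))\<^sup>2 - (norm (z - a))\<^sup>2 = (1 - (norm a)\<^sup>2) * (1 - (norm z)\<^sup>2)"
    unfolding cmod_power2 by (simp add: power2_eq_square algebra_simps)
  have a: "(norm a)\<^sup>2 < 1" using assms by (simp add: power_less_one_iff abs_square_less_1)
  show "norm ((z - a) / (1 - cnj a * z)) < 1" if "norm z < 1"
  proof -
    have "(norm z)\<^sup>2 < 1" using that by (simp add: abs_square_less_1)
    with a have "(norm (z - a))\<^sup>2 < (norm (1 - cnj a * z))\<^sup>2"
      using norm_id mult_pos_pos[of "1 - (norm a)\<^sup>2" "1 - (norm z)\<^sup>2"] by linarith
    then have "norm (z - a) < norm (1 - cnj a * z)"
      by (rule power_less_imp_less_base) simp
    then show ?thesis using nz that by (simp add: norm_divide divide_less_eq)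
  qed
  show "norm ((z - a) / (1 - cnj a * z)) = 1" if "norm z = 1"
  proof -
    have "(norm (z - a))\<^sup>2 = (norm (1 - cnj a * z))\<^sup>2" using norm_id that by simp
    then have "norm (z - a) = norm (1 - cnj a * z)" by simp
    then show ?thesis using nz that by (simp add: norm_divide)
  qed
qed

text \<open>The properties of finite Blaschke products that are inherited by their compositions.  They make
  the restriction to the open unit disc proper.\<close>

definition proper_disc_map :: "(complex \<Rightarrow> complex) \<Rightarrow> bool" where
  "proper_disc_map G \<longleftrightarrow> G analytic_on cball 0 1 \<and>
     (\<forall>z. norm z < 1 \<longrightarrow> norm (G z) < 1) \<and> (\<forall>z. norm z = 1 \<longrightarrow> norm (G z) = 1)"

lemma finite_Blaschke_product_proper:
  assumes "finite_Blaschke_product d G" "d \<ge> 1"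
  shows "proper_disc_map G"
proof -
  obtain u a where u: "norm u = 1" and a: "\<And>i. i < d \<Longrightarrow> norm (a i) < 1"
    and G: "G = (\<lambda>z. u * (\<Prod>i<d. (z - a i) / (1 - cnj (a i) * z)))"
    using assms by (auto simp: finite_Blaschke_product_def)
  have "G analytic_on cball 0 1"
    unfolding G by (intro analytic_intros) (use a Blaschke_factor_norm(3) in auto)
  moreover have "norm (G z) < 1" if "norm z < 1" for z
  proof -
    define p where "p i = norm ((z - a i) / (1 - cnj (a i) * z))" for i
    have p: "0 \<le> p i" "i < d \<Longrightarrow> p i < 1" for i
      using Blaschke_factor_norm(1)[OF a that] by (auto simp: p_def)
    have "norm (G z) = (\<Prod>i<d. p i)"
      unfolding G p_def by (simp only: norm_mult u prod_norm mult_1_left)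
    also have "\<dots> = p 0 * (\<Prod>i\<in>{..<d} - {0}. p i)"
      using assms(2) by (intro prod.remove) auto
    also have "\<dots> \<le> p 0 * 1"
      using p by (intro mult_left_mono prod_le_1) (auto intro: less_imp_le)
    also have "\<dots> < 1" using p assms(2) by simp
    finally show ?thesis .
  qed
  moreover have "norm (G z) = 1" if "norm z = 1" for z
    unfolding G using Blaschke_factor_norm(2)[OF a that]
    by (simp only: norm_mult u prod_norm [symmetric] mult_1_left) (intro prod.neutral, auto)
  ultimately show ?thesis by (simp add: proper_disc_map_def)
qed

lemma proper_disc_map_cball:
  "proper_disc_map G \<Longrightarrow> z \<in> cball 0 1 \<Longrightarrow> G z \<in> cball 0 1"
  unfolding proper_disc_map_def by (cases "norm z = 1") (auto intro: less_imp_le)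

lemma proper_disc_map_fold:
  assumes "list_all2 finite_Blaschke_product \<tau> Gs" "\<forall>d\<in>set \<tau>. d \<ge> 1"
  shows "proper_disc_map (\<lambda>z. fold (\<lambda>h w. h w) Gs z)"
  using assms
proof (induction rule: list_all2_induct)
  case Nil
  then show ?case by (simp add: proper_disc_map_def analytic_on_ident)
next
  case (Cons d \<tau> h Gs)
  have h: "proper_disc_map h" using Cons finite_Blaschke_product_proper by auto
  have F: "proper_disc_map (\<lambda>z. fold (\<lambda>h w. h w) Gs z)" using Cons by auto
  have "((\<lambda>z. fold (\<lambda>h w. h w) Gs z) \<circ> h) analytic_on cball 0 1"
    using h F proper_disc_map_cball[OF h]
    by (intro analytic_on_compose_gen[of h _ _ "cball 0 1"]) (auto simp: proper_disc_map_def)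
  then show ?case
    using h F by (simp add: proper_disc_map_def o_def)
qed

lemma proper_disc_map_preimage:
  assumes G: "proper_disc_map G" and K: "compact K" "K \<subseteq> ball 0 1"
  shows "compact {z\<in>ball 0 1. G z \<in> K}"
proof -
  have "continuous_on (cball 0 1) G"
    using G by (auto simp: proper_disc_map_def intro: holomorphic_on_imp_continuous_on analytic_imp_holomorphic)
  then have "closed (cball 0 1 \<inter> G -` K)"
    using continuous_closed_preimage[OF _ closed_cball compact_imp_closed[OF K(1)]] by blast
  then have "compact (cball 0 1 \<inter> G -` K)"
    using bounded_cball bounded_Int compact_eq_bounded_closed by blast
  moreover have "cball 0 1 \<inter> G -` K = {z\<in>ball 0 1. G z \<in> K}"
  proof -
    have "norm z < 1" if "norm z \<le> 1" "G z \<in> K" for z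
    proof -
      have "norm (G z) < 1" using that(2) K(2) by auto
      then have "norm z \<noteq> 1" using G by (auto simp: proper_disc_map_def)
      with that(1) show ?thesis by simp
    qed
    then show ?thesis by auto
  qed
  ultimately show ?thesis by simp
qed

text \<open>The derivative is holomorphic on a neighbourhood of the closed disc, and it does not vanish
  identically, because \<open>G\<close> has values of modulus 1 and values of smaller modulus.\<close>

lemma proper_disc_map_critical_points:
  assumes G: "proper_disc_map G"
  shows "finite {z\<in>ball 0 1. deriv G z = 0}"
proof -
  obtain T where T: "open T" "cball 0 1 \<subseteq> T" "G holomorphic_on T"
    using G by (auto simp: proper_disc_map_def analytic_on_holomorphic)
  obtain e where e: "e > 0" "(\<Union>x\<in>cball 0 1. ball x e) \<subseteq> T"
    using compact_subset_open_imp_ball_epsilon_subset[OF compact_cball T(1,2)] .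
  have sub: "ball (0::complex) (1 + e) \<subseteq> T"
  proof
    fix z :: complex assume z: "z \<in> ball 0 (1 + e)"
    show "z \<in> T"
    proof (cases "norm z \<le> 1")
      case False
      have "sgn z - z = (inverse (norm z) - 1) *\<^sub>R z"
        by (simp add: sgn_div_norm scaleR_left_diff_distrib)
      then have "dist (sgn z) z = \<bar>inverse (norm z) - 1\<bar> * norm z"
        by (simp add: dist_norm)
      also have "\<dots> = norm z - 1"
      proof -
        have "norm z > 1" "z \<noteq> 0" using False by auto
        then show ?thesis by (simp add: abs_if field_simps)
      qed
      also have "\<dots> < e" using z by simp
      finally have "dist (sgn z) z < e" .
      moreover have "sgn z \<in> cball 0 1" by (simp add: norm_sgn)
      ultimately have "z \<in> (\<Union>x\<in>cball 0 1. ball x e)" unfolding UN_iff mem_ball by blast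
      then show ?thesis using e(2) by blast
    qed (use T in auto)
  qed
  have hol: "G holomorphic_on ball 0 (1 + e)"
    using T(3) sub holomorphic_on_subset by blast
  have "\<not> deriv G constant_on ball 0 (1 + e)" if inf: "infinite {z\<in>ball 0 1. deriv G z = 0}"
  proof
    assume "deriv G constant_on ball 0 (1 + e)"
    then obtain k where k: "\<And>z. z \<in> ball 0 (1 + e) \<Longrightarrow> deriv G z = k" by (auto simp: constant_on_def)
    obtain z where z: "z \<in> ball 0 1" "deriv G z = 0"
      using inf not_finite_existsD by (metis (mono_tags, lifting) mem_Collect_eq)
    then have "k = 0" using k[of z] e by auto
    have "(G has_field_derivative 0) (at z within ball 0 (1 + e))" if "z \<in> ball 0 (1 + e)" for z
      using holomorphic_derivI[OF hol open_ball that] k[OF that] \<open>k = 0\<close>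
      by (simp add: has_field_derivative_at_within)
    then obtain b where "\<And>z. z \<in> ball 0 (1 + e) \<Longrightarrow> G z = b"
      using has_field_derivative_zero_constant[OF convex_ball] by metis
    then have "G 0 = G 1" using e by auto
    moreover have "norm (G 0) < 1" "norm (G 1) = 1" using G by (auto simp: proper_disc_map_def)
    ultimately show False by simp
  qed
  moreover have "deriv G holomorphic_on ball 0 (1 + e)" using hol by (intro holomorphic_deriv) auto
  ultimately have "infinite {z\<in>ball 0 1. deriv G z = 0} \<Longrightarrow> finite {z\<in>cball 0 1. deriv G z = 0}"
    using e by (intro holomorphic_compact_finite_zeros[of _ "ball 0 (1 + e)"]) auto
  moreover have "{z\<in>ball 0 1. deriv G z = 0} \<subseteq> {z\<in>cball 0 1. deriv G z = 0}" by auto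
  ultimately show ?thesis using finite_subset by blast
qed

text \<open>The conjugacy to a Blaschke product makes the restriction of \<open>f\<close> to \<open>B\<close> proper with
  finitely many critical points.\<close>

lemma conjugate_proper:
  assumes G: "proper_disc_map G" and B: "open B" "f holomorphic_on B" "f ` B \<subseteq> B"
    and \<kappa>: "\<kappa> holomorphic_on B" "bij_betw \<kappa> B (ball 0 1)" "\<And>z. z \<in> B \<Longrightarrow> \<kappa> (f z) = G (\<kappa> z)"
  shows "\<And>K. compact K \<Longrightarrow> K \<subseteq> B \<Longrightarrow> compact {z\<in>B. f z \<in> K}"
    "finite {z\<in>B. deriv f z = 0}"
proof -
  have inj: "inj_on \<kappa> B" and img: "\<kappa> ` B = ball 0 1"
    using \<kappa>(2) by (auto simp: bij_betw_def)
  obtain \<iota> where \<iota>: "\<iota> holomorphic_on ball 0 1" "\<And>z. z \<in> B \<Longrightarrow> \<iota> (\<kappa> z) = z"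
    using holomorphic_has_inverse[OF \<kappa>(1) B(1) inj] img by metis
  have \<iota>': "\<iota> w \<in> B" "\<kappa> (\<iota> w) = w" if "w \<in> ball 0 1" for w
    using that \<iota>(2) img by (metis imageE)+
  show "compact {z\<in>B. f z \<in> K}" if K: "compact K" "K \<subseteq> B" for K
  proof -
    have "compact (\<kappa> ` K)"
      using K \<kappa>(1) by (meson compact_continuous_image continuous_on_subset holomorphic_on_imp_continuous_on)
    moreover have "\<kappa> ` K \<subseteq> ball 0 1" using K img by blast
    ultimately have "compact {w\<in>ball 0 1. G w \<in> \<kappa> ` K}" by (rule proper_disc_map_preimage[OF G])
    then have "compact (\<iota> ` {w\<in>ball 0 1. G w \<in> \<kappa> ` K})"
      using \<iota>(1) by (intro compact_continuous_image)
        (auto intro: continuous_on_subset[OF holomorphic_on_imp_continuous_on])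
    moreover have "\<iota> ` {w\<in>ball 0 1. G w \<in> \<kappa> ` K} = {z\<in>B. f z \<in> K}"
    proof (intro subset_antisym subsetI)
      fix z assume "z \<in> \<iota> ` {w\<in>ball 0 1. G w \<in> \<kappa> ` K}"
      then obtain w where w: "z = \<iota> w" "w \<in> ball 0 1" "G w \<in> \<kappa> ` K" by blast
      then have z: "z \<in> B" "\<kappa> z = w" using \<iota>' by auto
      with w \<kappa>(3) obtain k where "k \<in> K" "\<kappa> (f z) = \<kappa> k" by auto
      then have "f z = k" using inj z(1) B(3) K(2) by (metis image_subset_iff inj_on_def subsetD)
      then show "z \<in> {z\<in>B. f z \<in> K}" using z \<open>k \<in> K\<close> by simp
    next
      fix z assume "z \<in> {z\<in>B. f z \<in> K}"
      then have z: "z \<in> B" "f z \<in> K" by auto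
      moreover from this have "G (\<kappa> z) \<in> \<kappa> ` K" by (simp flip: \<kappa>(3))
      ultimately have "\<kappa> z \<in> ball 0 1" "G (\<kappa> z) \<in> \<kappa> ` K" "z = \<iota> (\<kappa> z)"
        using img \<iota>(2) by auto
      then show "z \<in> \<iota> ` {w\<in>ball 0 1. G w \<in> \<kappa> ` K}" by blast
    qed
    ultimately show ?thesis by simp
  qed
  have "\<kappa> ` {z\<in>B. deriv f z = 0} \<subseteq> {w\<in>ball 0 1. deriv G w = 0}"
  proof clarify
    fix z assume z: "z \<in> B" "deriv f z = 0"
    have Gh: "G holomorphic_on ball 0 1"
      using G analytic_imp_holomorphic[OF analytic_on_subset[of G "cball 0 1" "ball 0 1"]]
      by (auto simp: proper_disc_map_def)
    have \<kappa>z: "\<kappa> z \<in> ball 0 1" using z img by blast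
    have "(f has_field_derivative 0) (at z)"
      using holomorphic_derivI[OF B(2,1) z(1)] z(2) by simp
    moreover have "(\<kappa> has_field_derivative deriv \<kappa> (f z)) (at (f z))"
      using holomorphic_derivI[OF \<kappa>(1) B(1)] z B(3) by blast
    ultimately have 1: "((\<lambda>z. \<kappa> (f z)) has_field_derivative deriv \<kappa> (f z) * 0) (at z)"
      using DERIV_chain2 by blast
    have "((\<lambda>z. G (\<kappa> z)) has_field_derivative deriv G (\<kappa> z) * deriv \<kappa> z) (at z)"
      using DERIV_chain2 holomorphic_derivI[OF Gh open_ball \<kappa>z] holomorphic_derivI[OF \<kappa>(1) B(1) z(1)] by blast
    then have "((\<lambda>z. \<kappa> (f z)) has_field_derivative deriv G (\<kappa> z) * deriv \<kappa> z) (at z)"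
      by (rule has_field_derivative_transform_within_open[OF _ B(1) z(1)]) (simp add: \<kappa>(3))
    with 1 have "deriv G (\<kappa> z) * deriv \<kappa> z = 0" using DERIV_unique by fastforce
    moreover have "deriv \<kappa> z \<noteq> 0"
      by (rule holomorphic_injective_imp_regular[OF \<kappa>(1) B(1) inj z(1)])
    ultimately show "\<kappa> z \<in> ball 0 1 \<and> deriv G (\<kappa> z) = 0" using \<kappa>z by simp
  qed
  moreover have "inj_on \<kappa> {z\<in>B. deriv f z = 0}" using inj by (rule inj_on_subset) auto
  ultimately show "finite {z\<in>B. deriv f z = 0}"
    using proper_disc_map_critical_points[OF G] by (meson finite_imageD finite_subset)
qed

section \<open>Inverse branches along backward orbits\<close>

text \<open>The fibres are finite, and properness provides a neighbourhood of each point of \<open>S\<close> whose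
  preimage lies in small discs around the points of the fibre, on which \<open>p\<close> is injective.\<close>

lemma proper_holomorphic_covering:
  assumes C: "open C" "p holomorphic_on C" and S: "open S" "p ` C = S"
    and crit: "\<And>z. z \<in> C \<Longrightarrow> deriv p z \<noteq> 0"
    and proper: "\<And>K. compact K \<Longrightarrow> K \<subseteq> S \<Longrightarrow> compact {z\<in>C. p z \<in> K}"
  shows "covering_space C p S"
proof
  show cont: "continuous_on C p" using C(2) by (rule holomorphic_on_imp_continuous_on)
  show "p ` C = S" by fact
  fix x assume x: "x \<in> S"
  define F where "F = {z\<in>C. p z = x}"
  have loc: "\<exists>e>0. ball y e \<subseteq> C \<and> inj_on p (ball y e)" if "y \<in> F" for y
    using has_complex_derivative_locally_injective[OF C(2) _ C(1) crit] that by (auto simp: F_def) metis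
  have "compact F" using proper[of "{x}"] x by (simp add: F_def)
  moreover have "\<not> y islimpt F" if "y \<in> F" for y
  proof
    assume lim: "y islimpt F"
    obtain e where e: "e > 0" "inj_on p (ball y e)" using loc[OF \<open>y \<in> F\<close>] by blast
    obtain z where "z \<in> F" "z \<in> ball y e" "z \<noteq> y"
      using lim e(1) by (auto simp: islimpt_approachable dist_commute)
    moreover have "y \<in> ball y e" using e(1) by simp
    ultimately show False using e(2) that by (auto simp: F_def inj_on_def)
  qed
  ultimately have fin: "finite F"
    by (meson Heine_Borel_imp_Bolzano_Weierstrass order_refl)
  from loc obtain e where e: "\<And>y. y \<in> F \<Longrightarrow> e y > 0 \<and> ball y (e y) \<subseteq> C \<and> inj_on p (ball y (e y))"
    by metis
  obtain d where d: "d > 0" "\<And>y z. y \<in> F \<Longrightarrow> z \<in> F \<Longrightarrow> y \<noteq> z \<Longrightarrow> d \<le> dist y z"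
  proof -
    have "\<exists>d>0. \<forall>z\<in>F. z \<noteq> y \<longrightarrow> d \<le> dist y z" for y
      using finite_set_avoid[OF fin] by blast
    then obtain dd where dd: "\<And>y. dd y > 0" "\<And>y z. z \<in> F \<Longrightarrow> z \<noteq> y \<Longrightarrow> dd y \<le> dist y z" by metis
    define d where "d = Min (insert 1 (dd ` F))"
    have "d > 0" unfolding d_def using fin dd(1) by (subst Min_gr_iff) auto
    moreover have "d \<le> dist y z" if "y \<in> F" "z \<in> F" "y \<noteq> z" for y z
    proof -
      have "d \<le> dd y" unfolding d_def using fin that by (intro Min_le) auto
      also have "\<dots> \<le> dist y z" using dd(2) that by auto
      finally show ?thesis .
    qed
    ultimately show ?thesis using that by blast
  qed
  define V where "V y = ball y (min (e y) (d / 2))" for y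
  have V: "open (V y)" "y \<in> V y" "V y \<subseteq> C" "inj_on p (V y)" if "y \<in> F" for y
    using e[OF that] d(1) by (auto simp: V_def intro: inj_on_subset)
  have Vdisj: "V y \<inter> V z = {}" if "y \<in> F" "z \<in> F" "y \<noteq> z" for y z
    unfolding V_def using d(2)[OF that] by (intro disjoint_ballI) (auto simp: min_def)
  have pV: "open (p ` A)" if "y \<in> F" "open A" "A \<subseteq> V y" for y A
  proof (rule open_mapping_thm3)
    show "p holomorphic_on A" using holomorphic_on_subset[OF C(2)] V(3)[OF that(1)] that(3) by blast
    show "inj_on p A" using V(4)[OF that(1)] that(3) by (rule inj_on_subset)
  qed fact
  define Q where "Q = p ` (C - (\<Union>y\<in>F. V y))"
  have "closedin (top_of_set S) Q"
    unfolding Q_def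
  proof (rule proper_map)
    show "closedin (top_of_set C) (C - (\<Union>y\<in>F. V y))"
      using V(1) by (auto simp: closedin_closed Diff_eq intro!: exI[of _ "- (\<Union>y\<in>F. V y)"])
    show "compact (C \<inter> p -` U)" if "U \<subseteq> S" "compact U" for U
    proof -
      have "C \<inter> p -` U = {z\<in>C. p z \<in> U}" by blast
      then show ?thesis using proper[OF that(2,1)] by simp
    qed
  qed (use S in auto)
  then have "open (S - Q)"
    using S(1) by (metis openin_diff openin_open_eq openin_subtopology_self)
  define T where "T = (S - Q) \<inter> (\<Inter>y\<in>F. p ` V y)"
  have "open T"
    unfolding T_def using \<open>open (S - Q)\<close> fin pV V by (intro open_Int open_INT) auto
  moreover have "x \<in> T"
    using x V(2) by (auto simp: T_def Q_def F_def)
  moreover have "\<exists>q. homeomorphism (V y \<inter> p -` T) T p q" if y: "y \<in> F" for y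
  proof -
    have op: "open (V y \<inter> p -` T)"
      using V[OF y] cont \<open>open T\<close> by (meson continuous_on_subset continuous_open_preimage)
    have "T \<subseteq> p ` V y" using y by (auto simp: T_def)
    then have "p ` (V y \<inter> p -` T) = T" by blast
    moreover have "inj_on p (V y \<inter> p -` T)" using V(4)[OF y] by (rule inj_on_subset) auto
    moreover have "p holomorphic_on V y \<inter> p -` T"
      by (rule holomorphic_on_subset[OF C(2)]) (use V(3)[OF y] in blast)
    ultimately show ?thesis
      using op invariance_of_domain_homeomorphism[of "V y \<inter> p -` T" p] holomorphic_on_imp_continuous_on
      by (metis DIM_complex order_refl)
  qed
  moreover have "\<Union> ((\<lambda>y. V y \<inter> p -` T) ` F) = C \<inter> p -` T"
  proof (intro subset_antisym subsetI)
    fix z assume "z \<in> C \<inter> p -` T"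
    then have "z \<in> C" "p z \<in> T" "p z \<notin> Q" by (auto simp: T_def)
    then show "z \<in> \<Union> ((\<lambda>y. V y \<inter> p -` T) ` F)" by (auto simp: Q_def)
  qed (use V(3) in auto)
  moreover have "openin (top_of_set C) u" if "u \<in> (\<lambda>y. V y \<inter> p -` T) ` F" for u
  proof -
    obtain y where y: "y \<in> F" "u = V y \<inter> p -` T" using \<open>u \<in> _\<close> by blast
    have "open u" unfolding y(2)
      using V[OF y(1)] cont \<open>open T\<close> by (meson continuous_on_subset continuous_open_preimage)
    moreover have "u \<subseteq> C" using y V(3) by blast
    ultimately show ?thesis using C(1) by (simp add: openin_open_eq)
  qed
  moreover have "pairwise disjnt ((\<lambda>y. V y \<inter> p -` T) ` F)"
    using Vdisj by (fastforce simp: pairwise_def disjnt_def)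
  moreover have "openin (top_of_set S) T"
    using \<open>open T\<close> S(1) by (auto simp: openin_open_eq T_def)
  ultimately show "\<exists>T. x \<in> T \<and> openin (top_of_set S) T \<and>
      (\<exists>v. \<Union>v = C \<inter> p -` T \<and> (\<forall>u\<in>v. openin (top_of_set C) u) \<and>
           pairwise disjnt v \<and> (\<forall>u\<in>v. \<exists>q. homeomorphism u T p q))"
    by (intro exI[of _ T] conjI exI[of _ "(\<lambda>y. V y \<inter> p -` T) ` F"]) auto
qed

text \<open>All inverse branches of the iterates along the backward orbit \<open>w\<close> exist on a simply connected set
  \<open>U\<close> that contains no forward image of a critical point: they are constructed one after the
  other by lifting through the covering that \<open>f\<close> induces outside the critical values.\<close>

lemma inverse_branches:
  assumes B: "open B" "f holomorphic_on B" "f ` B = B"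
    and proper: "\<And>K. compact K \<Longrightarrow> K \<subseteq> B \<Longrightarrow> compact {z\<in>B. f z \<in> K}"
    and fin: "finite {c\<in>B. deriv f c = 0}"
    and U: "open U" "simply_connected U" "U \<subseteq> B" "x \<in> U"
    and avoid: "\<And>c n. c \<in> B \<Longrightarrow> deriv f c = 0 \<Longrightarrow> (f ^^ Suc n) c \<notin> U"
    and w: "w 0 = x" "\<And>n. w n \<in> B" "\<And>n. f (w (Suc n)) = w n"
  obtains h where "\<And>z. z \<in> U \<Longrightarrow> h 0 z = z" "\<And>n. h n holomorphic_on U" "\<And>n. h n ` U \<subseteq> B"
    "\<And>n. h n x = w n" "\<And>n z. z \<in> U \<Longrightarrow> f (h (Suc n) z) = h n z"
proof -
  define V where "V = f ` {c\<in>B. deriv f c = 0}"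
  define S where "S = B - V"
  define C where "C = {z\<in>B. f z \<in> S}"
  have cont: "continuous_on B f" using B(2) by (rule holomorphic_on_imp_continuous_on)
  have "closed V" unfolding V_def using fin by (intro finite_imp_closed finite_imageI)
  then have S: "open S" unfolding S_def using B(1) by (intro open_Diff)
  have Ceq: "C = B \<inter> f -` S" by (auto simp: C_def)
  have C: "open C" unfolding Ceq using cont B(1) S by (rule continuous_open_preimage)
  have SB: "S \<subseteq> f ` B" unfolding B(3) S_def by blast
  have cov: "covering_space C f S"
  proof (rule proper_holomorphic_covering[OF C _ S])
    show hol: "f holomorphic_on C" using B(2) by (rule holomorphic_on_subset) (auto simp: C_def)
    show "f ` C = S" using SB by (auto simp: C_def)
    show "deriv f z \<noteq> 0" if "z \<in> C" for z using that by (auto simp: C_def S_def V_def)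
    show "compact {z\<in>C. f z \<in> K}" if K: "compact K" "K \<subseteq> S" for K
    proof -
      have "{z\<in>C. f z \<in> K} = {z\<in>B. f z \<in> K}" using K(2) by (auto simp: C_def)
      moreover have "K \<subseteq> B" using K(2) by (auto simp: S_def)
      ultimately show ?thesis using proper[OF K(1)] by simp
    qed
  qed
  define ok where "ok n h \<longleftrightarrow> h holomorphic_on U \<and> h ` U \<subseteq> B \<and> h x = w n \<and> (\<forall>z\<in>U. (f ^^ n) (h z) = z)"
    for n and h :: "complex \<Rightarrow> complex"
  have lift: "\<exists>h'. ok (Suc n) h' \<and> (\<forall>z\<in>U. f (h' z) = h z)" if h: "ok n h" for n h
  proof -
    have hS: "h \<in> U \<rightarrow> S"
    proof
      fix z assume z: "z \<in> U"
      have "h z \<notin> V"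
      proof
        assume "h z \<in> V"
        then obtain c where c: "c \<in> B" "deriv f c = 0" "h z = f c" by (auto simp: V_def)
        have "(f ^^ Suc n) c = (f ^^ n) (f c)" by (simp add: funpow_swap1)
        also have "\<dots> = z" unfolding c(3)[symmetric] using h z by (simp add: ok_def)
        finally show False using avoid[OF c(1,2), of n] z by simp
      qed
      then show "h z \<in> S" using h z by (auto simp: ok_def S_def)
    qed
    have hw: "h x = f (w (Suc n))" using h w(3) by (simp add: ok_def)
    have wC: "w (Suc n) \<in> C"
      using hS U(4) w(2) hw unfolding C_def by (metis (mono_tags, lifting) Pi_iff mem_Collect_eq)
    have lpc: "locally path_connected U" using U(1) by (rule open_imp_locally_path_connected)
    have hcont: "continuous_on U h" using h by (simp add: ok_def holomorphic_on_imp_continuous_on)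
    obtain h' where h': "continuous_on U h'" "h' \<in> U \<rightarrow> C" "h' x = w (Suc n)" "\<And>y. y \<in> U \<Longrightarrow> f (h' y) = h y"
      using covering_space_lift_strong[OF cov wC U(4,2) lpc hcont hS hw] by blast
    have "h' holomorphic_on U"
    proof (rule covering_space_lift_is_holomorphic[OF cov C _ _ hS h'(2,1)])
      show "f holomorphic_on C" using B(2) by (rule holomorphic_on_subset) (auto simp: C_def)
    qed (use h h' in \<open>auto simp: ok_def\<close>)
    moreover have "(f ^^ Suc n) (h' z) = z" if "z \<in> U" for z
      using h h'(4)[OF that] that by (simp add: funpow_swap1 ok_def)
    moreover have "h' ` U \<subseteq> B" using h'(2) by (auto simp: C_def)
    ultimately show ?thesis using h' by (auto simp: ok_def)
  qed
  have "\<exists>h. \<forall>n. ok n (h n) \<and> (\<forall>z\<in>U. f (h (Suc n) z) = h n z)"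
  proof (rule dependent_nat_choice)
    show "\<exists>h. ok 0 h" using U w by (intro exI[of _ "\<lambda>z. z"]) (auto simp: ok_def)
  qed (use lift in blast)
  then obtain h where h: "\<And>n. ok n (h n)" "\<And>n z. z \<in> U \<Longrightarrow> f (h (Suc n) z) = h n z" by blast
  show ?thesis
    using h(1) h(1)[of 0] h(2) by (intro that[of h]) (auto simp: ok_def)
qed

text \<open>A normality argument: if the functions omit 0 and another value, and converge to 0 at one
  point, then by the theorems of Montel and Hurwitz they converge to 0 everywhere.\<close>

lemma omitting_sequence_tendsto_0:
  assumes U: "open U" "connected U" "x \<in> U"
    and h: "\<And>n. h n holomorphic_on U" "\<And>n z. z \<in> U \<Longrightarrow> h n z \<noteq> 0 \<and> h n z \<noteq> a" and "a \<noteq> 0"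
    and lim: "(\<lambda>n. h n x) \<longlonglongrightarrow> 0" and K: "compact K" "K \<subseteq> U"
  shows "uniform_limit K h (\<lambda>_. 0) sequentially"
proof (rule ccontr)
  assume "\<not> ?thesis"
  then obtain e where e: "e > 0" "\<not> (\<forall>\<^sub>F n in sequentially. \<forall>z\<in>K. dist (h n z) 0 < e)"
    by (auto simp: uniform_limit_iff)
  then have fr: "\<exists>\<^sub>F n in sequentially. \<exists>z\<in>K. e \<le> norm (h n z)"
    by (simp add: not_eventually not_less)
  have "\<forall>\<^sub>F n in sequentially. norm (h n x) < norm a"
    using tendstoD[OF lim, of "norm a"] \<open>a \<noteq> 0\<close> by simp
  then obtain N where N: "\<And>n. n \<ge> N \<Longrightarrow> norm (h n x) < norm a" by (auto simp: eventually_sequentially)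
  have "\<exists>n\<ge>m. N \<le> n \<and> (\<exists>z\<in>K. e \<le> norm (h n z))" for m
    using fr unfolding frequently_sequentially by (meson max.bounded_iff)
  then obtain s :: "nat \<Rightarrow> nat" where s: "strict_mono s" "\<And>n. N \<le> s n \<and> (\<exists>z\<in>K. e \<le> norm (h (s n) z))"
    using infinite_enumerate[of "{n. N \<le> n \<and> (\<exists>z\<in>K. e \<le> norm (h n z))}"]
    by (auto simp: infinite_nat_iff_unbounded_le)
  define F where "F n z = h (s n) z / a" for n z
  have hol: "F n holomorphic_on U" for n
    unfolding F_def using h(1) \<open>a \<noteq> 0\<close> by (intro holomorphic_intros) auto
  have F01: "F n z \<noteq> 0 \<and> F n z \<noteq> 1" if "z \<in> U" for n z
    using h(2)[OF that] \<open>a \<noteq> 0\<close> by (simp add: F_def)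
  have F1: "norm (F n x) \<le> 1" for n
    using N[of "s n"] s(2)[of n] by (simp add: F_def norm_divide divide_le_eq)
  have bd: "\<exists>B. \<forall>h\<in>range F. \<forall>z\<in>K. norm (h z) \<le> B" if K: "compact K" "K \<subseteq> U" for K
  proof -
    obtain B where "\<And>h z. h \<in> range F \<Longrightarrow> z \<in> K \<Longrightarrow> norm (h z) \<le> B"
      by (rule GPicard3[OF U, of "range F" "range F" K]) (use hol F01 F1 K in auto)
    then show ?thesis by blast
  qed
  obtain G t where G: "G holomorphic_on U" and t: "strict_mono (t :: nat \<Rightarrow> nat)"
      and ptw: "\<And>x. x \<in> U \<Longrightarrow> (\<lambda>n. F (t n) x) \<longlonglongrightarrow> G x"
      and ul: "\<And>K. compact K \<Longrightarrow> K \<subseteq> U \<Longrightarrow> uniform_limit K (F \<circ> t) G sequentially"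
    by (rule Montel[OF U(1), of "range F" F]) (use hol bd in auto)
  have "(\<lambda>n. h (s (t n)) x) \<longlonglongrightarrow> 0"
    using LIMSEQ_subseq_LIMSEQ[OF lim strict_mono_o[OF s(1) t]] by (simp add: o_def)
  then have "(\<lambda>n. F (t n) x) \<longlonglongrightarrow> 0 / a" unfolding F_def by (intro tendsto_divide) (use \<open>a \<noteq> 0\<close> in auto)
  then have G0: "G x = 0" using ptw[OF U(3)] LIMSEQ_unique by fastforce
  have "G constant_on U"
  proof (rule ccontr)
    assume "\<not> G constant_on U"
    then have "G x \<noteq> 0"
      using Hurwitz_no_zeros[OF U(1,2), of "F \<circ> t" G x] hol G ul F01 U(3) by auto
    then show False using G0 by simp
  qed
  then have "\<And>z. z \<in> U \<Longrightarrow> G z = 0" using G0 U(3) by (auto simp: constant_on_def)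
  then have "uniform_limit K (F \<circ> t) (\<lambda>_. 0) sequentially"
    using ul[OF K] K(2) by (metis (no_types, lifting) subsetD uniform_limit_cong')
  then have "\<forall>\<^sub>F n in sequentially. \<forall>z\<in>K. dist ((F \<circ> t) n z) 0 < e / norm a"
    by (rule uniform_limitD) (use e(1) \<open>a \<noteq> 0\<close> in auto)
  then obtain n where "\<forall>z\<in>K. norm (F (t n) z) < e / norm a"
    by (auto simp: eventually_sequentially)
  moreover obtain z where "z \<in> K" "e \<le> norm (h (s (t n)) z)" using s(2) by blast
  ultimately show False using \<open>a \<noteq> 0\<close> by (force simp: F_def norm_divide divide_less_cancel)
qed

section \<open>The horn map and the renormalization\<close>

lemma exp_2pi_i_eq_iff: "exp_2pi_i z = exp_2pi_i w \<longleftrightarrow> (\<exists>k::int. z = w + of_int k)"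
proof
  assume "exp_2pi_i z = exp_2pi_i w"
  then obtain k :: int where "2 * of_real pi * \<i> * z = 2 * of_real pi * \<i> * w + (of_int (2 * k) * pi) * \<i>"
    unfolding exp_2pi_i_def exp_eq by blast
  then have "2 * of_real pi * \<i> * z = 2 * of_real pi * \<i> * (w + of_int k)"
    by (simp add: algebra_simps)
  then show "\<exists>k::int. z = w + of_int k" by auto
next
  assume "\<exists>k::int. z = w + of_int k"
  then obtain k :: int where "z = w + of_int k" by blast
  then have "2 * of_real pi * \<i> * z = 2 * of_real pi * \<i> * w + (of_int (2 * k) * pi) * \<i>"
    by (simp add: algebra_simps)
  then show "exp_2pi_i z = exp_2pi_i w"
    unfolding exp_2pi_i_def exp_eq by blast
qed

lemma exp_2pi_i_nonzero [simp]: "exp_2pi_i z \<noteq> 0"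
  by (simp add: exp_2pi_i_def)

lemma exp_2pi_i_shift [simp]: "exp_2pi_i (z + of_int k) = exp_2pi_i z" "exp_2pi_i (z + of_nat n) = exp_2pi_i z"
  using exp_2pi_i_eq_iff[of "z + of_nat n" z] by (auto simp: exp_2pi_i_eq_iff intro: exI[of _ "int n"])

lemma continuous_exp_2pi_i: "continuous_on S exp_2pi_i"
  unfolding exp_2pi_i_def by (intro continuous_intros)

lemma open_exp_2pi_i_image:
  assumes "open S"
  shows "open (exp_2pi_i ` S)"
proof -
  define T where "T = {w. w / (2 * of_real pi * \<i>) \<in> S}"
  have "open ((\<lambda>w. w / (2 * of_real pi * \<i>)) -` S)"
    using assms by (intro open_vimage continuous_intros) auto
  then have "open T" by (simp add: T_def vimage_def)
  then have "openin (top_of_set (- {0})) (exp ` T)"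
    by (intro covering_space_open_map[OF covering_space_exp_punctured_plane]) simp
  then have "open (exp ` T)"
    by (simp add: openin_open_eq open_Compl)
  moreover have "exp_2pi_i ` S = exp ` T"
  proof (intro subset_antisym subsetI)
    fix w assume "w \<in> exp_2pi_i ` S"
    then obtain z where "z \<in> S" "w = exp (2 * of_real pi * \<i> * z)" by (auto simp: exp_2pi_i_def)
    then show "w \<in> exp ` T" by (intro image_eqI[of _ _ "2 * of_real pi * \<i> * z"]) (auto simp: T_def)
  next
    fix w assume "w \<in> exp ` T"
    then obtain z where "z / (2 * of_real pi * \<i>) \<in> S" "w = exp z" by (auto simp: T_def)
    then show "w \<in> exp_2pi_i ` S"
      by (intro image_eqI[of _ _ "z / (2 * of_real pi * \<i>)"]) (auto simp: exp_2pi_i_def)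
  qed
  ultimately show ?thesis by simp
qed

lemma continuous_on_iterate:
  assumes "open D" "continuous_on D f"
  shows "continuous_on {z. iterate_defined D f n z} (f ^^ n)"
proof -
  have "open {z. iterate_defined D f n z}"
    using open_iterate_preimage[OF assms open_UNIV, of n] by simp
  moreover have "(f ^^ n) -` V \<inter> {z. iterate_defined D f n z} = {z. iterate_defined D f n z \<and> (f ^^ n) z \<in> V}" for V
    by auto
  ultimately show ?thesis
    using open_iterate_preimage[OF assms, of _ n] by (simp add: continuous_on_open_vimage)
qed

text \<open>Both \<open>psi_domain\<close> and the domain of the horn map are invariant under translation by
  \<open>- 1\<close>; the latter is also invariant under translation by 1.\<close>

lemma psi_domain_step:
  assumes PD: "P \<subseteq> D" and ext: "extended_inverse_coordinate D f P \<phi> r \<psi>" and z: "z \<in> psi_domain D f r \<psi>"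
  shows "z - 1 \<in> psi_domain D f r \<psi>" "\<psi> (z - 1) \<in> D" "f (\<psi> (z - 1)) = \<psi> z"
proof -
  obtain y n where y: "z = y + of_nat n" "Re y < r" "iterate_defined D f n (\<psi> y)"
    using z by (auto simp: psi_domain_def)
  have ext': "Re w < r \<Longrightarrow> iterate_defined D f m (\<psi> w) \<Longrightarrow> \<psi> (w + of_nat m) = (f ^^ m) (\<psi> w)" for w m
    using ext by (auto simp: extended_inverse_coordinate_def)
  have y1: "Re (y - 1) < r" using y(2) by simp
  then have "\<psi> (y - 1) \<in> D" using ext PD by (auto simp: extended_inverse_coordinate_def)
  moreover from this have "\<psi> y = f (\<psi> (y - 1))"
    using ext'[OF y1, of 1] by (simp add: iterate_defined_def)
  ultimately have it: "iterate_defined D f (Suc n) (\<psi> (y - 1))"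
    using y(3) by (simp add: iterate_defined_Suc)
  then have it': "iterate_defined D f n (\<psi> (y - 1))" "(f ^^ n) (\<psi> (y - 1)) \<in> D"
    by (auto simp: iterate_defined_def)
  have zy: "z - 1 = (y - 1) + of_nat n" using y(1) by simp
  then show "z - 1 \<in> psi_domain D f r \<psi>"
    using y1 it' unfolding psi_domain_def by blast
  have \<psi>z: "\<psi> (z - 1) = (f ^^ n) (\<psi> (y - 1))"
    unfolding zy using ext'[OF y1 it'(1)] .
  then show "\<psi> (z - 1) \<in> D" using it' by simp
  show "f (\<psi> (z - 1)) = \<psi> z"
    unfolding \<psi>z using ext'[OF y(2,3)] \<open>\<psi> y = _\<close> y(1) by (simp add: funpow_swap1)
qed

lemma horn_domain_step:
  assumes PD: "P \<subseteq> D" and ext: "extended_inverse_coordinate D f P \<phi> r \<psi>" and "f 0 = 0"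
    and z: "z \<in> horn_domain D f r \<psi>"
  shows "z - 1 \<in> horn_domain D f r \<psi>" "f (\<psi> (z - 1)) = \<psi> z"
    "z + 1 \<in> horn_domain D f r \<psi>" "\<psi> (z + 1) = f (\<psi> z)"
proof -
  have z': "z \<in> psi_domain D f r \<psi>" "\<psi> z \<in> parabolic_basin D f" using z by (auto simp: horn_domain_def)
  note st = psi_domain_step[OF PD ext z'(1)]
  show "f (\<psi> (z - 1)) = \<psi> z" by fact
  have "\<psi> (z - 1) \<in> parabolic_basin D f"
    using parabolic_basin_pullback[of f D 1 "\<psi> (z - 1)"] st z'(2) \<open>f 0 = 0\<close> by (simp add: iterate_defined_def)
  then show "z - 1 \<in> horn_domain D f r \<psi>" using st by (simp add: horn_domain_def)
  obtain y n where y: "z = y + of_nat n" "Re y < r" "iterate_defined D f n (\<psi> y)"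
    using z' by (auto simp: psi_domain_def)
  have ext': "iterate_defined D f m (\<psi> y) \<Longrightarrow> \<psi> (y + of_nat m) = (f ^^ m) (\<psi> y)" for m
    using ext y(2) by (auto simp: extended_inverse_coordinate_def)
  have \<psi>z: "\<psi> z = (f ^^ n) (\<psi> y)" using ext'[OF y(3)] y(1) by simp
  then have it: "iterate_defined D f (Suc n) (\<psi> y)"
    using y(3) parabolic_basinD(4)[OF z'(2)] by (auto simp: iterate_defined_def less_Suc_eq)
  have z1: "z + 1 = y + of_nat (Suc n)" using y(1) by simp
  then have "z + 1 \<in> psi_domain D f r \<psi>" using y(2) it unfolding psi_domain_def by blast
  moreover show "\<psi> (z + 1) = f (\<psi> z)" unfolding z1 ext'[OF it] \<psi>z by simp
  ultimately show "z + 1 \<in> horn_domain D f r \<psi>"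
    using parabolic_basinD(6)[OF z'(2)] by (simp add: horn_domain_def)
qed

lemma horn_domain_iterate:
  assumes PD: "P \<subseteq> D" and ext: "extended_inverse_coordinate D f P \<phi> r \<psi>" and "f 0 = 0"
    and z: "z \<in> horn_domain D f r \<psi>"
  shows "z - of_nat n \<in> horn_domain D f r \<psi>" "(f ^^ n) (\<psi> (z - of_nat n)) = \<psi> z"
    "z + of_nat n \<in> horn_domain D f r \<psi>" "\<psi> (z + of_nat n) = (f ^^ n) (\<psi> z)"
proof -
  note step = horn_domain_step[OF PD ext \<open>f 0 = 0\<close>]
  have "z - of_nat n \<in> horn_domain D f r \<psi> \<and> (f ^^ n) (\<psi> (z - of_nat n)) = \<psi> z"
  proof (induction n)
    case (Suc n)
    have "z - of_nat (Suc n) = (z - of_nat n) - 1" by simp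
    with Suc step(1,2)[of "z - of_nat n"] show ?case by (simp add: funpow_swap1 diff_diff_eq add.commute)
  qed (use z in auto)
  then show "z - of_nat n \<in> horn_domain D f r \<psi>" "(f ^^ n) (\<psi> (z - of_nat n)) = \<psi> z" by auto
  have "z + of_nat n \<in> horn_domain D f r \<psi> \<and> \<psi> (z + of_nat n) = (f ^^ n) (\<psi> z)"
  proof (induction n)
    case (Suc n)
    have "z + of_nat (Suc n) = (z + of_nat n) + 1" by simp
    with Suc step(3,4)[of "z + of_nat n"] show ?case by (simp add: ac_simps)
  qed (use z in auto)
  then show "z + of_nat n \<in> horn_domain D f r \<psi>" "\<psi> (z + of_nat n) = (f ^^ n) (\<psi> z)" by auto
qed

lemma horn_domain_int:
  assumes PD: "P \<subseteq> D" and ext: "extended_inverse_coordinate D f P \<phi> r \<psi>" and "f 0 = 0"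
    and z: "z \<in> horn_domain D f r \<psi>"
  shows "z + of_int k \<in> horn_domain D f r \<psi>"
  using horn_domain_iterate(1,3)[OF assms] by (cases k rule: int_cases2) auto

lemma psi_continuous:
  assumes D: "open D" "continuous_on D f"
    and rep: "repelling_Fatou_coordinate D f P \<phi> r" and ext: "extended_inverse_coordinate D f P \<phi> r \<psi>"
  shows "open (psi_domain D f r \<psi>)" "continuous_on (psi_domain D f r \<psi>) \<psi>"
proof -
  have P: "open P" using rep by (auto simp: repelling_Fatou_coordinate_def repelling_petal_def attracting_petal_def)
  have \<phi>: "\<phi> holomorphic_on P" "inj_on \<phi> P" "{z. Re z < r} \<subseteq> \<phi> ` P"
    using rep by (auto simp: repelling_Fatou_coordinate_def)
  obtain \<eta> where \<eta>: "\<eta> holomorphic_on (\<phi> ` P)" "\<And>z. z \<in> P \<Longrightarrow> \<eta> (\<phi> z) = z"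
    using holomorphic_has_inverse[OF \<phi>(1) P \<phi>(2)] by metis
  have "\<psi> z = \<eta> z" if "Re z < r" for z
    using ext \<eta>(2)[of "\<psi> z"] that by (auto simp: extended_inverse_coordinate_def)
  moreover have "continuous_on {z. Re z < r} \<eta>"
    using continuous_on_subset[OF holomorphic_on_imp_continuous_on[OF \<eta>(1)] \<phi>(3)] .
  ultimately have cont: "continuous_on {z. Re z < r} \<psi>"
    using continuous_on_eq[of "{z. Re z < r}" \<eta> \<psi>] by simp
  define S where "S n = {z. Re z < r + real n \<and> iterate_defined D f n (\<psi> (z - of_nat n))}" for n
  have un: "psi_domain D f r \<psi> = (\<Union>n. S n)"
  proof (intro subset_antisym subsetI)
    fix z assume "z \<in> psi_domain D f r \<psi>"
    then obtain y n where "z = y + of_nat n" "Re y < r" "iterate_defined D f n (\<psi> y)"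
      by (auto simp: psi_domain_def)
    then have "z \<in> S n" by (simp add: S_def)
    then show "z \<in> (\<Union>n. S n)" by blast
  next
    fix z assume "z \<in> (\<Union>n. S n)"
    then obtain n where "z \<in> S n" by blast
    then have "Re (z - of_nat n) < r" "iterate_defined D f n (\<psi> (z - of_nat n))" by (auto simp: S_def)
    moreover have "z = (z - of_nat n) + of_nat n" by simp
    ultimately show "z \<in> psi_domain D f r \<psi>" unfolding psi_domain_def by blast
  qed
  have half: "open {z. Re z < r + real n}" for n by (intro open_Collect_less continuous_intros)
  have cont_n: "continuous_on {z. Re z < r + real n} (\<lambda>z. \<psi> (z - of_nat n))" for n
    by (intro continuous_on_compose2[OF cont] continuous_intros) auto
  have S_open: "open (S n)" for n
  proof -
    have "open {z. iterate_defined D f n z}"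
      using open_iterate_preimage[OF D open_UNIV, of n] by simp
    from continuous_open_preimage[OF cont_n half this]
    have "open ({z. Re z < r + real n} \<inter> (\<lambda>z. \<psi> (z - of_nat n)) -` {z. iterate_defined D f n z})" .
    moreover have "{z. Re z < r + real n} \<inter> (\<lambda>z. \<psi> (z - of_nat n)) -` {z. iterate_defined D f n z} = S n"
      by (auto simp: S_def)
    ultimately show ?thesis by simp
  qed
  then show "open (psi_domain D f r \<psi>)" unfolding un by blast
  have "continuous_on (S n) \<psi>" for n
  proof -
    have "continuous_on (S n) (\<lambda>z. (f ^^ n) (\<psi> (z - of_nat n)))"
    proof (rule continuous_on_compose2[OF continuous_on_iterate[OF D]])
      show "continuous_on (S n) (\<lambda>z. \<psi> (z - of_nat n))"
        by (rule continuous_on_subset[OF cont_n]) (auto simp: S_def)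
    qed (auto simp: S_def)
    moreover have "\<psi> z = (f ^^ n) (\<psi> (z - of_nat n))" if z: "z \<in> S n" for z
    proof -
      have "Re (z - of_nat n) < r" "iterate_defined D f n (\<psi> (z - of_nat n))" using z by (auto simp: S_def)
      then have "\<psi> ((z - of_nat n) + of_nat n) = (f ^^ n) (\<psi> (z - of_nat n))"
        using ext unfolding extended_inverse_coordinate_def by blast
      then show ?thesis by simp
    qed
    ultimately show ?thesis by (rule continuous_on_eq[OF _ sym])
  qed
  then show "continuous_on (psi_domain D f r \<psi>) \<psi>"
    unfolding un using S_open by (intro continuous_on_open_UN) auto
qed

text \<open>The part of the domain of the horn map that is sent by \<open>\<psi>\<close>, together with its translates to
  the left, into the immediate basin.  The translates have to be included since preimages of points
  of \<open>B\<close> may belong to other components of the basin.\<close>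

definition deep_horn_domain ::
    "complex set \<Rightarrow> (complex \<Rightarrow> complex) \<Rightarrow> real \<Rightarrow> (complex \<Rightarrow> complex) \<Rightarrow> complex set \<Rightarrow> complex set" where
  "deep_horn_domain D f r \<psi> B = {z \<in> horn_domain D f r \<psi>. \<forall>n. \<psi> (z - of_nat n) \<in> B}"

lemma deep_horn_domain_int:
  assumes PD: "P \<subseteq> D" and ext: "extended_inverse_coordinate D f P \<phi> r \<psi>" and "f 0 = 0" and "f ` B \<subseteq> B"
    and z: "z \<in> deep_horn_domain D f r \<psi> B"
  shows "z + of_int k \<in> deep_horn_domain D f r \<psi> B"
proof -
  note H = horn_domain_iterate[OF PD ext \<open>f 0 = 0\<close>]
  have zH: "z \<in> horn_domain D f r \<psi>" and zB: "\<psi> (z - of_nat n) \<in> B" for n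
    using z by (auto simp: deep_horn_domain_def)
  have H': "z + of_int k \<in> horn_domain D f r \<psi>"
    by (rule horn_domain_int[OF PD ext \<open>f 0 = 0\<close> zH])
  have "\<psi> (z + of_int k - of_nat n) \<in> B" for n
  proof (cases "k \<le> int n")
    case True
    then have "z + of_int k - of_nat n = z - of_nat (nat (int n - k))"
      by simp
    then show ?thesis using zB by metis
  next
    case False
    then have "z + of_int k - of_nat n = z + of_nat (nat (k - int n))"
      by simp
    then have "\<psi> (z + of_int k - of_nat n) = (f ^^ nat (k - int n)) (\<psi> z)"
      using H(4)[OF zH] by metis
    moreover have "\<psi> z \<in> B" using zB[of 0] by simp
    ultimately show ?thesis using iterates_in_invariant_set[OF \<open>f ` B \<subseteq> B\<close>] by simp
  qed
  with H' show ?thesis by (simp add: deep_horn_domain_def)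
qed

lemma deep_horn_domain_clopen:
  assumes D: "open D" "continuous_on D f" "f 0 = 0"
    and rep: "repelling_Fatou_coordinate D f P \<phi> r" and ext: "extended_inverse_coordinate D f P \<phi> r \<psi>"
    and B: "B \<in> components (parabolic_basin D f)" "open (parabolic_basin D f)"
  shows "open (horn_domain D f r \<psi>)" "open (deep_horn_domain D f r \<psi> B)"
    "open (horn_domain D f r \<psi> - deep_horn_domain D f r \<psi> B)"
proof -
  let ?H = "horn_domain D f r \<psi>" and ?X = "deep_horn_domain D f r \<psi> B"
  have PD: "P \<subseteq> D" using rep by (auto simp: repelling_Fatou_coordinate_def repelling_petal_def)
  note psi = psi_continuous[OF D(1,2) rep ext]
  have "?H = psi_domain D f r \<psi> \<inter> \<psi> -` parabolic_basin D f" by (auto simp: horn_domain_def)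
  then show opH: "open ?H" using continuous_open_preimage[OF psi(2,1) B(2)] by simp
  have "?H \<subseteq> psi_domain D f r \<psi>" by (auto simp: horn_domain_def)
  then have contH: "continuous_on ?H \<psi>" by (rule continuous_on_subset[OF psi(2)])
  \<comment> \<open>A disc in the horn domain is contained in the deep part or disjoint from it, since the images of
    its translates are connected subsets of the basin.\<close>
  have dich: "C \<subseteq> ?X" if C: "connected C" "C \<subseteq> ?H" "C \<inter> ?X \<noteq> {}" for C
  proof -
    obtain z where z: "z \<in> C" "z \<in> ?X" using C(3) by blast
    have "\<psi> (w - of_nat n) \<in> B" if w: "w \<in> C" for w n
    proof -
      let ?C = "(\<lambda>w. w - of_nat n) ` C"
      have sub: "?C \<subseteq> ?H" using horn_domain_iterate(1)[OF PD ext D(3)] C(2) by blast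
      have "connected ?C" by (intro connected_continuous_image continuous_intros C(1))
      then have "connected (\<psi> ` ?C)" by (rule connected_continuous_image[OF continuous_on_subset[OF contH sub]])
      moreover have "\<psi> ` ?C \<subseteq> parabolic_basin D f" using sub by (auto simp: horn_domain_def)
      moreover have "\<psi> (z - of_nat n) \<in> \<psi> ` ?C \<inter> B" using z by (auto simp: deep_horn_domain_def)
      ultimately have "\<psi> ` ?C \<subseteq> B" using component_absorbs[OF B(1)] by blast
      then show ?thesis using w by blast
    qed
    then show ?thesis using C(2) by (auto simp: deep_horn_domain_def)
  qed
  have ball: "\<exists>e>0. ball z e \<subseteq> ?H" if "z \<in> ?H" for z
    using opH that by (auto simp: open_contains_ball)
  show "open ?X"
    unfolding open_contains_ball
  proof
    fix z assume z: "z \<in> ?X"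
    then have "z \<in> ?H" by (simp add: deep_horn_domain_def)
    then obtain e where e: "e > 0" "ball z e \<subseteq> ?H" using ball by blast
    have "z \<in> ball z e" using e(1) by simp
    then have "ball z e \<inter> ?X \<noteq> {}" using z by blast
    then show "\<exists>e>0. ball z e \<subseteq> ?X" using dich[OF connected_ball e(2)] e(1) by blast
  qed
  show "open (?H - ?X)"
    unfolding open_contains_ball
  proof
    fix z assume z: "z \<in> ?H - ?X"
    then obtain e where e: "e > 0" "ball z e \<subseteq> ?H" using ball by blast
    have "z \<in> ball z e" using e(1) by simp
    then have "ball z e \<inter> ?X = {}" using dich[OF connected_ball e(2)] z by blast
    then show "\<exists>e>0. ball z e \<subseteq> ?H - ?X" using e by blast
  qed
qed

text \<open>Since the deep part of the horn domain contains an upper half-plane, its image under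
  \<open>exp_2pi_i\<close>, together with 0, is a neighbourhood of 0.  It is open and closed in the domain that
  is considered before passing to the component of 0, so it contains this component.\<close>

lemma renormalization_domain:
  assumes f: "(D, f) \<in> parabolic_maps" "leading_term f 1 c"
    and B: "is_immediate_basin D f A B"
    and rep: "repelling_Fatou_coordinate D f P \<phi> r"
    and ext: "extended_inverse_coordinate D f P \<phi> r \<psi>"
    and DR: "DR = connected_component_set (insert 0 (exp_2pi_i ` horn_domain D f r \<psi>)) 0"
  shows "open DR" "0 \<in> DR" "DR \<subseteq> insert 0 (exp_2pi_i ` deep_horn_domain D f r \<psi> B)"
proof -
  let ?H = "horn_domain D f r \<psi>" and ?X = "deep_horn_domain D f r \<psi> B"
  note f' = parabolic_mapsD[OF f(1)]
  note B' = immediate_basin_invariant[OF f(1) B]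
  have PD: "P \<subseteq> D" using rep by (auto simp: repelling_Fatou_coordinate_def repelling_petal_def)
  have Bc: "B \<in> components (parabolic_basin D f)" using B by (simp add: is_immediate_basin_def)
  note clopen = deep_horn_domain_clopen[OF f'(1) holomorphic_on_imp_continuous_on[OF f'(3)] f'(4) rep ext Bc
      open_parabolic_basin[OF f]]
  obtain M where M: "\<And>u. Re u < r \<Longrightarrow> M < \<bar>Im u\<bar> \<Longrightarrow> \<psi> u \<in> B"
    using horn_ends_in_basin[OF f B rep ext] by blast
  have ends: "z \<in> ?X" if z: "M < \<bar>Im z\<bar>" for z
  proof -
    obtain m :: nat where m: "Re z - r < of_nat m" using reals_Archimedean2 by blast
    define u where "u = z - of_nat m"
    have u: "Re u < r" "M < \<bar>Im u\<bar>" using m z by (auto simp: u_def)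
    then have uB: "\<psi> (u - of_nat n) \<in> B" for n by (intro M) auto
    have "u = u + of_nat 0" "iterate_defined D f 0 (\<psi> u)" by (auto simp: iterate_defined_def)
    then have "u \<in> psi_domain D f r \<psi>" using u(1) unfolding psi_domain_def by blast
    then have "u \<in> ?X"
      using uB[of 0] uB B'(2) by (auto simp: deep_horn_domain_def horn_domain_def)
    then have "u + of_int (int m) \<in> ?X" by (rule deep_horn_domain_int[OF PD ext f'(4) B'(1)])
    then show ?thesis by (simp add: u_def)
  qed
  have nbhd: "w \<in> insert 0 (exp_2pi_i ` ?X)" if w: "norm w < exp (- (2 * pi * M))" for w
  proof (cases "w = 0")
    case False
    define z where "z = Ln w / (2 * of_real pi * \<i>)"
    have Ez: "exp_2pi_i z = w" using False by (simp add: z_def exp_2pi_i_def)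
    have "norm (exp_2pi_i z) = exp (- (2 * pi * Im z))" by (simp add: exp_2pi_i_def)
    with w Ez have "M < Im z" by simp
    then have "z \<in> ?X" by (intro ends) auto
    with Ez show ?thesis by blast
  qed simp
  have op: "open (insert 0 (exp_2pi_i ` Y))" if "?X \<subseteq> Y" "open Y" for Y
  proof -
    have "ball 0 (exp (- (2 * pi * M))) \<subseteq> insert 0 (exp_2pi_i ` Y)"
      using nbhd that(1) by (force simp: image_iff)
    moreover have "(0::complex) \<in> ball 0 (exp (- (2 * pi * M)))" by simp
    ultimately have "insert 0 (exp_2pi_i ` Y) = ball 0 (exp (- (2 * pi * M))) \<union> exp_2pi_i ` Y"
      by blast
    then show ?thesis using open_exp_2pi_i_image[OF that(2)] by (simp add: open_Un)
  qed
  have XH: "?X \<subseteq> ?H" by (auto simp: deep_horn_domain_def)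
  show "open DR" unfolding DR by (rule open_connected_component[OF op[OF XH clopen(1)]])
  show "0 \<in> DR" unfolding DR by simp
  have "exp_2pi_i ` (?H - ?X) \<inter> insert 0 (exp_2pi_i ` ?X) = {}"
  proof -
    have False if "z \<in> ?H - ?X" "w \<in> ?X" "exp_2pi_i z = exp_2pi_i w" for z w
      using that deep_horn_domain_int[OF PD ext f'(4) B'(1), of w] by (auto simp: exp_2pi_i_eq_iff)
    then show ?thesis by auto
  qed
  moreover have "connected DR" unfolding DR by simp
  moreover have "DR \<subseteq> insert 0 (exp_2pi_i ` ?X) \<union> exp_2pi_i ` (?H - ?X)"
    unfolding DR using connected_component_subset[of "insert 0 (exp_2pi_i ` ?H)" 0] XH by blast
  moreover have "open (insert 0 (exp_2pi_i ` ?X))" "open (exp_2pi_i ` (?H - ?X))"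
    using op[OF order_refl clopen(2)] open_exp_2pi_i_image[OF clopen(3)] by auto
  ultimately have "DR \<inter> exp_2pi_i ` (?H - ?X) = {}"
    using connectedD[of DR "insert 0 (exp_2pi_i ` ?X)" "exp_2pi_i ` (?H - ?X)"] \<open>0 \<in> DR\<close> by blast
  with \<open>DR \<subseteq> _\<close> show "DR \<subseteq> insert 0 (exp_2pi_i ` ?X)" by blast
qed

lemma renormalization_parabolic:
  assumes ren: "is_parabolic_renormalization D f \<phi>att r \<psi> DR g" and DR: "open DR" "0 \<in> DR"
  obtains \<sigma> where "(DR, g) \<in> parabolic_maps"
    "\<And>z. z \<in> horn_domain D f r \<psi> \<Longrightarrow> exp_2pi_i z \<in> DR \<Longrightarrow> g (exp_2pi_i z) = exp_2pi_i (\<phi>att (\<psi> z) + \<sigma>)"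
proof -
  obtain \<sigma> l where DReq: "DR = connected_component_set (insert 0 (exp_2pi_i ` horn_domain D f r \<psi>)) 0"
    and l: "extended_horn_map D f \<phi>att r \<psi> \<sigma> l" "deriv l 0 = 1" "\<And>z. z \<in> DR \<Longrightarrow> g z = l z"
    using ren by (auto simp: is_parabolic_renormalization_def)
  have l': "l holomorphic_on insert 0 (exp_2pi_i ` horn_domain D f r \<psi>)" "l 0 = 0"
    "\<And>z. z \<in> horn_domain D f r \<psi> \<Longrightarrow> l (exp_2pi_i z) = exp_2pi_i (\<phi>att (\<psi> z) + \<sigma>)"
    using l(1) by (auto simp: extended_horn_map_def)
  have "DR \<subseteq> insert 0 (exp_2pi_i ` horn_domain D f r \<psi>)"
    unfolding DReq by (rule connected_component_subset)
  then have "l holomorphic_on DR" by (rule holomorphic_on_subset[OF l'(1)])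
  then have "g holomorphic_on DR" using l(3) by (simp cong: holomorphic_cong)
  moreover have "g 0 = 0" using l(3)[OF DR(2)] l'(2) by simp
  moreover have "\<forall>\<^sub>F z in nhds 0. g z = l z"
    using DR l(3) by (auto intro: eventually_mono[OF eventually_nhds_in_open])
  then have "deriv g 0 = 1" using l(2) by (simp cong: deriv_cong_ev)
  ultimately have "(DR, g) \<in> parabolic_maps" using DR by (simp add: parabolic_maps_def)
  then show ?thesis using that l(3) l'(3) by metis
qed

section \<open>Properness on virtual basins\<close>

lemma compact_iterate_preimage:
  assumes proper: "\<And>K. compact K \<Longrightarrow> K \<subseteq> B \<Longrightarrow> compact {z\<in>B. f z \<in> K}" and "f ` B \<subseteq> B"
    and K: "compact K" "K \<subseteq> B"
  shows "compact {z\<in>B. (f ^^ n) z \<in> K}"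
proof (induction n)
  case 0
  have "{z\<in>B. z \<in> K} = K" using K by auto
  then show ?case using K by simp
next
  case (Suc n)
  have "{z\<in>B. (f ^^ Suc n) z \<in> K} = {z\<in>B. f z \<in> {y\<in>B. (f ^^ n) y \<in> K}}"
    using \<open>f ` B \<subseteq> B\<close> by (auto simp: funpow_swap1)
  then show ?case using proper[OF Suc] by simp
qed

lemma proper_surjective:
  assumes B: "open B" "connected B" "B \<noteq> {}" "f holomorphic_on B" "f ` B \<subseteq> B"
    and proper: "\<And>K. compact K \<Longrightarrow> K \<subseteq> B \<Longrightarrow> compact {z\<in>B. f z \<in> K}"
    and fin: "finite {c\<in>B. deriv f c = 0}"
  shows "f ` B = B"
proof -
  have "\<not> f constant_on B"
  proof
    assume "f constant_on B"
    then obtain k where k: "\<And>z. z \<in> B \<Longrightarrow> f z = k" by (auto simp: constant_on_def)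
    have "deriv f z = 0" if "z \<in> B" for z
    proof -
      have "((\<lambda>_. k) has_field_derivative 0) (at z)" by simp
      then have "(f has_field_derivative 0) (at z)"
        by (rule has_field_derivative_transform_within_open[OF _ B(1) that]) (use k in auto)
      then show ?thesis by (rule DERIV_imp_deriv)
    qed
    then have "{c\<in>B. deriv f c = 0} = B" by auto
    with fin B show False using finite_imp_not_open by auto
  qed
  then have "open (f ` B)" using open_mapping_thm[OF B(4,1,2,1)] by blast
  then have 1: "openin (top_of_set B) (f ` B)" using B by (simp add: openin_open_eq)
  have 2: "closedin (top_of_set B) (f ` B)"
  proof (rule proper_map)
    show "compact (B \<inter> f -` U)" if "U \<subseteq> B" "compact U" for U
    proof -
      have "B \<inter> f -` U = {z\<in>B. f z \<in> U}" by blast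
      then show ?thesis using proper[OF that(2,1)] by simp
    qed
  qed (use B in auto)
  from 1 2 B show ?thesis using connected_clopen by blast
qed

text \<open>By Liouville's theorem, a domain that is conformally equivalent to a disc and does not
  contain 0 omits another point.\<close>

lemma disc_image_omits:
  assumes \<kappa>: "\<kappa> holomorphic_on B" "bij_betw \<kappa> B (ball 0 1)" and "0 \<notin> B"
  obtains a where "a \<noteq> 0" "a \<notin> B"
proof -
  have "B \<noteq> - {0}"
  proof
    assume B: "B = - {0}"
    have expB: "exp ` UNIV \<subseteq> B" unfolding B by auto
    have "(\<kappa> \<circ> exp) holomorphic_on UNIV"
      using holomorphic_on_compose[OF holomorphic_on_exp holomorphic_on_subset[OF \<kappa>(1) expB]] .
    moreover have "range (\<kappa> \<circ> exp) \<subseteq> ball 0 1"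
      unfolding image_comp[symmetric] using \<kappa>(2) expB by (auto simp: bij_betw_def)
    then have "bounded (range (\<kappa> \<circ> exp))" by (rule bounded_subset[OF bounded_ball])
    ultimately have "(\<kappa> \<circ> exp) constant_on UNIV" by (rule Liouville_theorem)
    then have "\<kappa> (exp 0) = \<kappa> (exp 1)" unfolding constant_on_def o_def by (metis UNIV_I)
    moreover have "inj_on \<kappa> (- {0})" using \<kappa>(2) B by (simp add: bij_betw_def)
    ultimately have "exp 0 = (exp 1 :: complex)"
      using inj_onD[of \<kappa> "- {0}" "exp 0" "exp 1"] by simp
    then have "exp (0::real) = exp 1" by (metis Re_complex_of_real exp_of_real of_real_0 of_real_1)
    then show False by simp
  qed
  with \<open>0 \<notin> B\<close> that show ?thesis by blast
qed

text \<open>To the left, \<open>\<psi>\<close> runs through orbits of the local inverse in the repelling petal.\<close>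

lemma extended_inverse_tendsto_0:
  assumes f: "(D, f) \<in> parabolic_maps" "leading_term f 1 c"
    and rep: "repelling_Fatou_coordinate D f P \<phi> r" and ext: "extended_inverse_coordinate D f P \<phi> r \<psi>"
  shows "(\<lambda>n. \<psi> (z - of_nat n)) \<longlonglongrightarrow> 0"
proof -
  have rp: "repelling_petal D f P" and \<phi>: "inj_on \<phi> P" "\<And>z. z \<in> P \<Longrightarrow> f z \<in> P \<Longrightarrow> \<phi> (f z) = \<phi> z + 1"
    using rep by (auto simp: repelling_Fatou_coordinate_def)
  obtain W g where g: "(W, g) \<in> parabolic_maps" "\<forall>w\<in>W. g w \<in> D \<and> f (g w) = w"
    and P: "open P" "g ` P \<subseteq> P" "P \<subseteq> parabolic_basin W g"
    using repelling_petalE[OF f rp] by metis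
  have \<psi>: "\<psi> u \<in> P \<and> \<phi> (\<psi> u) = u" if "Re u < r" for u
    using ext that by (auto simp: extended_inverse_coordinate_def)
  obtain m :: nat where m: "Re z - r < of_nat m" using reals_Archimedean2 by blast
  have "\<psi> (z - of_nat (n + m)) = (g ^^ n) (\<psi> (z - of_nat m))" for n
  proof (induction n)
    case (Suc n)
    let ?u = "z - of_nat (n + m)" and ?v = "z - of_nat (Suc n + m)"
    have u: "Re ?u < r" "Re ?v < r" using m by auto
    have "\<psi> ?u \<in> P" "\<phi> (\<psi> ?u) = ?u" using \<psi>[OF u(1)] by auto
    moreover from this have "g (\<psi> ?u) \<in> P" "f (g (\<psi> ?u)) = \<psi> ?u"
      using P g(2) parabolic_basinD(4) by blast+
    ultimately have "\<phi> (g (\<psi> ?u)) = ?v" using \<phi>(2)[of "g (\<psi> ?u)"] by (simp add: algebra_simps)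
    then have "g (\<psi> ?u) = \<psi> ?v"
      using \<psi>[OF u(2)] \<open>g (\<psi> ?u) \<in> P\<close> \<phi>(1) by (metis inj_onD)
    then show ?case using Suc by simp
  qed simp
  moreover have "(\<lambda>n. (g ^^ n) (\<psi> (z - of_nat m))) \<longlonglongrightarrow> 0"
    using \<psi>[of "z - of_nat m"] m P(3) parabolic_basinD(3) by force
  ultimately have "(\<lambda>n. \<psi> (z - of_nat (n + m))) \<longlonglongrightarrow> 0" by simp
  then show ?thesis by (rule LIMSEQ_offset)
qed

text \<open>If the points of a compact set have backward orbits that depend continuously on the point and
  converge uniformly to 0, these orbits are eventually given by the repelling Fatou coordinate, so
  the identity of the compact set lifts through \<open>\<psi>\<close>.\<close>

lemma lift_to_repelling_coordinate:
  assumes f: "(D, f) \<in> parabolic_maps" "leading_term f 1 c"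
    and rep: "repelling_Fatou_coordinate D f P \<phi> r" and ext: "extended_inverse_coordinate D f P \<phi> r \<psi>"
    and V: "open V" "\<And>m. continuous_on V (h m)" and K: "compact K" "K \<subseteq> V" "x0 \<in> K"
    and h: "\<And>x. x \<in> K \<Longrightarrow> h 0 x = x" "\<And>m x. x \<in> K \<Longrightarrow> f (h (Suc m) x) = h m x"
      "\<And>m x. x \<in> K \<Longrightarrow> h m x \<in> D" "\<And>m x. x \<in> K \<Longrightarrow> h m x \<noteq> 0"
    and lim: "uniform_limit K h (\<lambda>_. 0) sequentially"
    and w0: "\<And>m. h m x0 = \<psi> (w0 - of_nat m)"
  obtains v where "continuous_on K v" "v x0 = w0" "\<And>x. x \<in> K \<Longrightarrow> v x \<in> psi_domain D f r \<psi> \<and> \<psi> (v x) = x"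
proof -
  have rp: "repelling_petal D f P" and \<phi>: "\<phi> holomorphic_on P" "inj_on \<phi> P"
    "\<And>z. z \<in> P \<Longrightarrow> f z \<in> P \<Longrightarrow> \<phi> (f z) = \<phi> z + 1"
    using rep by (auto simp: repelling_Fatou_coordinate_def)
  obtain W g where g: "(W, g) \<in> parabolic_maps" "\<forall>w\<in>W. g w \<in> D \<and> f (g w) = w"
    and P: "open P" "g ` P \<subseteq> P" "P \<subseteq> parabolic_basin W g"
    and absorb: "\<And>y. y \<in> parabolic_basin W g \<Longrightarrow> \<forall>\<^sub>F n in sequentially. (g ^^ n) y \<in> P"
    using repelling_petalE[OF f rp] by metis
  note g' = parabolic_mapsD[OF g(1)]
  have \<psi>: "\<psi> u \<in> P \<and> \<phi> (\<psi> u) = u" if "Re u < r" for u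
    using ext that by (auto simp: extended_inverse_coordinate_def)
  have "\<forall>\<^sub>F z in at 0. g (f z) = z \<and> z \<in> W"
    using local_inverse_left[OF f(1) g] eventually_at_in_open'[OF g'(1,2)] by (rule eventually_conj)
  then obtain d where d: "d > 0" "\<And>z. z \<noteq> 0 \<Longrightarrow> norm z < d \<Longrightarrow> g (f z) = z \<and> z \<in> W"
    unfolding eventually_at by auto
  obtain m1 where m1: "\<And>m x. m \<ge> m1 \<Longrightarrow> x \<in> K \<Longrightarrow> norm (h m x) < d"
    using uniform_limitD[OF lim d(1)] by (auto simp: eventually_sequentially)
  have gh: "g (h m x) = h (Suc m) x" "h m x \<in> W" if "m \<ge> m1" "x \<in> K" for m x
    using d(2)[OF h(4) m1, of x "Suc m"] d(2)[OF h(4) m1, of x m] h(2) that by auto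
  have ghn: "(g ^^ j) (h m x) = h (m + j) x" if "m \<ge> m1" "x \<in> K" for m j x
    by (induction j) (use gh(1) that in auto)
  have hP: "h (m + j) x \<in> P" if "m \<ge> m1" "x \<in> K" "h m x \<in> P" for m j x
    using ghn[OF that(1,2)] iterates_in_invariant_set[OF P(2) that(3)] by metis
  have basin: "h m1 x \<in> parabolic_basin W g" if x: "x \<in> K" for x
  proof -
    have "(\<lambda>n. h n x) \<longlonglongrightarrow> 0" using tendsto_uniform_limitI[OF lim x] .
    then have "(\<lambda>n. h (m1 + n) x) \<longlonglongrightarrow> 0"
      using LIMSEQ_ignore_initial_segment[of "\<lambda>n. h n x" 0 m1] by (simp add: add.commute)
    then show ?thesis
      using ghn[OF order_refl x] gh(2)[OF _ x] h(4)[OF x]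
      by (auto simp: parabolic_basin_def iterate_defined_def)
  qed
  define T where "T m = V \<inter> h m -` P" for m
  have "open (T m)" for m unfolding T_def by (rule continuous_open_preimage[OF V(2,1) P(1)])
  moreover have "K \<subseteq> (\<Union>m\<in>{m1..}. T m)"
  proof
    fix x assume x: "x \<in> K"
    obtain j where "(g ^^ j) (h m1 x) \<in> P"
      using absorb[OF basin[OF x]] by (meson eventually_sequentially le_refl)
    then have "x \<in> T (m1 + j)" using ghn[OF order_refl x] x K(2) by (auto simp: T_def)
    then show "x \<in> (\<Union>m\<in>{m1..}. T m)" by (meson UN_I atLeast_iff le_add1)
  qed
  ultimately obtain F where F: "F \<subseteq> {m1..}" "finite F" "K \<subseteq> (\<Union>m\<in>F. T m)"
    using compactE_image[OF K(1), of "{m1..}" T] by metis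
  define m2 where "m2 = Max (insert m1 F)"
  have m2: "m2 \<ge> m1" using F(2) by (simp add: m2_def)
  have inP: "h m x \<in> P" if "m \<ge> m2" "x \<in> K" for m x
  proof -
    obtain m' where m': "m' \<in> F" "h m' x \<in> P" using F(3) \<open>x \<in> K\<close> by (auto simp: T_def)
    then have "m' \<ge> m1" "m' \<le> m2" using F by (auto simp: m2_def)
    then show ?thesis using hP[OF _ that(2) m'(2), of "m - m'"] that(1) by simp
  qed
  have \<phi>h: "\<phi> (h (m2 + i) x) = \<phi> (h m2 x) - of_nat i" if x: "x \<in> K" for x i
  proof (induction i)
    case (Suc i)
    have "\<phi> (f (h (Suc (m2 + i)) x)) = \<phi> (h (Suc (m2 + i)) x) + 1"
      using inP[OF _ x] h(2)[OF x] by (intro \<phi>(3)) auto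
    then show ?case using Suc h(2)[OF x] by (simp add: algebra_simps)
  qed simp
  have cont: "continuous_on K (\<lambda>x. \<phi> (h m x))" if "m \<ge> m2" for m
    using inP[OF that] K(2)
    by (intro continuous_on_compose2[OF holomorphic_on_imp_continuous_on[OF \<phi>(1)]]
        continuous_on_subset[OF V(2)]) auto
  have "bounded ((\<lambda>x. \<phi> (h m2 x)) ` K)"
    using compact_continuous_image[OF cont[OF order_refl] K(1)] by (rule compact_imp_bounded)
  then obtain b where b: "\<And>x. x \<in> K \<Longrightarrow> norm (\<phi> (h m2 x)) \<le> b" by (auto simp: bounded_iff)
  obtain i :: nat where i: "max (b - r) (Re w0 - r) < of_nat i" using reals_Archimedean2 by blast
  define m3 where "m3 = m2 + i"
  have m3: "m3 \<ge> m2" by (simp add: m3_def)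
  define t where "t x = \<phi> (h m3 x)" for x
  have Ret: "Re (t x) < r" if "x \<in> K" for x
    using \<phi>h[OF that, of i] b[OF that] complex_Re_le_cmod[of "\<phi> (h m2 x)"] i by (simp add: t_def m3_def)
  have \<psi>t: "\<psi> (t x) = h m3 x" if x: "x \<in> K" for x
    using \<psi>[OF Ret[OF x]] inP[OF m3 x] \<phi>(2) by (simp add: t_def inj_on_def)
  have fh: "(f ^^ k) (h (m + k) x) = h m x" if x: "x \<in> K" for m k x
  proof (induction k)
    case (Suc k)
    then show ?case using h(2)[OF x] by (simp add: funpow_swap1)
  qed simp
  define v where "v x = t x + of_nat m3" for x
  have "v x \<in> psi_domain D f r \<psi> \<and> \<psi> (v x) = x" if x: "x \<in> K" for x
  proof -
    have it: "iterate_defined D f m3 (\<psi> (t x))"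
      unfolding iterate_defined_def
    proof (intro allI impI)
      fix k assume "k < m3"
      then have "(f ^^ k) (\<psi> (t x)) = h (m3 - k) x" using fh[OF x, of k "m3 - k"] \<psi>t[OF x] by simp
      then show "(f ^^ k) (\<psi> (t x)) \<in> D" using h(3)[OF x] by simp
    qed
    have "\<psi> (v x) = (f ^^ m3) (\<psi> (t x))"
      unfolding v_def using ext Ret[OF x] it unfolding extended_inverse_coordinate_def by blast
    also have "\<dots> = x" using fh[OF x, of m3 0] \<psi>t[OF x] h(1)[OF x] by simp
    finally show ?thesis
      using Ret[OF x] it unfolding psi_domain_def v_def by blast
  qed
  moreover have "v x0 = w0"
  proof -
    have "Re (w0 - of_nat m3) < r" using i by (simp add: m3_def)
    then show ?thesis using \<psi>[of "w0 - of_nat m3"] w0[of m3] by (simp add: v_def t_def)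
  qed
  moreover have "continuous_on K v" unfolding v_def t_def by (intro continuous_intros cont m3)
  ultimately show ?thesis using that by blast
qed


text \<open>The virtual basins are relatively closed in the set of points of \<open>B\<close> that the attracting Fatou
  coordinate, followed by a translation and \<open>exp_2pi_i\<close>, maps into \<open>BR\<close>.  Let \<open>z\<close> be a limit
  point of the virtual basin in this set.  Since the critical orbits converge to 0, a disc around
  \<open>z\<close> contains no iterate of order at least \<open>n1\<close> of a critical point.  The inverse branches
  along backward orbits of points of the virtual basin are therefore defined on a disc around a
  limit point \<open>y0\<close> of the corresponding points of order \<open>n1\<close> of these orbits.  They converge to 0
  and lift through \<open>\<psi>\<close>; the lift, translated by an integer, stays in the component \<open>U\<close>.\<close>

lemma virtual_basin_relatively_closed:
  assumes f: "(D, f) \<in> parabolic_maps" "leading_term f 1 c"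
    and B: "is_immediate_basin D f A B" "f ` B = B"
    and proper: "\<And>K. compact K \<Longrightarrow> K \<subseteq> B \<Longrightarrow> compact {z\<in>B. f z \<in> K}"
    and fin: "finite {c\<in>B. deriv f c = 0}"
    and a: "a \<noteq> 0" "a \<notin> B"
    and att: "continuous_on B \<phi>att"
    and rep: "repelling_Fatou_coordinate D f P \<phi> r" and ext: "extended_inverse_coordinate D f P \<phi> r \<psi>"
    and DR: "DR = connected_component_set (insert 0 (exp_2pi_i ` horn_domain D f r \<psi>)) 0"
    and g: "g 0 = 0"
      "\<And>z. z \<in> horn_domain D f r \<psi> \<Longrightarrow> exp_2pi_i z \<in> DR \<Longrightarrow> g (exp_2pi_i z) = exp_2pi_i (\<phi>att (\<psi> z) + \<sigma>)"
    and BR: "BR \<in> components (parabolic_basin DR g)" "open BR"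
    and U: "U \<in> components (exp_2pi_i -` BR)" "U \<subseteq> deep_horn_domain D f r \<psi> B"
    and z: "z \<in> B" "z \<in> closure (virtual_basin \<psi> U N)" "exp_2pi_i (\<phi>att z + \<sigma>) \<in> BR"
  shows "z \<in> virtual_basin \<psi> U N"
proof -
  let ?H = "horn_domain D f r \<psi>" and ?X = "deep_horn_domain D f r \<psi> B"
  note f' = parabolic_mapsD[OF f(1)]
  note B' = immediate_basin_invariant[OF f(1) B(1)]
  have Bc: "B \<in> components (parabolic_basin D f)" using B by (simp add: is_immediate_basin_def)
  have Bo: "open B" using Bc open_parabolic_basin[OF f] open_components by blast
  have BD: "B \<subseteq> D" using B'(2) parabolic_basinD(4) by blast
  have holB: "f holomorphic_on B" using f'(3) BD by (rule holomorphic_on_subset)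
  have contB: "continuous_on B f" using holB by (rule holomorphic_on_imp_continuous_on)
  have itB: "(f ^^ n) y \<in> B" if "y \<in> B" for n y by (rule iterates_in_invariant_set[OF B'(1) that])
  have cont_it: "continuous_on B (f ^^ n)" for n
  proof (induction n)
    case (Suc n)
    show ?case unfolding funpow.simps o_def
      by (rule continuous_on_compose2[OF contB Suc]) (use itB in auto)
  qed (simp add: continuous_on_id id_def)
  have B0: "y \<noteq> 0" if "y \<in> B" for y using B'(2) parabolic_basinD(2)[of y D f 0] that by auto
  have PD: "P \<subseteq> D" using rep by (auto simp: repelling_Fatou_coordinate_def repelling_petal_def)
  define \<Omega> where "\<Omega> = B \<inter> (\<lambda>y. exp_2pi_i (\<phi>att y + \<sigma>)) -` BR"
  have "continuous_on B (\<lambda>y. exp_2pi_i (\<phi>att y + \<sigma>))"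
    by (intro continuous_on_compose2[OF continuous_exp_2pi_i[of UNIV]] continuous_intros att) auto
  then have "open \<Omega>" unfolding \<Omega>_def using Bo BR(2) by (rule continuous_open_preimage)
  moreover have "z \<in> \<Omega>" using z by (simp add: \<Omega>_def)
  ultimately obtain \<rho> where \<rho>: "\<rho> > 0" "cball z \<rho> \<subseteq> \<Omega>" by (auto simp: open_contains_cball)
  then have \<rho>B: "cball z \<rho> \<subseteq> B" by (auto simp: \<Omega>_def)
  have "\<forall>\<^sub>F n in sequentially. (f ^^ n) b \<notin> cball z \<rho>" if "b \<in> B" for b
  proof -
    have "(\<lambda>n. (f ^^ n) b) \<longlonglongrightarrow> 0" using that B'(2) parabolic_basinD(3) by blast
    moreover have "open (- cball z \<rho>)" "0 \<in> - cball z \<rho>" using \<rho>B B0 by blast+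
    ultimately have "\<forall>\<^sub>F n in sequentially. (f ^^ n) b \<in> - cball z \<rho>" by (rule topological_tendstoD)
    then show ?thesis by simp
  qed
  then have "\<forall>\<^sub>F n in sequentially. \<forall>b\<in>{c\<in>B. deriv f c = 0}. (f ^^ n) b \<notin> cball z \<rho>"
    using fin by (intro eventually_ball_finite) auto
  then obtain n1 where n1: "\<And>n b. n \<ge> n1 \<Longrightarrow> b \<in> B \<Longrightarrow> deriv f b = 0 \<Longrightarrow> (f ^^ n) b \<notin> cball z \<rho>"
    by (auto simp: eventually_sequentially)
  define S where "S = {y\<in>B. (f ^^ n1) y \<in> cball z \<rho>}"
  have S: "compact S"
    unfolding S_def using compact_iterate_preimage[OF proper B'(1) compact_cball \<rho>B] .
  \<comment> \<open>The parameters of the points of order \<open>n1\<close> of backward orbits of points close to \<open>z\<close>.\<close>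
  have "\<exists>u\<in>U. dist (\<psi> (u + of_int N)) z < min \<rho> (1 / real (Suc k))" for k
  proof -
    have "\<exists>y\<in>virtual_basin \<psi> U N. dist y z < min \<rho> (1 / real (Suc k))"
      using z(2) \<rho>(1) unfolding closure_approachable by (metis min_less_iff_conj of_nat_0_less_iff zero_less_Suc zero_less_divide_1_iff)
    then show ?thesis by (auto simp: virtual_basin_def)
  qed
  then obtain u where u: "\<And>k. u k \<in> U" "\<And>k. dist (\<psi> (u k + of_int N)) z < min \<rho> (1 / real (Suc k))"
    by metis
  have uX: "u k + of_int j \<in> ?X" for k j
    by (rule deep_horn_domain_int[OF PD ext f'(4) B'(1)]) (use u(1) U(2) in blast)
  have XH: "w \<in> ?H" and XB: "\<psi> (w - of_nat n) \<in> B" if "w \<in> ?X" for w n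
    using that by (auto simp: deep_horn_domain_def)
  define w0 where "w0 k = u k + of_int N - of_nat n1" for k
  have w0X: "w0 k \<in> ?X" for k using uX[of k "N - int n1"] by (simp add: w0_def algebra_simps)
  define y where "y k = \<psi> (w0 k)" for k
  have yB: "y k \<in> B" for k using XB[OF w0X, of k 0] by (simp add: y_def)
  have fy: "(f ^^ n1) (y k) = \<psi> (u k + of_int N)" for k
    using horn_domain_iterate(2)[OF PD ext f'(4) XH[OF uX[of k N]], of n1] by (simp add: y_def w0_def)
  have "y k \<in> S" for k
    using yB u(2)[of k] by (auto simp: S_def fy dist_commute)
  then obtain y0 s where y0: "y0 \<in> S" "strict_mono (s :: nat \<Rightarrow> nat)" "(y \<circ> s) \<longlonglongrightarrow> y0"
    using S unfolding compact_def by metis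
  have y0B: "y0 \<in> B" using y0(1) by (simp add: S_def)
  have fy0: "(f ^^ n1) y0 = z"
  proof -
    have "(\<lambda>k. (f ^^ n1) ((y \<circ> s) k)) \<longlonglongrightarrow> (f ^^ n1) y0"
      by (rule continuous_on_tendsto_compose[OF cont_it y0(3) y0B]) (simp add: yB)
    moreover have "(\<lambda>k. \<psi> (u k + of_int N)) \<longlonglongrightarrow> z"
    proof (rule metric_LIMSEQ_I)
      fix e :: real assume "e > 0"
      then obtain M where M: "1 / real (Suc M) < e" using nat_approx_posE by blast
      have "dist (\<psi> (u k + of_int N)) z < e" if "k \<ge> M" for k
      proof -
        have "1 / real (Suc k) \<le> 1 / real (Suc M)" using that by (intro divide_left_mono) auto
        with u(2)[of k] M show ?thesis by linarith
      qed
      then show "\<exists>M. \<forall>k\<ge>M. dist (\<psi> (u k + of_int N)) z < e" by blast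
    qed
    then have "(\<lambda>k. \<psi> (u (s k) + of_int N)) \<longlonglongrightarrow> z"
      using LIMSEQ_subseq_LIMSEQ[OF _ y0(2)] by (auto simp: o_def)
    ultimately show ?thesis using LIMSEQ_unique by (auto simp: fy)
  qed
  have "open (B \<inter> (f ^^ n1) -` ball z \<rho>)" by (rule continuous_open_preimage[OF cont_it Bo open_ball])
  moreover have "y0 \<in> B \<inter> (f ^^ n1) -` ball z \<rho>" using y0B fy0 \<rho>(1) by simp
  ultimately obtain \<epsilon> where \<epsilon>: "\<epsilon> > 0" "ball y0 \<epsilon> \<subseteq> B \<inter> (f ^^ n1) -` ball z \<rho>"
    by (rule openE)
  obtain k where k: "dist (y k) y0 < \<epsilon>"
    using metric_LIMSEQ_D[OF y0(3) \<epsilon>(1)] by auto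
  define \<Delta> where "\<Delta> = ball y0 \<epsilon>"
  have \<Delta>: "open \<Delta>" "connected \<Delta>" "simply_connected \<Delta>" "\<Delta> \<subseteq> B" "y k \<in> \<Delta>"
    using \<epsilon> k by (auto simp: \<Delta>_def dist_commute convex_imp_simply_connected)
  have avoid: "(f ^^ Suc n) b \<notin> \<Delta>" if "b \<in> B" "deriv f b = 0" for b n
  proof
    assume "(f ^^ Suc n) b \<in> \<Delta>"
    then have "(f ^^ n1) ((f ^^ Suc n) b) \<in> ball z \<rho>" using \<epsilon>(2) by (auto simp: \<Delta>_def)
    then have "(f ^^ (n1 + Suc n)) b \<in> cball z \<rho>" unfolding funpow_add by auto
    then show False using n1[OF _ that, of "n1 + Suc n"] by simp
  qed
  define w where "w m = \<psi> (w0 k - of_nat m)" for m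
  have w: "w 0 = y k" "w m \<in> B" "f (w (Suc m)) = w m" for m
  proof -
    show "w 0 = y k" by (simp add: w_def y_def)
    show "w m \<in> B" unfolding w_def by (rule XB[OF w0X])
    have "w0 k - of_nat m \<in> ?H" by (rule horn_domain_iterate(1)[OF PD ext f'(4) XH[OF w0X]])
    from horn_domain_step(2)[OF PD ext f'(4) this] show "f (w (Suc m)) = w m"
      by (simp add: w_def algebra_simps)
  qed
  obtain h where h: "\<And>x. x \<in> \<Delta> \<Longrightarrow> h 0 x = x" "\<And>n. h n holomorphic_on \<Delta>" "\<And>n. h n ` \<Delta> \<subseteq> B"
    "\<And>n. h n (y k) = w n" "\<And>n x. x \<in> \<Delta> \<Longrightarrow> f (h (Suc n) x) = h n x"
    using inverse_branches[OF Bo holB B(2) proper fin \<Delta>(1,3,4,5) avoid w] by blast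
  define K where "K = cball y0 (dist (y k) y0)"
  have K: "compact K" "K \<subseteq> \<Delta>" "y k \<in> K" "y0 \<in> K" "connected K"
    using k by (auto simp: K_def \<Delta>_def dist_commute)
  have "(\<lambda>n. h n (y k)) \<longlonglongrightarrow> 0"
    unfolding h(4) w_def by (rule extended_inverse_tendsto_0[OF f rep ext])
  then have lim: "uniform_limit K h (\<lambda>_. 0) sequentially"
    using omitting_sequence_tendsto_0[OF \<Delta>(1,2,5), of h a K] h(2,3) a B0 K(1,2) by blast
  have conth: "continuous_on \<Delta> (h m)" for m using h(2) by (rule holomorphic_on_imp_continuous_on)
  have hD: "h m x \<in> D" "h m x \<noteq> 0" if "x \<in> K" for m x
    using h(3)[of m] K(2) that BD B0 by blast+
  have hw: "h m (y k) = \<psi> (w0 k - of_nat m)" for m unfolding h(4) w_def ..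
  have h05: "h 0 x = x" "f (h (Suc m) x) = h m x" if "x \<in> K" for m x using h(1,5) K(2) that by auto
  obtain v where v: "continuous_on K v" "v (y k) = w0 k"
      "\<And>x. x \<in> K \<Longrightarrow> v x \<in> psi_domain D f r \<psi> \<and> \<psi> (v x) = x"
    using lift_to_repelling_coordinate[OF f rep ext \<Delta>(1) conth K(1,2,3) h05 hD lim hw] by blast
  have vH: "v x \<in> ?H" if "x \<in> K" for x
    using v(3)[OF that] K(2) \<Delta>(4) B'(2) that by (auto simp: horn_domain_def)
  have con: "connected (v ` K)" using v(1) K(5) by (rule connected_continuous_image)
  then have conE: "connected (exp_2pi_i ` v ` K)"
    by (rule connected_continuous_image[OF continuous_exp_2pi_i])
  have "exp_2pi_i (u k) \<in> BR" using u(1) in_components_subset[OF U(1)] by blast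
  moreover have "exp_2pi_i (w0 k) = exp_2pi_i (u k)"
    unfolding exp_2pi_i_eq_iff by (intro exI[of _ "N - int n1"]) (simp add: w0_def)
  ultimately have base: "exp_2pi_i (w0 k) \<in> BR" by simp
  then have baseE: "exp_2pi_i (w0 k) \<in> BR \<inter> exp_2pi_i ` v ` K" using K(3) v(2) by (metis IntI imageI)
  have BRb: "BR \<subseteq> parabolic_basin DR g" using BR(1) by (rule in_components_subset)
  then have BRD: "BR \<subseteq> DR" using parabolic_basinD(4) by blast
  have ED: "exp_2pi_i ` v ` K \<subseteq> DR"
  proof -
    have "connected_component_set (insert 0 (exp_2pi_i ` ?H)) (exp_2pi_i (w0 k)) = DR"
      unfolding DR using base BRD DR connected_component_eq by blast
    moreover have "exp_2pi_i ` v ` K \<subseteq> connected_component_set (insert 0 (exp_2pi_i ` ?H)) (exp_2pi_i (w0 k))"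
      by (rule connected_component_maximal) (use baseE conE vH in auto)
    ultimately show ?thesis by simp
  qed
  have "exp_2pi_i ` v ` K \<subseteq> parabolic_basin DR g"
  proof clarify
    fix x assume x: "x \<in> K"
    have "(f ^^ n1) x \<in> ball z \<rho>" using x K(2) \<epsilon>(2) by (auto simp: \<Delta>_def)
    then have "(f ^^ n1) x \<in> \<Omega>" using \<rho>(2) ball_subset_cball by blast
    moreover have "\<psi> (v x + of_nat n1) = (f ^^ n1) x" "v x + of_nat n1 \<in> ?H"
      using horn_domain_iterate(3,4)[OF PD ext f'(4) vH[OF x], of n1] v(3)[OF x] by auto
    ultimately have "exp_2pi_i (\<phi>att (\<psi> (v x + of_nat n1)) + \<sigma>) \<in> BR" by (simp add: \<Omega>_def)
    moreover have "exp_2pi_i (v x) \<in> DR" using ED x by blast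
    ultimately have "g (exp_2pi_i (v x)) \<in> BR"
      using g(2)[OF \<open>v x + of_nat n1 \<in> ?H\<close>] by simp
    then show "exp_2pi_i (v x) \<in> parabolic_basin DR g"
      using parabolic_basin_pullback[of g DR 1 "exp_2pi_i (v x)"] g(1) BRb \<open>exp_2pi_i (v x) \<in> DR\<close>
      by (auto simp: iterate_defined_def)
  qed
  then have EBR: "exp_2pi_i ` v ` K \<subseteq> BR"
    using component_absorbs[OF BR(1) conE] baseE by blast
  define v' where "v' x = v x + of_int (int n1 - N)" for x
  have v'u: "v' (y k) = u k" by (simp add: v'_def v(2) w0_def)
  have "v' ` K \<subseteq> U"
  proof (rule component_absorbs[OF U(1)])
    show "connected (v' ` K)"
      unfolding v'_def using v(1) K(5) by (intro connected_continuous_image continuous_intros)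
    show "v' ` K \<subseteq> exp_2pi_i -` BR"
    proof clarify
      fix x assume "x \<in> K"
      then have "exp_2pi_i (v x) \<in> BR" using EBR by blast
      then show "v' x \<in> exp_2pi_i -` BR" unfolding v'_def vimage_eq exp_2pi_i_shift .
    qed
    show "v' ` K \<inter> U \<noteq> {}" using K(3) v'u u(1) by (metis disjoint_iff imageI)
  qed
  then have "v' y0 \<in> U" using K(4) by blast
  moreover have "z = \<psi> (v' y0 + of_int N)"
  proof -
    have "\<psi> (v y0 + of_nat n1) = (f ^^ n1) y0"
      using horn_domain_iterate(4)[OF PD ext f'(4) vH[OF K(4)], of n1] v(3)[OF K(4)] by auto
    moreover have "v' y0 + of_int N = v y0 + of_nat n1" by (simp add: v'_def)
    ultimately show ?thesis using fy0 by simp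
  qed
  ultimately show ?thesis by (auto simp: virtual_basin_def)
qed

lemma nondegenerate_leading_term:
  assumes "(D, f) \<in> parabolic_maps" "deriv (deriv f) 0 \<noteq> 0"
  shows "leading_term f 1 (fps_nth (fps_expansion f 0) 2)"
proof -
  have "fps_nth (fps_expansion f 0) 2 = deriv (deriv f) 0 / 2"
    by (simp add: fps_expansion_def numeral_2_eq_2)
  then show ?thesis using assms(2) by (auto simp: leading_term_def numeral_2_eq_2)
qed

theorem proposition4p12:
  fixes \<tau> :: "nat list"
    and D DR P A BR U :: "complex set"
    and f Rf \<phi>att \<phi>rep \<psi>rep :: "complex \<Rightarrow> complex"
    and r :: real and N :: int
  assumes "composition_type \<tau>"
    and "(D, f) \<in> Dyn \<tau>"
    and "attracting_Fatou_coordinate D f \<phi>att"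
    and "repelling_Fatou_coordinate D f P \<phi>rep r"
    and "extended_inverse_coordinate D f P \<phi>rep r \<psi>rep"
    and "is_parabolic_renormalization D f \<phi>att r \<psi>rep DR Rf"
    and "A \<in> attracting_axes Rf"
    and "is_immediate_basin DR Rf A BR"
    and "U \<in> components (exp_2pi_i -` BR)"
  shows "proper_restriction D f (virtual_basin \<psi>rep U N) (virtual_basin \<psi>rep U (N + 1))"
proof -
  note rep = assms(4) and ext = assms(5) and ren = assms(6) and imR = assms(8) and U = assms(9)
  obtain A' B G \<kappa> where f: "(D, f) \<in> parabolic_maps" "deriv (deriv f) 0 \<noteq> 0"
    and B: "is_immediate_basin D f A' B" and G: "G \<in> Blaschke_class \<tau>"
    and \<kappa>: "\<kappa> holomorphic_on B" "bij_betw \<kappa> B (ball 0 1)" "\<forall>z\<in>B. \<kappa> (f z) = G (\<kappa> z)"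
    using assms(2) unfolding Dyn_def degenerate_parabolic_maps_def by blast
  define c where "c = fps_nth (fps_expansion f 0) 2"
  have lt: "leading_term f 1 c" unfolding c_def by (rule nondegenerate_leading_term[OF f])
  note f' = parabolic_mapsD[OF f(1)]
  note B' = immediate_basin_invariant[OF f(1) B]
  have Bc: "B \<in> components (parabolic_basin D f)" using B by (simp add: is_immediate_basin_def)
  have Bo: "open B" using Bc open_parabolic_basin[OF f(1) lt] open_components by blast
  have BD: "B \<subseteq> D" using B'(2) parabolic_basinD(4) by blast
  have holB: "f holomorphic_on B" using f'(3) BD by (rule holomorphic_on_subset)
  have B0: "0 \<notin> B" using B'(2) parabolic_basinD(2)[of 0 D f 0] by auto
  have PD: "P \<subseteq> D" using rep by (auto simp: repelling_Fatou_coordinate_def repelling_petal_def)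
  have "proper_disc_map G"
  proof -
    obtain Gs where "list_all2 finite_Blaschke_product \<tau> Gs" "G = (\<lambda>z. fold (\<lambda>h w. h w) Gs z)"
      using G by (auto simp: Blaschke_class_def)
    moreover have "\<forall>d\<in>set \<tau>. d \<ge> 1" using assms(1) by (fastforce simp: composition_type_def)
    ultimately show ?thesis using proper_disc_map_fold by simp
  qed
  note proper = conjugate_proper[OF this Bo holB B'(1) \<kappa>(1,2) \<kappa>(3)[rule_format]]
  have surj: "f ` B = B"
    using proper_surjective[OF Bo in_components_connected[OF Bc] B'(3) holB B'(1) proper] .
  obtain a where a: "a \<noteq> 0" "a \<notin> B" using disc_image_omits[OF \<kappa>(1,2) B0] by blast
  have att: "continuous_on B \<phi>att" "\<And>z. z \<in> parabolic_basin D f \<Longrightarrow> \<phi>att (f z) = \<phi>att z + 1"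
    using assms(3) B'(2)
    by (auto simp: attracting_Fatou_coordinate_def
        intro: continuous_on_subset[OF holomorphic_on_imp_continuous_on])
  have DR: "DR = connected_component_set (insert 0 (exp_2pi_i ` horn_domain D f r \<psi>rep)) 0"
    using ren by (simp add: is_parabolic_renormalization_def)
  note DR' = renormalization_domain[OF f(1) lt B rep ext DR]
  obtain \<sigma> where R: "(DR, Rf) \<in> parabolic_maps"
    and \<sigma>: "\<And>z. z \<in> horn_domain D f r \<psi>rep \<Longrightarrow> exp_2pi_i z \<in> DR \<Longrightarrow>
               Rf (exp_2pi_i z) = exp_2pi_i (\<phi>att (\<psi>rep z) + \<sigma>)"
    using renormalization_parabolic[OF ren DR'(1,2)] by blast
  note BR' = immediate_basin_invariant[OF R imR]
  have BRc: "BR \<in> components (parabolic_basin DR Rf)" using imR by (simp add: is_immediate_basin_def)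
  obtain q b where "leading_term Rf q b" using assms(7) by (auto simp: attracting_axes_def)
  then have BRo: "open BR" using BRc open_parabolic_basin[OF R] open_components by blast
  have BRD: "BR \<subseteq> DR" "0 \<notin> BR"
    using BR'(2) parabolic_basinD(4) parabolic_basinD(2)[of 0 DR Rf 0] by auto
  have UE: "exp_2pi_i u \<in> BR" if "u \<in> U" for u using that in_components_subset[OF U] by blast
  have UX: "U \<subseteq> deep_horn_domain D f r \<psi>rep B"
  proof
    fix u assume "u \<in> U"
    then have "exp_2pi_i u \<in> exp_2pi_i ` deep_horn_domain D f r \<psi>rep B"
      using UE BRD DR'(3) exp_2pi_i_nonzero by blast
    then show "u \<in> deep_horn_domain D f r \<psi>rep B"
      using deep_horn_domain_int[OF PD ext f'(4) B'(1)] by (auto simp: exp_2pi_i_eq_iff)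
  qed
  have UX': "u + of_int k \<in> deep_horn_domain D f r \<psi>rep B" if "u \<in> U" for u k
    using deep_horn_domain_int[OF PD ext f'(4) B'(1)] UX that by blast
  have UH: "u + of_int k \<in> horn_domain D f r \<psi>rep" "\<psi>rep (u + of_int k) \<in> B" if "u \<in> U" for u k
    using UX'[OF that, of k] by (auto simp: deep_horn_domain_def dest: spec[of _ 0])
  define V where "V n = virtual_basin \<psi>rep U n" for n
  have VB: "V n \<subseteq> B" for n using UH(2) by (auto simp: V_def virtual_basin_def)
  have fV_step: "f (\<psi>rep (u + of_int n)) = \<psi>rep (u + of_int (n + 1))" if "u \<in> U" for u n
    using horn_domain_step(4)[OF PD ext f'(4) UH(1)[OF that, of n]] by (simp add: algebra_simps)
  have fV: "f ` V N \<subseteq> V (N + 1)"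
    using fV_step by (auto simp: V_def virtual_basin_def)
  have lclosed: "x \<in> V N" if x: "x \<in> B" "x \<in> closure (V N)" "f x \<in> V (N + 1)" for x
  proof -
    obtain u where u: "u \<in> U" "f x = \<psi>rep (u + of_int (N + 1))"
      using x(3) by (auto simp: V_def virtual_basin_def)
    have "exp_2pi_i (u + of_int (N + 1)) \<in> BR" unfolding exp_2pi_i_shift by (rule UE[OF u(1)])
    then have "exp_2pi_i (\<phi>att (f x) + \<sigma>) \<in> BR"
      using \<sigma>[OF UH(1)[OF u(1), of "N + 1"]] BRD BR'(1) u(2) by (metis image_subset_iff subsetD)
    moreover have "\<phi>att (f x) + \<sigma> = (\<phi>att x + \<sigma>) + of_int 1" using att(2) x(1) B'(2) by auto
    ultimately have "exp_2pi_i (\<phi>att x + \<sigma>) \<in> BR" by (simp only: exp_2pi_i_shift)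
    then show ?thesis
      unfolding V_def
      using virtual_basin_relatively_closed[OF f(1) lt B surj proper a att(1) rep ext DR
          parabolic_mapsD(4)[OF R] \<sigma> BRc BRo U UX x(1)] x(2) by (simp add: V_def)
  qed
  have comp: "compact (V N \<inter> f -` K)" if K: "K \<subseteq> V (N + 1)" "compact K" for K
  proof -
    have "compact {x\<in>B. f x \<in> K}" using K VB by (intro proper(1)) auto
    moreover have "closed (V N \<inter> f -` K)"
    proof -
      have "x \<in> V N \<inter> f -` K" if x: "x \<in> closure (V N \<inter> f -` K)" for x
      proof -
        have "closure (V N \<inter> f -` K) \<subseteq> {x\<in>B. f x \<in> K}"
          using compact_imp_closed[OF calculation] VB by (intro closure_minimal) auto
        then have "x \<in> B" "f x \<in> K" using x by auto
        moreover have "x \<in> closure (V N)" using x closure_mono[of "V N \<inter> f -` K" "V N"] by auto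
        ultimately show ?thesis using lclosed K(1) by auto
      qed
      then show ?thesis by (metis closure_subset_eq subsetI)
    qed
    moreover have "V N \<inter> f -` K = {x\<in>B. f x \<in> K} \<inter> (V N \<inter> f -` K)" using VB by auto
    ultimately show ?thesis using compact_Int_closed by metis
  qed
  have "proper_map (top_of_set (V N)) (top_of_set (V (N + 1))) f"
    unfolding proper_map_def
  proof
    show "closed_map (top_of_set (V N)) (top_of_set (V (N + 1))) f"
      unfolding closed_map_def using proper_map[OF _ comp fV] by blast
    show "\<forall>y\<in>topspace (top_of_set (V (N + 1))). compactin (top_of_set (V N)) {x \<in> topspace (top_of_set (V N)). f x = y}"
    proof
      fix y assume "y \<in> topspace (top_of_set (V (N + 1)))"
      then have "compact (V N \<inter> f -` {y})" by (intro comp) auto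
      moreover have "V N \<inter> f -` {y} = {x \<in> topspace (top_of_set (V N)). f x = y}" by auto
      ultimately show "compactin (top_of_set (V N)) {x \<in> topspace (top_of_set (V N)). f x = y}"
        by (simp add: compactin_subtopology)
    qed
  qed
  then show ?thesis
    using VB BD by (auto simp: proper_restriction_def V_def)
qed

end
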